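(* Let $\mathbb{X}$ be a Borel subset of a locally compact Polish space $\hat{\mathbb{X}}$, and let $[\mathbb{X}]$, $[[\mathbb{X}]]$, $\mathbb{X}^m_\sigma$ and $[\mathbb{X}^m_\sigma]$ be metrized by the Prokhorov-based distances $\mathrm{d}^{(P)}_{[\mathbb{X}]}$, $\mathrm{d}^{(P)}_{[[\mathbb{X}]]}$, $\mathrm{d}^{(P)}_{\mathbb{X}^m_\sigma}$ and $\mathrm{d}^{(P)}_{[\mathbb{X}^m_\sigma]}$ defined in the context. Let $q$ be a probability measure on $([\mathbb{X}],\mathscr{B}([\mathbb{X}]))$ and let $\rho$ be the exchangeable probability measure on $(\mathbb{X}^\infty,\mathscr{B}(\mathbb{X}^\infty))$ given by $\rho(C)=\int_{[\mathbb{X}]}\mathfrak{p}^\infty(C)\,q(\mathrm{d}\mathfrak{p})$ for $C\in\mathscr{B}(\mathbb{X}^\infty)$. Suppose that $\Pi_r(\tilde{\mathfrak{p}})\in\mathrm{L}^1(\mathbb{X}^\infty,\mathscr{B}(\mathbb{X}^\infty),\rho)$ for some $r>2$, with $\Pi_r$ as defined in the context. Put $$Y(\tilde{\mathfrak{p}}):=\left(\frac32\limsup_{n\to+\infty}\sqrt{\frac{n}{\log n}}\;\mathrm{d}^{(P)}_{[\mathbb{X}]}(\tilde{\mathfrak{p}},\tilde{\mathfrak{e}}_n)\right)^{1/2}.$$ Then $Y(\tilde{\mathfrak{p}})$ is finite $\rho$-a.s., $$\limsup_{n\to\infty}\left(\frac{n}{\log n}\right)^{1/4}\mathrm{d}^{(P)}_{[[\mathbb{X}]]}\big(q(\tilde{\boldsymbol{\xi}}^{(n)}),\delta_{\tilde{\mathfrak{e}}_n}\big)\le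 Y(\tilde{\mathfrak{p}})\qquad(\rho\text{-a.s.}),$$ and, for every $m\in\mathbb{N}$, $$\limsup_{n\to\infty}\left(\frac{n}{\log n}\right)^{1/8}\mathrm{d}^{(P)}_{[\mathbb{X}^m_\sigma]}\big(p_m(\tilde{\boldsymbol{\xi}}^{(n)}),\tilde{\mathfrak{e}}_n^m\big)\le\sqrt{\frac32\,Y(\tilde{\mathfrak{p}})}\qquad(\rho\text{-a.s.}).$$
   Context: For a separable metrizable space $\mathbb{S}$ with Borel $\sigma$-algebra $\mathscr{B}(\mathbb{S})$, $[\mathbb{S}]$ denotes the set of all probability measures on $(\mathbb{S},\mathscr{B}(\mathbb{S}))$, endowed with the topology of weak convergence and its Borel $\sigma$-algebra; $[[\mathbb{S}]]$ is the set of probability measures on $[\mathbb{S}]$. $\mathfrak{p}^m$ is the $m$-fold product measure. $\tilde{\xi}_1,\tilde{\xi}_2,\dots$ are the coordinate random elements of $\mathbb{X}^\infty$ and $\tilde{\boldsymbol{\xi}}^{(n)}:=(\tilde{\xi}_1,\dots,\tilde{\xi}_n)$. The empirical measure is $\tilde{\mathfrak{e}}_n:=\frac1n\sum_{i=1}^n\delta_{\tilde{\xi}_i}$, and $\delta_{\tilde{\mathfrak{e}}_n}\in[[\mathbb{X}]]$ is the point mass at $\tilde{\mathfrak{e}}_n$. Under $\rho$ there is a random probability measure $\tilde{\mathfrak{p}}$ ($\mathscr{B}(\mathbb{X}^\infty)/\mathscr{B}([\mathbb{X}])$-measurable, $\rho$-a.s. unique) with distribution $q$ such that $\tilde{\mathfrak{e}}_n$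 converges weakly to $\tilde{\mathfrak{p}}$, $\rho$-a.s. The posterior distribution $q(\tilde{\boldsymbol{\xi}}^{(n)})=q(\tilde{\boldsymbol{\xi}}^{(n)},\cdot)$ is a (fixed) regular conditional distribution of $\tilde{\mathfrak{p}}$ given $\tilde{\boldsymbol{\xi}}^{(n)}$ under $\rho$. The predictive distribution is $p_m(\tilde{\boldsymbol{\xi}}^{(n)},C):=\int_{[\mathbb{X}]}\mathfrak{p}^m(C)\,q(\tilde{\boldsymbol{\xi}}^{(n)},\mathrm{d}\mathfrak{p})$ for $C\in\mathscr{B}(\mathbb{X}^m)$. Metrics. The topology of $\mathbb{X}$ is given by a distance $\mathrm{d}_{\mathbb{X}}$, which is the restriction to $\mathbb{X}$ of a distance generating the topology of $\hat{\mathbb{X}}$. For a metric space $(\mathbb{S},\mathrm{d}_{\mathbb{S}})$ the Prokhorov distance on $[\mathbb{S}]$ is $$\mathrm{d}^{(P)}_{[\mathbb{S}]}(\mu_1,\mu_2):=\inf\{\epsilon>0:\ \mu_1(B)\le\mu_2(B^\epsilon)+\epsilon\ \ \forall B\in\mathscr{B}(\mathbb{S})\},\quad B^\epsilon:=\{x\in\mathbb{S}:\ \mathrm{d}_{\mathbb{S}}(x,y)<\epsilon\text{ for some }y\in B\}.$$ Then $\mathrm{d}^{(P)}_{[\mathbb{X}]}$ is the Prokhorov distance with ground space $(\mathbb{X},\mathrm{d}_{\mathbb{X}})$, and $\mathrm{d}^{(P)}_{[[\mathbb{X}]]}$ is the Prokhorov distance with ground space $([\mathbb{X}],\mathrm{d}^{(P)}_{[\mathbb{X}]})$.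 $\mathbb{X}^m_\sigma:=\mathbb{X}^m/\!\sim$, where $\sim$ identifies $(x_1,\dots,x_m)$ with $(x_{\tau(1)},\dots,x_{\tau(m)})$ for every permutation $\tau$ of $\{1,\dots,m\}$, is metrized by $\mathrm{d}^{(P)}_{\mathbb{X}^m_\sigma}([(x_1,\dots,x_m)],[(y_1,\dots,y_m)]):=\mathrm{d}^{(P)}_{[\mathbb{X}]}\big(\frac1m\sum_{i=1}^m\delta_{x_i},\frac1m\sum_{i=1}^m\delta_{y_i}\big)$, and $\mathrm{d}^{(P)}_{[\mathbb{X}^m_\sigma]}$ is the Prokhorov distance with ground space $(\mathbb{X}^m_\sigma,\mathrm{d}^{(P)}_{\mathbb{X}^m_\sigma})$. The measures $p_m(\tilde{\boldsymbol{\xi}}^{(n)})$ and $\tilde{\mathfrak{e}}_n^m$ on $\mathbb{X}^m$ are identified with their images on $\mathbb{X}^m_\sigma$ under the quotient map. Discretization. Fix an increasing sequence of compact subsets $\hat{\mathbb{K}}_m$ ($m\in\mathbb{N}$) of $\hat{\mathbb{X}}$ converging to (i.e. with union) $\hat{\mathbb{X}}$ and, for each $m$, a finite Borel partition $\{A_{m,j}\}_{j=1,\dots,k_m}$ of $\hat{\mathbb{K}}_m$ with $\mathrm{diam}(A_{m,j})\le 1/m$ (these exist). Put $A_{m,k_m+1}:=\hat{\mathbb{X}}\setminus\hat{\mathbb{K}}_m$ and, for $r>2$ and $\mathfrak{p}\in[\mathbb{X}]$, $$\Pi_r(\mathfrak{p}):=\liminf_{m\to+\infty}\sum_{j=1}^{k_m+1}\big[\mathfrak{p}(A_{m,j}\cap\mathbb{X})\,(1-\mathfrak{p}(A_{m,j}\cap\mathbb{X}))\big]^{1/r}.$$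 *)

theory Defs
  imports "HOL-Probability.Probability"
begin

section \<open>Borel sets and spaces of probability measures over an abstract topology\<close>

definition borel_of :: "'a topology \<Rightarrow> 'a measure" where
  "borel_of T = sigma (topspace T) {U. openin T U}"

lemma space_borel_of [simp]: "space (borel_of T) = topspace T"
  by (simp add: borel_of_def space_measure_of_conv)

lemma sets_borel_of: "sets (borel_of T) = sigma_sets (topspace T) {U. openin T U}"
  unfolding borel_of_def by (rule sets_measure_of) (auto dest: openin_subset)

lemma borel_of_open: "openin T U \<Longrightarrow> U \<in> sets (borel_of T)"
  by (auto simp: sets_borel_of)

lemma sets_borel_of_closed: "sets (borel_of T) = sigma_sets (topspace T) {C. closedin T C}"
  unfolding sets_borel_of
proof (rule sigma_sets_eqI)
  fix U assume "U \<in> {U. openin T U}"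
  then have "topspace T - U \<in> {C. closedin T C}" "U = topspace T - (topspace T - U)"
    using openin_subset by auto
  then show "U \<in> sigma_sets (topspace T) {C. closedin T C}"
    by (metis sigma_sets.Basic sigma_sets.Compl)
next
  fix C assume "C \<in> {C. closedin T C}"
  then have "topspace T - C \<in> {U. openin T U}" "C = topspace T - (topspace T - C)"
    using closedin_subset by auto
  then show "C \<in> sigma_sets (topspace T) {U. openin T U}"
    by (metis sigma_sets.Basic sigma_sets.Compl)
qed

lemma continuous_map_measurable:
  assumes f: "continuous_map T euclideanreal f"
  shows "f \<in> borel_measurable (borel_of T)"
proof (rule borel_measurableI)
  fix U :: "real set" assume "open U"
  then have "openin T {x \<in> topspace T. f x \<in> U}"
    using f by (auto simp: continuous_map_def)
  moreover have "f -` U \<inter> space (borel_of T) = {x \<in> topspace T. f x \<in> U}" by auto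
  ultimately show "f -` U \<inter> space (borel_of T) \<in> sets (borel_of T)"
    by (simp add: borel_of_open)
qed

definition prob_measures :: "'a topology \<Rightarrow> 'a measure set" where
  "prob_measures T = {P. prob_space P \<and> sets P = sets (borel_of T)}"

text \<open>
  The topology of weak convergence on the set of Borel probability measures: the coarsest
  topology that makes \<open>P \<mapsto> \<integral> f dP\<close> continuous for every bounded continuous real function \<open>f\<close>.
\<close>

definition weak_topology :: "'a topology \<Rightarrow> 'a measure topology" where
  "weak_topology T = topology_generated_by
     {{P \<in> prob_measures T. (\<integral>x. f x \<partial>P) \<in> U} | f U.
        continuous_map T euclideanreal f \<and> bounded (f ` topspace T) \<and> open U}"

lemma topspace_weak_topology [simp]: "topspace (weak_topology T) = prob_measures T"
proof -
  have "prob_measures T \<in> {{P \<in> prob_measures T. (\<integral>x. f x \<partial>P) \<in> U} | f U.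
        continuous_map T euclideanreal f \<and> bounded (f ` topspace T) \<and> open U}"
    by (rule CollectI, rule exI[of _ "\<lambda>_. 0"], rule exI[of _ UNIV]) (auto simp: image_constant_conv)
  then show ?thesis
    unfolding weak_topology_def topology_generated_by_topspace by blast
qed

lemma continuous_map_weak_integral:
  assumes "continuous_map T euclideanreal f" "bounded (f ` topspace T)"
  shows "continuous_map (weak_topology T) euclideanreal (\<lambda>P. \<integral>x. f x \<partial>P)"
  unfolding continuous_map_def topspace_weak_topology
  using assms by (auto simp: weak_topology_def intro!: topology_generated_by_Basis)

lemma measurable_weak_topology:
  assumes T: "metrizable_space T"
  shows "(\<lambda>P. P) \<in> borel_of (weak_topology T) \<rightarrow>\<^sub>M prob_algebra (borel_of T)"
proof -
  have closed: "(\<lambda>P. emeasure P C) \<in> borel_measurable (borel_of (weak_topology T))"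
    if C: "closedin T C" for C
  proof -
    obtain U where U: "\<And>n. openin T (U n)" "\<And>n. U (Suc n) \<subseteq> U n" "\<Inter>(range U) = C"
      using closed_imp_gdelta_in[OF T C] unfolding gdelta_in_descending by blast
    have "\<exists>f. continuous_map T (top_of_set {0..1::real}) f \<and> f ` (topspace T - U n) \<subseteq> {0} \<and> f ` C \<subseteq> {1}" for n
    proof -
      have "disjnt (topspace T - U n) C" using U(3) by (auto simp: disjnt_def)
      then show ?thesis
        using Urysohn_lemma[OF metrizable_imp_normal_space[OF T], of "topspace T - U n" C 0 1] C U(1)
        by (metis closedin_diff closedin_topspace zero_le_one)
    qed
    then obtain f where f: "\<And>n. continuous_map T (top_of_set {0..1::real}) (f n)"
        "\<And>n. f n ` (topspace T - U n) \<subseteq> {0}" "\<And>n. f n ` C \<subseteq> {1}" by metis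
    have cf: "continuous_map T euclideanreal (f n)" and rf: "x \<in> topspace T \<Longrightarrow> f n x \<in> {0..1}" for n x
      using f(1)[of n] by (auto simp: continuous_map_in_subtopology)
    have bf: "bounded (f n ` topspace T)" for n
      by (rule bounded_subset[of "{0..1}"]) (use rf in auto)
    have lim: "(\<lambda>n. f n x) \<longlonglongrightarrow> indicator C x" if x: "x \<in> topspace T" for x
    proof (cases "x \<in> C")
      case True
      then have "f n x = 1" for n using f(3) by blast
      then show ?thesis using True by simp
    next
      case False
      then obtain N where N: "x \<notin> U N" using U(3) by blast
      have "f n x = 0" if "n \<ge> N" for n
      proof -
        have "U n \<subseteq> U N" using that U(2) by (rule lift_Suc_antimono_le[rotated])
        then have "x \<in> topspace T - U n" using N x by blast
        then show ?thesis using f(2) by blast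
      qed
      then have "eventually (\<lambda>n. f n x = indicator C x) sequentially"
        using False by (auto simp: eventually_sequentially)
      then show ?thesis by (rule tendsto_eventually)
    qed
    have "(\<lambda>P. measure P C) \<in> borel_measurable (borel_of (weak_topology T))"
    proof (rule borel_measurable_LIMSEQ_real)
      show "(\<lambda>P. \<integral>x. f n x \<partial>P) \<in> borel_measurable (borel_of (weak_topology T))" for n
        by (intro continuous_map_measurable continuous_map_weak_integral cf bf)
      fix P assume "P \<in> space (borel_of (weak_topology T))"
      then have P: "prob_space P" "sets P = sets (borel_of T)" by (auto simp: prob_measures_def)
      interpret prob_space P by fact
      have sp: "space P = topspace T" using sets_eq_imp_space_eq[OF P(2)] by simp
      have CP: "C \<in> sets P" unfolding P(2) using C by (simp add: sets_borel_of_closed)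
      have "(\<lambda>n. \<integral>x. f n x \<partial>P) \<longlonglongrightarrow> (\<integral>x. indicator C x \<partial>P)"
      proof (rule integral_dominated_convergence[where w="\<lambda>_. 1"])
        show "indicat_real C \<in> borel_measurable P" using CP by simp
        show "f n \<in> borel_measurable P" for n
          using continuous_map_measurable[OF cf] P(2) by (simp cong: measurable_cong_sets)
        show "AE x in P. (\<lambda>n. f n x) \<longlonglongrightarrow> indicat_real C x"
          by (rule AE_I2) (use lim sp in auto)
        show "AE x in P. norm (f n x) \<le> 1" for n
          by (rule AE_I2) (use rf sp in auto)
      qed simp
      then show "(\<lambda>n. \<integral>x. f n x \<partial>P) \<longlonglongrightarrow> measure P C" using CP by simp
    qed
    then have "(\<lambda>P. ennreal (measure P C)) \<in> borel_measurable (borel_of (weak_topology T))" by measurable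
    then show ?thesis
      by (rule measurable_cong[THEN iffD1, rotated])
         (auto simp: prob_measures_def intro!: finite_measure.emeasure_eq_measure[symmetric] prob_space.finite_measure)
  qed
  have "(\<lambda>P. P) \<in> borel_of (weak_topology T) \<rightarrow>\<^sub>M subprob_algebra (borel_of T)"
  proof (rule measurable_subprob_algebra_generated[OF sets_borel_of_closed])
    show "Int_stable {C. closedin T C}" by (auto simp: Int_stable_def)
    show "{C. closedin T C} \<subseteq> Pow (topspace T)" by (auto dest: closedin_subset)
    show "\<And>P. P \<in> space (borel_of (weak_topology T)) \<Longrightarrow> subprob_space P"
      by (auto simp: prob_measures_def prob_space_imp_subprob_space)
    show "\<And>P. P \<in> space (borel_of (weak_topology T)) \<Longrightarrow> sets P = sets (borel_of T)"
      by (auto simp: prob_measures_def)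
  qed (use closed in auto)
  then show ?thesis
    unfolding prob_algebra_def
    by (intro measurable_restrict_space2) (auto simp: prob_measures_def)
qed

text \<open>
  Products of Borel spaces are formed with \<^const>\<open>PiM\<close>. For countable products of second
  countable spaces this is the Borel \<open>\<sigma>\<close>-algebra of the product topology.
\<close>

lemma sets_PiM_borel_of:
  assumes T: "second_countable T" and I: "countable I"
  shows "sets (\<Pi>\<^sub>M i\<in>I. borel_of T) = sets (borel_of (product_topology (\<lambda>_. T) I))"
proof (rule antisym)
  let ?P = "product_topology (\<lambda>_. T) I"
  have "(\<lambda>x. x) \<in> borel_of ?P \<rightarrow>\<^sub>M (\<Pi>\<^sub>M i\<in>I. borel_of T)"
  proof (rule measurable_PiM_single')
    fix i assume i: "i \<in> I"
    show "(\<lambda>x. x i) \<in> borel_of ?P \<rightarrow>\<^sub>M borel_of T"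
      unfolding borel_of_def[of T]
    proof (rule measurable_measure_of)
      show "(\<lambda>x. x i) \<in> space (borel_of ?P) \<rightarrow> topspace T" using i by (auto simp: PiE_iff)
      fix U assume "U \<in> {U. openin T U}"
      then have "openin ?P {x \<in> topspace ?P. x i \<in> U}"
        using continuous_map_product_projection[OF i, of "\<lambda>_. T"] by (auto simp: continuous_map_def)
      moreover have "(\<lambda>x. x i) -` U \<inter> space (borel_of ?P) = {x \<in> topspace ?P. x i \<in> U}" by auto
      ultimately show "(\<lambda>x. x i) -` U \<inter> space (borel_of ?P) \<in> sets (borel_of ?P)"
        by (simp add: borel_of_open)
    qed (auto dest: openin_subset)
  qed (auto simp: PiE_iff)
  then show "sets (\<Pi>\<^sub>M i\<in>I. borel_of T) \<subseteq> sets (borel_of ?P)"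
  proof (intro subsetI)
    fix C assume f: "(\<lambda>x. x) \<in> borel_of ?P \<rightarrow>\<^sub>M (\<Pi>\<^sub>M i\<in>I. borel_of T)"
      and C: "C \<in> sets (\<Pi>\<^sub>M i\<in>I. borel_of T)"
    have "(\<lambda>x. x) -` C \<inter> space (borel_of ?P) = C"
      using sets.sets_into_space[OF C] by (auto simp: space_PiM)
    with measurable_sets[OF f C] show "C \<in> sets (borel_of ?P)" by simp
  qed
next
  let ?P = "product_topology (\<lambda>_. T) I"
  obtain \<B> where \<B>_all: "countable \<B> \<and> (\<forall>V\<in>\<B>. openin T V) \<and>
      (\<forall>U x. openin T U \<and> x \<in> U \<longrightarrow> (\<exists>V\<in>\<B>. x \<in> V \<and> V \<subseteq> U))"
    using T unfolding second_countable_def ..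
  then have \<B>: "countable \<B>" "\<And>V. V \<in> \<B> \<Longrightarrow> openin T V"
      "\<And>U x. openin T U \<Longrightarrow> x \<in> U \<Longrightarrow> \<exists>V\<in>\<B>. x \<in> V \<and> V \<subseteq> U"
    by simp_all
  define box where "box F B = (\<Pi>\<^sub>E i\<in>I. if i \<in> F then B i else topspace T)" for F and B :: "'b \<Rightarrow> 'a set"
  define \<C> where "\<C> = (\<Union>F\<in>{F. finite F \<and> F \<subseteq> I}. box F ` (\<Pi>\<^sub>E i\<in>F. \<B>))"
  have cC: "countable \<C>"
    unfolding \<C>_def using I \<B>(1)
    by (intro countable_UN countable_Collect_finite_subset countable_image countable_PiE) auto
  have C_sets: "C \<in> sets (\<Pi>\<^sub>M i\<in>I. borel_of T)" if CC: "C \<in> \<C>" for C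
  proof -
    obtain F B where F: "finite F" "F \<subseteq> I" and B: "B \<in> (\<Pi>\<^sub>E i\<in>F. \<B>)" and C: "C = box F B"
      using CC by (auto simp: \<C>_def)
    have "B i \<in> sets (borel_of T)" if i: "i \<in> F" for i
      using B \<B>(2) i by (intro borel_of_open) (auto simp: PiE_iff)
    moreover have "topspace T \<in> sets (borel_of T)"
      by (rule borel_of_open) simp
    ultimately show ?thesis
      unfolding C box_def using I by (intro sets_PiM_I_countable) simp_all
  qed
  have "U \<in> sets (\<Pi>\<^sub>M i\<in>I. borel_of T)" if U: "openin ?P U" for U
  proof -
    have "U = \<Union>{C \<in> \<C>. C \<subseteq> U}"
    proof (intro equalityI subsetI)
      fix x assume x: "x \<in> U"
      obtain V where V: "finite {i \<in> I. V i \<noteq> topspace T}" "\<And>i. i \<in> I \<Longrightarrow> openin T (V i)"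
          "x \<in> Pi\<^sub>E I V" "Pi\<^sub>E I V \<subseteq> U"
        using U x unfolding openin_product_topology_alt by metis
      define F where "F = {i \<in> I. V i \<noteq> topspace T}"
      have "\<forall>i\<in>F. \<exists>W\<in>\<B>. x i \<in> W \<and> W \<subseteq> V i"
        using V(2,3) \<B>(3) unfolding F_def by (auto simp: PiE_iff)
      then have "\<exists>B. \<forall>i\<in>F. B i \<in> \<B> \<and> x i \<in> B i \<and> B i \<subseteq> V i"
        by (intro bchoice) blast
      then obtain B where B: "\<And>i. i \<in> F \<Longrightarrow> B i \<in> \<B> \<and> x i \<in> B i \<and> B i \<subseteq> V i" by blast
      have "box F (restrict B F) \<in> \<C>"
        unfolding \<C>_def using V(1) B by (auto simp: F_def)
      moreover have "x \<in> box F (restrict B F)"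
        using V(3) B openin_subset[OF V(2)] unfolding box_def PiE_iff by auto
      moreover have "box F (restrict B F) \<subseteq> Pi\<^sub>E I V"
        unfolding box_def using B by (intro PiE_mono) (auto simp: F_def)
      ultimately show "x \<in> \<Union>{C \<in> \<C>. C \<subseteq> U}" using V(4) by blast
    qed auto
    also have "\<dots> \<in> sets (\<Pi>\<^sub>M i\<in>I. borel_of T)"
      by (rule sets.countable_Union) (use cC C_sets in \<open>auto intro: countable_subset\<close>)
    finally show ?thesis .
  qed
  then have "{U. openin ?P U} \<subseteq> sets (\<Pi>\<^sub>M i\<in>I. borel_of T)" by auto
  then have "sigma_sets (space (\<Pi>\<^sub>M i\<in>I. borel_of T)) {U. openin ?P U} \<subseteq> sets (\<Pi>\<^sub>M i\<in>I. borel_of T)"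
    by (rule sets.sigma_sets_subset)
  then show "sets (borel_of ?P) \<subseteq> sets (\<Pi>\<^sub>M i\<in>I. borel_of T)"
    by (simp add: sets_borel_of space_PiM)
qed

lemma measurable_PiM_prob_algebra:
  "(\<lambda>P. \<Pi>\<^sub>M i\<in>I. P) \<in> prob_algebra M \<rightarrow>\<^sub>M prob_algebra (\<Pi>\<^sub>M i\<in>I. M)"
proof (rule measurable_prob_algebra_generated[OF sets_PiM Int_stable_prod_algebra prod_algebra_sets_into_space])
  fix P assume "P \<in> space (prob_algebra M)"
  then have P: "prob_space P" "sets P = sets M" by (auto simp: space_prob_algebra)
  show "prob_space (\<Pi>\<^sub>M i\<in>I. P)" using P by (intro prob_space_PiM)
  show "sets (\<Pi>\<^sub>M i\<in>I. P) = sets (\<Pi>\<^sub>M i\<in>I. M)" using P by (intro sets_PiM_cong) auto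
next
  fix A assume "A \<in> prod_algebra I (\<lambda>_. M)"
  then obtain J E where J: "A = prod_emb I (\<lambda>_. M) J (Pi\<^sub>E J E)" "finite J" "J \<subseteq> I"
      "\<And>i. i \<in> J \<Longrightarrow> E i \<in> sets M"
    by (elim prod_algebraE) auto
  have "(\<lambda>P. emeasure P (E i)) \<in> borel_measurable (prob_algebra M)" if "i \<in> J" for i
    using measurable_prob_algebraD[OF measurable_ident_sets[OF refl]] J(4)[OF that]
    by (rule measurable_emeasure_kernel)
  then have "(\<lambda>P. \<Prod>i\<in>J. emeasure P (E i)) \<in> borel_measurable (prob_algebra M)"
    by (rule borel_measurable_prod_ennreal)
  moreover have "emeasure (\<Pi>\<^sub>M i\<in>I. P) A = (\<Prod>i\<in>J. emeasure P (E i))" if "P \<in> space (prob_algebra M)" for P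
  proof -
    have P: "prob_space P" "sets P = sets M" using that by (auto simp: space_prob_algebra)
    have "A = prod_emb I (\<lambda>_. P) J (Pi\<^sub>E J E)"
      using sets_eq_imp_space_eq[OF P(2)] by (simp add: J(1) prod_emb_def)
    then show ?thesis using J P by (simp add: emeasure_PiM_emb)
  qed
  ultimately show "(\<lambda>P. emeasure (\<Pi>\<^sub>M i\<in>I. P) A) \<in> borel_measurable (prob_algebra M)"
    by (subst measurable_cong) auto
qed


section \<open>Prokhorov distance\<close>

text \<open>
  Here \<open>d\<close> is a distance on \<open>topspace T\<close> that induces \<open>T\<close>; the balls are those of the
  ground space, so points outside \<open>topspace T\<close> play no role.
\<close>

definition prokhorov :: "'a topology \<Rightarrow> ('a \<Rightarrow> 'a \<Rightarrow> real) \<Rightarrow> 'a measure \<Rightarrow> 'a measure \<Rightarrow> real" where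
  "prokhorov T d \<mu> \<nu> =
     Inf {\<epsilon>. \<epsilon> > 0 \<and> (\<forall>B\<in>sets (borel_of T).
            measure \<mu> B \<le> measure \<nu> {x \<in> topspace T. \<exists>y\<in>B. d x y < \<epsilon>} + \<epsilon>)}"

context Metric_space
begin

definition nbhd :: "'a set \<Rightarrow> real \<Rightarrow> 'a set" where
  "nbhd B \<epsilon> = {x \<in> M. \<exists>y\<in>B. d x y < \<epsilon>}"

definition prokhorov_set :: "'a measure \<Rightarrow> 'a measure \<Rightarrow> real set" where
  "prokhorov_set \<mu> \<nu> = {\<epsilon>. \<epsilon> > 0 \<and> (\<forall>B\<in>sets (borel_of mtopology). measure \<mu> B \<le> measure \<nu> (nbhd B \<epsilon>) + \<epsilon>)}"

lemma prokhorov_Inf: "prokhorov mtopology d \<mu> \<nu> = Inf (prokhorov_set \<mu> \<nu>)"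
  by (simp add: prokhorov_def prokhorov_set_def nbhd_def)

lemma openin_nbhd: assumes "B \<subseteq> M" shows "openin mtopology (nbhd B \<epsilon>)"
proof -
  have "nbhd B \<epsilon> = (\<Union>y\<in>B. mball y \<epsilon>)" using assms commute by (fastforce simp: nbhd_def)
  then show ?thesis by auto
qed

lemma borel_subset: "B \<in> sets (borel_of mtopology) \<Longrightarrow> B \<subseteq> M"
  using sets.sets_into_space by fastforce

lemma sets_nbhd: "B \<in> sets (borel_of mtopology) \<Longrightarrow> nbhd B \<epsilon> \<in> sets (borel_of mtopology)"
  by (rule borel_of_open[OF openin_nbhd[OF borel_subset]])

lemma nbhd_mono: "\<epsilon> \<le> \<delta> \<Longrightarrow> nbhd B \<epsilon> \<subseteq> nbhd B \<delta>"
  by (auto simp: nbhd_def) (meson order_less_le_trans)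

lemma bdd_below_prokhorov_set: "bdd_below (prokhorov_set \<mu> \<nu>)"
  by (rule bdd_belowI[of _ 0]) (auto simp: prokhorov_set_def)

lemma prokhorov_set_nonempty:
  assumes "\<mu> \<in> prob_measures mtopology"
  shows "1 \<in> prokhorov_set \<mu> \<nu>"
proof -
  have "measure \<mu> B \<le> measure \<nu> (nbhd B 1) + 1" for B
    using assms prob_space.prob_le_1[of \<mu> B] by (simp add: prob_measures_def add_increasing)
  then show ?thesis by (simp add: prokhorov_set_def)
qed

lemma prokhorov_nonneg:
  assumes "\<mu> \<in> prob_measures mtopology"
  shows "0 \<le> prokhorov mtopology d \<mu> \<nu>"
  unfolding prokhorov_Inf
proof (rule cInf_greatest)
  show "prokhorov_set \<mu> \<nu> \<noteq> {}" using prokhorov_set_nonempty[OF assms, of \<nu>] by blast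
qed (simp add: prokhorov_set_def)

lemma prokhorov_set_sym_subset:
  assumes \<mu>: "\<mu> \<in> prob_measures mtopology" and \<nu>: "\<nu> \<in> prob_measures mtopology"
  shows "prokhorov_set \<mu> \<nu> \<subseteq> prokhorov_set \<nu> \<mu>"
proof
  fix \<epsilon> assume e: "\<epsilon> \<in> prokhorov_set \<mu> \<nu>"
  interpret m: prob_space \<mu> using \<mu> by (simp add: prob_measures_def)
  interpret n: prob_space \<nu> using \<nu> by (simp add: prob_measures_def)
  have s: "sets \<mu> = sets (borel_of mtopology)" "sets \<nu> = sets (borel_of mtopology)"
    using \<mu> \<nu> by (auto simp: prob_measures_def)
  have sp: "space \<mu> = M" "space \<nu> = M" using s[THEN sets_eq_imp_space_eq] by auto
  have "measure \<nu> B \<le> measure \<mu> (nbhd B \<epsilon>) + \<epsilon>" if B: "B \<in> sets (borel_of mtopology)" for B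
  proof -
    let ?C = "M - nbhd B \<epsilon>"
    have N: "nbhd B \<epsilon> \<in> sets (borel_of mtopology)" by (rule sets_nbhd[OF B])
    have C: "?C \<in> sets (borel_of mtopology)" using sets.compl_sets[OF N] by simp
    have "nbhd ?C \<epsilon> \<subseteq> M - B"
    proof
      fix x assume "x \<in> nbhd ?C \<epsilon>"
      then obtain y where xy: "x \<in> M" "y \<in> M" "y \<notin> nbhd B \<epsilon>" "d x y < \<epsilon>"
        by (auto simp: nbhd_def)
      then have "x \<notin> B" using commute[of x y] by (auto simp: nbhd_def)
      then show "x \<in> M - B" using xy by blast
    qed
    then have "measure \<nu> (nbhd ?C \<epsilon>) \<le> measure \<nu> (M - B)"
      using B sets.compl_sets[OF B] by (intro n.finite_measure_mono) (auto simp: s)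
    moreover have "measure \<mu> ?C \<le> measure \<nu> (nbhd ?C \<epsilon>) + \<epsilon>"
      using e C by (auto simp: prokhorov_set_def)
    moreover have "measure \<mu> ?C = 1 - measure \<mu> (nbhd B \<epsilon>)"
      using m.prob_compl[of "nbhd B \<epsilon>"] N by (simp add: s sp)
    moreover have "measure \<nu> (M - B) = 1 - measure \<nu> B"
      using n.prob_compl[of B] B by (simp add: s sp)
    ultimately show ?thesis by linarith
  qed
  then show "\<epsilon> \<in> prokhorov_set \<nu> \<mu>" using e by (auto simp: prokhorov_set_def)
qed

lemma prokhorov_less:
  assumes "\<mu> \<in> prob_measures mtopology" "prokhorov mtopology d \<mu> \<nu> < c"
  obtains a where "a \<in> prokhorov_set \<mu> \<nu>" "a < c"
proof -
  have "prokhorov_set \<mu> \<nu> \<noteq> {}" using prokhorov_set_nonempty[OF assms(1), of \<nu>] by blast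
  from cInf_lessD[OF this assms(2)[unfolded prokhorov_Inf]] show thesis using that by blast
qed

lemma prokhorov_commute:
  assumes "\<mu> \<in> prob_measures mtopology" "\<nu> \<in> prob_measures mtopology"
  shows "prokhorov mtopology d \<mu> \<nu> = prokhorov mtopology d \<nu> \<mu>"
  unfolding prokhorov_Inf using prokhorov_set_sym_subset assms by (metis subset_antisym)

lemma prokhorov_triangle:
  assumes \<mu>: "\<mu> \<in> prob_measures mtopology" and \<nu>: "\<nu> \<in> prob_measures mtopology"
    and \<kappa>: "\<kappa> \<in> prob_measures mtopology"
  shows "prokhorov mtopology d \<mu> \<kappa> \<le> prokhorov mtopology d \<mu> \<nu> + prokhorov mtopology d \<nu> \<kappa>"
proof (rule field_le_epsilon)
  fix e :: real assume e: "e > 0"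
  have "prokhorov mtopology d \<mu> \<nu> < prokhorov mtopology d \<mu> \<nu> + e / 2" using e by simp
  then obtain a where a: "a \<in> prokhorov_set \<mu> \<nu>" "a < prokhorov mtopology d \<mu> \<nu> + e / 2"
    by (rule prokhorov_less[OF \<mu>])
  have "prokhorov mtopology d \<nu> \<kappa> < prokhorov mtopology d \<nu> \<kappa> + e / 2" using e by simp
  then obtain b where b: "b \<in> prokhorov_set \<nu> \<kappa>" "b < prokhorov mtopology d \<nu> \<kappa> + e / 2"
    by (rule prokhorov_less[OF \<nu>])
  have sl: "sets \<kappa> = sets (borel_of mtopology)" using \<kappa> by (simp add: prob_measures_def)
  interpret l: prob_space \<kappa> using \<kappa> by (simp add: prob_measures_def)
  have "measure \<mu> B \<le> measure \<kappa> (nbhd B (a + b)) + (a + b)" if B: "B \<in> sets (borel_of mtopology)" for B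
  proof -
    have "nbhd (nbhd B a) b \<subseteq> nbhd B (a + b)"
    proof
      fix x assume "x \<in> nbhd (nbhd B a) b"
      then obtain y z where "x \<in> M" "y \<in> M" "z \<in> B" "d x y < b" "d y z < a" by (auto simp: nbhd_def)
      moreover have "z \<in> M" using borel_subset[OF B] \<open>z \<in> B\<close> by blast
      ultimately have "d x z < a + b" using triangle[of x y z] by linarith
      then show "x \<in> nbhd B (a + b)" using \<open>x \<in> M\<close> \<open>z \<in> B\<close> by (auto simp: nbhd_def)
    qed
    then have "measure \<kappa> (nbhd (nbhd B a) b) \<le> measure \<kappa> (nbhd B (a + b))"
      using sets_nbhd[OF B] by (intro l.finite_measure_mono) (auto simp: sl)
    moreover have "measure \<mu> B \<le> measure \<nu> (nbhd B a) + a" using a(1) B by (auto simp: prokhorov_set_def)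
    moreover have "measure \<nu> (nbhd B a) \<le> measure \<kappa> (nbhd (nbhd B a) b) + b"
      using b(1) sets_nbhd[OF B] by (auto simp: prokhorov_set_def)
    ultimately show ?thesis by linarith
  qed
  then have "a + b \<in> prokhorov_set \<mu> \<kappa>" using a(1) b(1) by (auto simp: prokhorov_set_def)
  then have "prokhorov mtopology d \<mu> \<kappa> \<le> a + b"
    unfolding prokhorov_Inf by (rule cInf_lower[OF _ bdd_below_prokhorov_set])
  then show "prokhorov mtopology d \<mu> \<kappa> \<le> prokhorov mtopology d \<mu> \<nu> + prokhorov mtopology d \<nu> \<kappa> + e"
    using a(2) b(2) by linarith
qed

lemma prokhorov_self:
  assumes \<mu>: "\<mu> \<in> prob_measures mtopology"
  shows "prokhorov mtopology d \<mu> \<mu> = 0"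
proof (rule antisym[OF field_le_epsilon prokhorov_nonneg[OF \<mu>]])
  fix e :: real assume e: "e > 0"
  interpret m: prob_space \<mu> using \<mu> by (simp add: prob_measures_def)
  have sm: "sets \<mu> = sets (borel_of mtopology)" using \<mu> by (simp add: prob_measures_def)
  have "measure \<mu> B \<le> measure \<mu> (nbhd B e) + e" if B: "B \<in> sets (borel_of mtopology)" for B
  proof -
    have "B \<subseteq> nbhd B e" using borel_subset[OF B] e by (force simp: nbhd_def)
    then have "measure \<mu> B \<le> measure \<mu> (nbhd B e)"
      using sets_nbhd[OF B] by (intro m.finite_measure_mono) (auto simp: sm)
    then show ?thesis using e by linarith
  qed
  then have "e \<in> prokhorov_set \<mu> \<mu>" using e by (auto simp: prokhorov_set_def)
  then show "prokhorov mtopology d \<mu> \<mu> \<le> 0 + e"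
    unfolding prokhorov_Inf by (simp add: cInf_lower bdd_below_prokhorov_set)
qed

lemma prokhorov_zero_closed_le:
  assumes \<mu>: "\<mu> \<in> prob_measures mtopology" and \<nu>: "\<nu> \<in> prob_measures mtopology"
    and 0: "prokhorov mtopology d \<mu> \<nu> = 0" and C: "closedin mtopology C"
  shows "measure \<mu> C \<le> measure \<nu> C"
proof -
  interpret n: prob_space \<nu> using \<nu> by (simp add: prob_measures_def)
  have sn: "sets \<nu> = sets (borel_of mtopology)" using \<nu> by (simp add: prob_measures_def)
  have CB: "C \<in> sets (borel_of mtopology)" using C by (simp add: sets_borel_of_closed)
  let ?e = "\<lambda>n. inverse (real (Suc n))"
  have ineq: "measure \<mu> C \<le> measure \<nu> (nbhd C (?e n)) + ?e n" for n
  proof -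
    have "prokhorov mtopology d \<mu> \<nu> < ?e n" using 0 by simp
    then obtain a where a: "a \<in> prokhorov_set \<mu> \<nu>" "a < ?e n"
      by (rule prokhorov_less[OF \<mu>])
    have "measure \<nu> (nbhd C a) \<le> measure \<nu> (nbhd C (?e n))"
      using sets_nbhd[OF CB] nbhd_mono[of a "?e n" C] a(2) by (intro n.finite_measure_mono) (auto simp: sn)
    moreover have "measure \<mu> C \<le> measure \<nu> (nbhd C a) + a" using a(1) CB by (auto simp: prokhorov_set_def)
    ultimately show ?thesis using a(2) by linarith
  qed
  have "(\<Inter>n. nbhd C (?e n)) = C"
  proof (intro equalityI subsetI)
    fix x assume x: "x \<in> (\<Inter>n. nbhd C (?e n))"
    show "x \<in> C"
    proof (rule ccontr)
      assume "x \<notin> C"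
      moreover have "x \<in> M" using x by (auto simp: nbhd_def)
      ultimately obtain r where r: "r > 0" "disjnt C (mball x r)"
        using C unfolding closedin_metric by blast
      obtain n where "?e n < r" using reals_Archimedean[OF r(1)] by blast
      moreover obtain y where "y \<in> C" "d x y < ?e n" using x by (auto simp: nbhd_def)
      moreover have "y \<in> M" using \<open>y \<in> C\<close> CB borel_subset by blast
      ultimately have "y \<in> mball x r" using \<open>x \<in> M\<close> by simp
      then show False using r(2) \<open>y \<in> C\<close> by (auto simp: disjnt_iff)
    qed
  next
    fix x assume "x \<in> C"
    then show "x \<in> (\<Inter>n. nbhd C (?e n))" using borel_subset[OF CB] by (force simp: nbhd_def)
  qed
  moreover have "(\<lambda>n. measure \<nu> (nbhd C (?e n))) \<longlonglongrightarrow> measure \<nu> (\<Inter>n. nbhd C (?e n))"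
    using sets_nbhd[OF CB]
    by (intro n.finite_Lim_measure_decseq) (auto simp: sn decseq_def intro!: nbhd_mono)
  ultimately have "(\<lambda>n. measure \<nu> (nbhd C (?e n)) + ?e n) \<longlonglongrightarrow> measure \<nu> C + 0"
    by (intro tendsto_add LIMSEQ_inverse_real_of_nat) simp
  then show ?thesis using ineq by (intro LIMSEQ_le_const[where X="\<lambda>n. measure \<nu> (nbhd C (?e n)) + ?e n"]) auto
qed

lemma prokhorov_eq_0_iff:
  assumes \<mu>: "\<mu> \<in> prob_measures mtopology" and \<nu>: "\<nu> \<in> prob_measures mtopology"
  shows "prokhorov mtopology d \<mu> \<nu> = 0 \<longleftrightarrow> \<mu> = \<nu>"
proof
  assume 0: "prokhorov mtopology d \<mu> \<nu> = 0"
  interpret m: prob_space \<mu> using \<mu> by (simp add: prob_measures_def)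
  interpret n: prob_space \<nu> using \<nu> by (simp add: prob_measures_def)
  show "\<mu> = \<nu>"
  proof (rule measure_eqI_generator_eq)
    show "Int_stable {C. closedin mtopology C}" by (auto simp: Int_stable_def)
    show "{C. closedin mtopology C} \<subseteq> Pow M" using closedin_subset[of mtopology] by auto
    show "emeasure \<mu> C = emeasure \<nu> C" if "C \<in> {C. closedin mtopology C}" for C
      using prokhorov_zero_closed_le[OF \<mu> \<nu> 0, of C] prokhorov_zero_closed_le[OF \<nu> \<mu>, of C] that 0
      by (simp add: prokhorov_commute[OF \<nu> \<mu>] m.emeasure_eq_measure n.emeasure_eq_measure)
    show "sets \<mu> = sigma_sets M {C. closedin mtopology C}" "sets \<nu> = sigma_sets M {C. closedin mtopology C}"
      using \<mu> \<nu> sets_borel_of_closed[of mtopology] by (auto simp: prob_measures_def)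
    show "range (\<lambda>_::nat. M) \<subseteq> {C. closedin mtopology C}"
      using closedin_topspace[of mtopology] by auto
  qed auto
qed (use prokhorov_self \<mu> in auto)

end


section \<open>Empirical measures, mixtures, regular conditional distributions\<close>

text \<open>The sample of size \<open>n\<close> is indexed by \<open>{..<n}\<close>.\<close>

definition empirical :: "'a measure \<Rightarrow> nat \<Rightarrow> (nat \<Rightarrow> 'a) \<Rightarrow> 'a measure" where
  "empirical M n x =
     measure_of (space M) (sets M) (\<lambda>A. (\<Sum>i<n. emeasure (return M (x i)) A) / of_nat n)"

lemma emeasure_empirical:
  assumes "A \<in> sets M"
  shows "emeasure (empirical M n x) A = (\<Sum>i<n. emeasure (return M (x i)) A) / of_nat n"
  unfolding empirical_def
proof (rule emeasure_measure_of_sigma)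
  show "countably_additive (sets M) (\<lambda>A. (\<Sum>i<n. emeasure (return M (x i)) A) / of_nat n)"
  proof (rule countably_additiveI)
    fix A :: "nat \<Rightarrow> _" assume A: "range A \<subseteq> sets M" "disjoint_family A"
    have "(\<Sum>k. (\<Sum>i<n. emeasure (return M (x i)) (A k)) / of_nat n) =
      (\<Sum>i<n. \<Sum>k. emeasure (return M (x i)) (A k)) / of_nat n"
      by (simp add: divide_ennreal_def ennreal_suminf_multc suminf_sum)
    also have "\<dots> = (\<Sum>i<n. emeasure (return M (x i)) (\<Union>k. A k)) / of_nat n"
      using A by (intro arg_cong2[where f="(/)"] sum.cong suminf_emeasure refl) auto
    finally show "(\<Sum>k. (\<Sum>i<n. emeasure (return M (x i)) (A k)) / of_nat n) = \<dots>" .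
  qed
qed (use assms in \<open>auto simp: positive_def sets.sigma_algebra_axioms\<close>)

lemma sets_empirical [simp]: "sets (empirical M n x) = sets M"
  by (simp add: empirical_def)

lemma measure_empirical:
  assumes A: "A \<in> sets M" and n: "n \<ge> 1"
  shows "measure (empirical M n x) A = real (card {i\<in>{..<n}. x i \<in> A}) / real n"
proof -
  have "(\<Sum>i<n. emeasure (return M (x i)) A) = of_nat (card {i\<in>{..<n}. x i \<in> A})"
    using A by (simp add: indicator_def sum.If_cases Int_def)
  then have "emeasure (empirical M n x) A = ennreal (real (card {i\<in>{..<n}. x i \<in> A}) / real n)"
    using A n by (simp add: emeasure_empirical divide_ennreal ennreal_of_nat_eq_real_of_nat)
  then show ?thesis by (simp add: measure_def)
qed

lemma empirical_prob_measures:
  assumes x: "x \<in> {..<n} \<rightarrow> topspace T" and n: "n \<ge> 1"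
  shows "empirical (borel_of T) n x \<in> prob_measures T"
proof -
  have sp: "space (empirical (borel_of T) n x) = topspace T"
    using sets_eq_imp_space_eq[OF sets_empirical] by force
  have T: "topspace T \<in> sets (borel_of T)" by (rule borel_of_open) simp
  have "(\<Sum>i<n. emeasure (return (borel_of T) (x i)) (topspace T)) = of_nat n"
    using x T by (simp add: Pi_iff)
  moreover have "(of_nat n :: ennreal) / of_nat n = 1"
    using n by (intro ennreal_divide_self) (auto simp: of_nat_less_top)
  ultimately have "emeasure (empirical (borel_of T) n x) (topspace T) = 1"
    using T by (simp add: emeasure_empirical)
  then show ?thesis by (auto simp: prob_measures_def sp intro!: prob_spaceI)
qed

definition mixture :: "'i set \<Rightarrow> 'a measure \<Rightarrow> 'a measure measure \<Rightarrow> ('i \<Rightarrow> 'a) measure" where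
  "mixture I M Q = measure_of (space (\<Pi>\<^sub>M i\<in>I. M)) (sets (\<Pi>\<^sub>M i\<in>I. M))
     (\<lambda>C. \<integral>\<^sup>+p. emeasure (\<Pi>\<^sub>M i\<in>I. p) C \<partial>Q)"

lemma emeasure_mixture:
  assumes T: "metrizable_space T" and Q: "sets Q = sets (borel_of (weak_topology T))"
    and C: "C \<in> sets (\<Pi>\<^sub>M i\<in>I. borel_of T)"
  shows "emeasure (mixture I (borel_of T) Q) C = (\<integral>\<^sup>+p. emeasure (\<Pi>\<^sub>M i\<in>I. p) C \<partial>Q)"
proof -
  let ?P = "\<Pi>\<^sub>M i\<in>I. borel_of T"
  have kernel: "(\<lambda>p. \<Pi>\<^sub>M i\<in>I. p) \<in> Q \<rightarrow>\<^sub>M prob_algebra ?P"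
    using measurable_compose[OF measurable_weak_topology[OF T] measurable_PiM_prob_algebra] Q
    by (simp cong: measurable_cong_sets)
  have meas: "(\<lambda>p. emeasure (\<Pi>\<^sub>M i\<in>I. p) A) \<in> borel_measurable Q" if "A \<in> sets ?P" for A
    using measurable_prob_algebraD[OF kernel] that by (rule measurable_emeasure_kernel)
  have sp: "sets (\<Pi>\<^sub>M i\<in>I. p) = sets ?P" if "p \<in> space Q" for p
    using measurable_space[OF kernel that] by (simp add: space_prob_algebra)
  show ?thesis
    unfolding mixture_def
  proof (rule emeasure_measure_of_sigma)
    show "sigma_algebra (space ?P) (sets ?P)" ..
    show "positive (sets ?P) (\<lambda>C. \<integral>\<^sup>+p. emeasure (\<Pi>\<^sub>M i\<in>I. p) C \<partial>Q)"
      by (simp add: positive_def)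
    show "countably_additive (sets ?P) (\<lambda>C. \<integral>\<^sup>+p. emeasure (\<Pi>\<^sub>M i\<in>I. p) C \<partial>Q)"
    proof (rule countably_additiveI)
      fix A :: "nat \<Rightarrow> _" assume A: "range A \<subseteq> sets ?P" "disjoint_family A"
      have "(\<Sum>n. \<integral>\<^sup>+p. emeasure (\<Pi>\<^sub>M i\<in>I. p) (A n) \<partial>Q) = (\<integral>\<^sup>+p. (\<Sum>n. emeasure (\<Pi>\<^sub>M i\<in>I. p) (A n)) \<partial>Q)"
        using A(1) by (intro nn_integral_suminf[symmetric] meas) auto
      also have "\<dots> = (\<integral>\<^sup>+p. emeasure (\<Pi>\<^sub>M i\<in>I. p) (\<Union>n. A n) \<partial>Q)"
        using A sp by (intro nn_integral_cong suminf_emeasure) auto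
      finally show "(\<Sum>n. \<integral>\<^sup>+p. emeasure (\<Pi>\<^sub>M i\<in>I. p) (A n) \<partial>Q) = (\<integral>\<^sup>+p. emeasure (\<Pi>\<^sub>M i\<in>I. p) (\<Union>n. A n) \<partial>Q)" .
    qed
  qed (rule C)
qed

text \<open>
  \<open>\<kappa>\<close> is a regular conditional distribution of the \<open>K\<close>-valued random element \<open>Y\<close> given the
  \<open>N\<close>-valued random element \<open>Z\<close>, both defined on \<open>M\<close>.
\<close>

definition regular_cond_distr ::
    "'w measure \<Rightarrow> 'z measure \<Rightarrow> ('w \<Rightarrow> 'z) \<Rightarrow> 'y measure \<Rightarrow> ('w \<Rightarrow> 'y) \<Rightarrow> ('z \<Rightarrow> 'y measure) \<Rightarrow> bool" where
  "regular_cond_distr M N Z K Y \<kappa> \<longleftrightarrow>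
     \<kappa> \<in> N \<rightarrow>\<^sub>M prob_algebra K \<and>
     (\<forall>A\<in>sets K. \<forall>B\<in>sets N.
        emeasure M {\<omega> \<in> space M. Z \<omega> \<in> B \<and> Y \<omega> \<in> A} =
        (\<integral>\<^sup>+\<omega>\<in>Z -` B \<inter> space M. emeasure (\<kappa> (Z \<omega>)) A \<partial>M))"


section \<open>Tuples up to permutation\<close>

definition perm_rel :: "'a set \<Rightarrow> nat \<Rightarrow> ((nat \<Rightarrow> 'a) \<times> (nat \<Rightarrow> 'a)) set" where
  "perm_rel X m = {(x, y). x \<in> {..<m} \<rightarrow>\<^sub>E X \<and> y \<in> {..<m} \<rightarrow>\<^sub>E X \<and>
     (\<exists>\<tau>. \<tau> permutes {..<m} \<and> y = x \<circ> \<tau>)}"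

definition sym_space :: "'a set \<Rightarrow> nat \<Rightarrow> (nat \<Rightarrow> 'a) set set" where
  "sym_space X m = ({..<m} \<rightarrow>\<^sub>E X) // perm_rel X m"

definition sym_proj :: "'a set \<Rightarrow> nat \<Rightarrow> (nat \<Rightarrow> 'a) \<Rightarrow> (nat \<Rightarrow> 'a) set" where
  "sym_proj X m x = perm_rel X m `` {x}"

text \<open>
  Empirical measures are invariant under permutation, so the choice of representatives is
  immaterial. The value 0 off the carrier is there because the axioms of \<^locale>\<open>Metric_space\<close>
  on sign and symmetry are not relativised to the carrier.
\<close>

definition sym_dist ::
    "'a topology \<Rightarrow> ('a \<Rightarrow> 'a \<Rightarrow> real) \<Rightarrow> nat \<Rightarrow> (nat \<Rightarrow> 'a) set \<Rightarrow> (nat \<Rightarrow> 'a) set \<Rightarrow> real" where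
  "sym_dist T d m Q R =
     (if Q \<in> sym_space (topspace T) m \<and> R \<in> sym_space (topspace T) m
      then prokhorov T d
        (empirical (borel_of T) m (SOME x. x \<in> Q)) (empirical (borel_of T) m (SOME y. y \<in> R))
      else 0)"

definition sym_topology ::
    "'a topology \<Rightarrow> ('a \<Rightarrow> 'a \<Rightarrow> real) \<Rightarrow> nat \<Rightarrow> (nat \<Rightarrow> 'a) set topology" where
  "sym_topology T d m = Metric_space.mtopology (sym_space (topspace T) m) (sym_dist T d m)"

definition sym_distr ::
    "'a topology \<Rightarrow> ('a \<Rightarrow> 'a \<Rightarrow> real) \<Rightarrow> nat \<Rightarrow> (nat \<Rightarrow> 'a) measure \<Rightarrow> (nat \<Rightarrow> 'a) set measure" where
  "sym_distr T d m \<mu> = distr \<mu> (borel_of (sym_topology T d m)) (sym_proj (topspace T) m)"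

lemma equiv_perm_rel: "equiv ({..<m} \<rightarrow>\<^sub>E X) (perm_rel X m)"
proof (rule equivI)
  show "perm_rel X m \<subseteq> ({..<m} \<rightarrow>\<^sub>E X) \<times> ({..<m} \<rightarrow>\<^sub>E X)" by (auto simp: perm_rel_def)
  show "refl_on ({..<m} \<rightarrow>\<^sub>E X) (perm_rel X m)"
  proof (rule refl_onI)
    fix x assume x: "x \<in> {..<m} \<rightarrow>\<^sub>E X"
    have "id permutes {..<m}" "x = x \<circ> id" by (simp_all add: permutes_id)
    then show "(x, x) \<in> perm_rel X m" using x unfolding perm_rel_def by blast
  qed
  show "sym (perm_rel X m)"
  proof (rule symI)
    fix x y assume "(x, y) \<in> perm_rel X m"
    then obtain \<tau> where t: "x \<in> {..<m} \<rightarrow>\<^sub>E X" "y \<in> {..<m} \<rightarrow>\<^sub>E X" "\<tau> permutes {..<m}" "y = x \<circ> \<tau>"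
      by (auto simp: perm_rel_def)
    have "y \<circ> inv \<tau> = x \<circ> (\<tau> \<circ> inv \<tau>)" unfolding t(4) by (rule comp_assoc)
    then have "x = y \<circ> inv \<tau>" by (simp add: permutes_inv_o(1)[OF t(3)])
    then show "(y, x) \<in> perm_rel X m" using t permutes_inv[OF t(3)] unfolding perm_rel_def by blast
  qed
  show "trans (perm_rel X m)"
  proof (rule transI)
    fix x y z assume "(x, y) \<in> perm_rel X m" "(y, z) \<in> perm_rel X m"
    then obtain \<tau> \<sigma> where t: "x \<in> {..<m} \<rightarrow>\<^sub>E X" "z \<in> {..<m} \<rightarrow>\<^sub>E X" "\<tau> permutes {..<m}" "y = x \<circ> \<tau>"
        "\<sigma> permutes {..<m}" "z = y \<circ> \<sigma>"
      by (auto simp: perm_rel_def)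
    have "z = x \<circ> (\<tau> \<circ> \<sigma>)" unfolding t(6) t(4) by (rule comp_assoc)
    then show "(x, z) \<in> perm_rel X m"
      using t permutes_compose[OF t(5) t(3)] unfolding perm_rel_def by blast
  qed
qed

lemma sym_proj_in: "x \<in> {..<m} \<rightarrow>\<^sub>E X \<Longrightarrow> sym_proj X m x \<in> sym_space X m"
  unfolding sym_space_def sym_proj_def by (rule quotientI)

lemma sym_spaceE:
  assumes "Q \<in> sym_space X m"
  obtains x where "x \<in> {..<m} \<rightarrow>\<^sub>E X" "Q = sym_proj X m x"
  using assms unfolding sym_space_def sym_proj_def by (rule quotientE)

lemma empirical_perm:
  assumes "(x, y) \<in> perm_rel X m"
  shows "empirical M m x = empirical M m y"
proof (rule measure_eqI)
  obtain \<tau> where t: "\<tau> permutes {..<m}" "y = x \<circ> \<tau>" using assms by (auto simp: perm_rel_def)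
  fix A assume "A \<in> sets (empirical M m x)"
  then have A: "A \<in> sets M" by simp
  have "(\<Sum>i<m. emeasure (return M (x i)) A) = (\<Sum>i<m. emeasure (return M (y i)) A)"
    unfolding t(2) using sum.permute[OF t(1), of "\<lambda>i. emeasure (return M (x i)) A"] by (simp add: comp_def)
  then show "emeasure (empirical M m x) A = emeasure (empirical M m y) A"
    using A by (simp add: emeasure_empirical)
qed simp

context Metric_space
begin

lemma perm_rel_if_empirical_eq:
  assumes x: "x \<in> {..<m} \<rightarrow>\<^sub>E M" and y: "y \<in> {..<m} \<rightarrow>\<^sub>E M" and m: "m \<ge> 1"
    and eq: "empirical (borel_of mtopology) m x = empirical (borel_of mtopology) m y"
  shows "(x, y) \<in> perm_rel M m"
proof -
  have card: "card {i \<in> {..<m}. y i = a} = card {i \<in> {..<m}. x i = a}" for a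
  proof (cases "a \<in> M")
    case True
    have "closedin mtopology {a}"
      using True by (intro closedin_Hausdorff_singleton Hausdorff_space_mtopology) simp
    then have "{a} \<in> sets (borel_of mtopology)" by (simp add: sets_borel_of_closed)
    then have "real (card {i \<in> {..<m}. x i \<in> {a}}) / real m = real (card {i \<in> {..<m}. y i \<in> {a}}) / real m"
      using arg_cong[OF eq, of "\<lambda>N. measure N {a}"] by (simp only: measure_empirical[OF _ m])
    then show ?thesis using m by simp
  next
    case False
    then have "{i \<in> {..<m}. y i = a} = {}" "{i \<in> {..<m}. x i = a} = {}" using x y by (auto simp: PiE_iff)
    then show ?thesis by (simp only:)
  qed
  have "image_mset y (mset_set {..<m}) = image_mset x (mset_set {..<m})"
  proof (rule multiset_eqI)
    fix a
    have "count (image_mset f (mset_set {..<m})) a = card {i \<in> {..<m}. f i = a}" for f :: "nat \<Rightarrow> 'a"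
    proof -
      have "f -` {a} \<inter> {..<m} = {i \<in> {..<m}. f i = a}" by auto
      then show ?thesis by (simp add: count_image_mset)
    qed
    then show "count (image_mset y (mset_set {..<m})) a = count (image_mset x (mset_set {..<m})) a"
      using card by simp
  qed
  then obtain p where p: "p permutes {..<m}" "\<forall>i\<in>{..<m}. y i = x (p i)"
    using image_mset_eq_implies_permutes[of "{..<m}" y x] by blast
  have "y = x \<circ> p"
  proof
    fix i show "y i = (x \<circ> p) i"
    proof (cases "i < m")
      case False
      then have "p i = i" using p(1) by (simp add: permutes_not_in)
      moreover have "x i = undefined" "y i = undefined"
        using False PiE_arb[OF x, of i] PiE_arb[OF y, of i] by simp_all
      ultimately show ?thesis by simp
    next
      case True
      then show ?thesis using p(2) by simp
    qed
  qed
  then show ?thesis using x y p(1) unfolding perm_rel_def by blast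
qed

lemma sym_dist_proj:
  assumes x: "x \<in> {..<m} \<rightarrow>\<^sub>E M" and y: "y \<in> {..<m} \<rightarrow>\<^sub>E M"
  shows "sym_dist mtopology d m (sym_proj M m x) (sym_proj M m y) =
    prokhorov mtopology d (empirical (borel_of mtopology) m x) (empirical (borel_of mtopology) m y)"
proof -
  have "empirical (borel_of mtopology) m (SOME z. z \<in> sym_proj M m w) = empirical (borel_of mtopology) m w"
    if w: "w \<in> {..<m} \<rightarrow>\<^sub>E M" for w
  proof -
    have "w \<in> sym_proj M m w" unfolding sym_proj_def by (rule equiv_class_self[OF equiv_perm_rel w])
    then have "(SOME z. z \<in> sym_proj M m w) \<in> sym_proj M m w"
      by (rule someI[of "\<lambda>z. z \<in> sym_proj M m w"])
    then have "(w, SOME z. z \<in> sym_proj M m w) \<in> perm_rel M m" by (simp add: sym_proj_def)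
    then show ?thesis by (rule empirical_perm[symmetric])
  qed
  then show ?thesis using x y by (simp add: sym_dist_def sym_proj_in)
qed

lemma Metric_space_sym:
  assumes m: "m \<ge> 1"
  shows "Metric_space (sym_space M m) (sym_dist mtopology d m)"
proof
  let ?e = "empirical (borel_of mtopology) m"
  have e: "?e x \<in> prob_measures mtopology" if "x \<in> {..<m} \<rightarrow>\<^sub>E M" for x
    using that m by (intro empirical_prob_measures) (auto simp: PiE_iff)
  show "0 \<le> sym_dist mtopology d m Q R" for Q R
  proof (cases "Q \<in> sym_space M m \<and> R \<in> sym_space M m")
    case True
    then obtain x y where xy: "x \<in> {..<m} \<rightarrow>\<^sub>E M" "Q = sym_proj M m x" "y \<in> {..<m} \<rightarrow>\<^sub>E M" "R = sym_proj M m y"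
      by (elim conjE sym_spaceE)
    show ?thesis
      unfolding xy(2,4) sym_dist_proj[OF xy(1,3)] by (rule prokhorov_nonneg[OF e[OF xy(1)]])
  next
    case False
    then show ?thesis by (simp only: sym_dist_def topspace_mtopology if_False order_refl)
  qed
  show "sym_dist mtopology d m Q R = sym_dist mtopology d m R Q" for Q R
  proof (cases "Q \<in> sym_space M m \<and> R \<in> sym_space M m")
    case True
    then obtain x y where xy: "x \<in> {..<m} \<rightarrow>\<^sub>E M" "Q = sym_proj M m x" "y \<in> {..<m} \<rightarrow>\<^sub>E M" "R = sym_proj M m y"
      by (elim conjE sym_spaceE)
    show ?thesis
      unfolding xy(2,4) sym_dist_proj[OF xy(1,3)] sym_dist_proj[OF xy(3,1)]
      by (rule prokhorov_commute[OF e[OF xy(1)] e[OF xy(3)]])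
  next
    case False
    then have "\<not> (R \<in> sym_space M m \<and> Q \<in> sym_space M m)" by blast
    with False show ?thesis by (simp only: sym_dist_def topspace_mtopology if_False)
  qed
  show "sym_dist mtopology d m Q R = 0 \<longleftrightarrow> Q = R" if QR: "Q \<in> sym_space M m" "R \<in> sym_space M m" for Q R
  proof -
    obtain x y where x: "x \<in> {..<m} \<rightarrow>\<^sub>E M" "Q = sym_proj M m x" and y: "y \<in> {..<m} \<rightarrow>\<^sub>E M" "R = sym_proj M m y"
      using QR by (elim sym_spaceE)
    have "sym_dist mtopology d m Q R = 0 \<longleftrightarrow> ?e x = ?e y"
      unfolding x(2) y(2) sym_dist_proj[OF x(1) y(1)] by (intro prokhorov_eq_0_iff e x y)
    also have "\<dots> \<longleftrightarrow> (x, y) \<in> perm_rel M m"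
      using perm_rel_if_empirical_eq[OF x(1) y(1) m] empirical_perm by blast
    also have "\<dots> \<longleftrightarrow> Q = R"
      unfolding x(2) y(2) sym_proj_def using eq_equiv_class_iff[OF equiv_perm_rel x(1) y(1)] by simp
    finally show ?thesis .
  qed
  show "sym_dist mtopology d m Q S \<le> sym_dist mtopology d m Q R + sym_dist mtopology d m R S"
    if QRS: "Q \<in> sym_space M m" "R \<in> sym_space M m" "S \<in> sym_space M m" for Q R S
  proof -
    obtain x y z where x: "x \<in> {..<m} \<rightarrow>\<^sub>E M" "Q = sym_proj M m x" and y: "y \<in> {..<m} \<rightarrow>\<^sub>E M" "R = sym_proj M m y"
      and z: "z \<in> {..<m} \<rightarrow>\<^sub>E M" "S = sym_proj M m z"
      using QRS by (elim sym_spaceE)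
    show ?thesis
      unfolding x(2) y(2) z(2) sym_dist_proj[OF x(1) y(1)] sym_dist_proj[OF x(1) z(1)] sym_dist_proj[OF y(1) z(1)]
      by (rule prokhorov_triangle[OF e[OF x(1)] e[OF y(1)] e[OF z(1)]])
  qed
qed

lemma prokhorov_empirical_le:
  assumes y: "y \<in> {..<m} \<rightarrow>\<^sub>E M" and m: "m \<ge> 1" and \<epsilon>: "\<epsilon> > 0" and xy: "\<And>i. i < m \<Longrightarrow> d (x i) (y i) < \<epsilon>"
  shows "prokhorov mtopology d (empirical (borel_of mtopology) m x) (empirical (borel_of mtopology) m y) \<le> \<epsilon>"
proof -
  have "measure (empirical (borel_of mtopology) m x) B \<le> measure (empirical (borel_of mtopology) m y) (nbhd B \<epsilon>) + \<epsilon>"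
    if B: "B \<in> sets (borel_of mtopology)" for B
  proof -
    have "{i \<in> {..<m}. x i \<in> B} \<subseteq> {i \<in> {..<m}. y i \<in> nbhd B \<epsilon>}"
    proof
      fix i assume i: "i \<in> {i \<in> {..<m}. x i \<in> B}"
      then have "d (y i) (x i) < \<epsilon>" using xy[of i] commute[of "x i" "y i"] by simp
      then show "i \<in> {i \<in> {..<m}. y i \<in> nbhd B \<epsilon>}" using i y by (auto simp: nbhd_def PiE_iff)
    qed
    then have "card {i \<in> {..<m}. x i \<in> B} \<le> card {i \<in> {..<m}. y i \<in> nbhd B \<epsilon>}"
      by (intro card_mono) auto
    then have "real (card {i \<in> {..<m}. x i \<in> B}) / real m \<le> real (card {i \<in> {..<m}. y i \<in> nbhd B \<epsilon>}) / real m"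
      by (intro divide_right_mono) auto
    then show ?thesis
      using \<epsilon> unfolding measure_empirical[OF B m] measure_empirical[OF sets_nbhd[OF B] m] by linarith
  qed
  then have "\<epsilon> \<in> prokhorov_set (empirical (borel_of mtopology) m x) (empirical (borel_of mtopology) m y)"
    using \<epsilon> by (simp add: prokhorov_set_def)
  then show ?thesis unfolding prokhorov_Inf by (rule cInf_lower[OF _ bdd_below_prokhorov_set])
qed

lemma measurable_sym_proj:
  assumes m: "m \<ge> 1" and sc: "second_countable mtopology"
  shows "sym_proj M m \<in> (\<Pi>\<^sub>M i\<in>{..<m}. borel_of mtopology) \<rightarrow>\<^sub>M borel_of (sym_topology mtopology d m)"
proof -
  interpret S: Metric_space "sym_space M m" "sym_dist mtopology d m" by (rule Metric_space_sym[OF m])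
  let ?P = "product_topology (\<lambda>_. mtopology) {..<m}"
  have T: "sym_topology mtopology d m = S.mtopology" by (simp add: sym_topology_def)
  have "sym_proj M m \<in> borel_of ?P \<rightarrow>\<^sub>M borel_of S.mtopology"
    unfolding borel_of_def[of S.mtopology]
  proof (rule measurable_measure_of)
    show "sym_proj M m \<in> space (borel_of ?P) \<rightarrow> topspace S.mtopology" using sym_proj_in by auto
    fix U assume "U \<in> {U. openin S.mtopology U}"
    then have U: "openin S.mtopology U" by simp
    have "openin ?P (sym_proj M m -` U \<inter> topspace ?P)"
    proof (subst openin_subopen, intro ballI)
      fix x assume "x \<in> sym_proj M m -` U \<inter> topspace ?P"
      then have x: "sym_proj M m x \<in> U" "x \<in> {..<m} \<rightarrow>\<^sub>E M" by auto
      obtain r where r: "r > 0" "S.mball (sym_proj M m x) r \<subseteq> U"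
        using U x(1) unfolding S.openin_mtopology by blast
      let ?B = "\<Pi>\<^sub>E i\<in>{..<m}. mball (x i) (r / 2)"
      have "openin ?P ?B" by (subst openin_PiE_gen) auto
      moreover have "x \<in> ?B" using x(2) r(1) by (auto simp: PiE_iff)
      moreover have "?B \<subseteq> sym_proj M m -` U \<inter> topspace ?P"
      proof
        fix y assume y: "y \<in> ?B"
        then have yM: "y \<in> {..<m} \<rightarrow>\<^sub>E M" by (auto simp: PiE_iff)
        have "sym_dist mtopology d m (sym_proj M m x) (sym_proj M m y) \<le> r / 2"
          unfolding sym_dist_proj[OF x(2) yM]
          using y r(1) by (intro prokhorov_empirical_le yM m) (auto simp: PiE_iff)
        then have "sym_proj M m y \<in> S.mball (sym_proj M m x) r"
          using r(1) sym_proj_in[OF x(2)] sym_proj_in[OF yM] by simp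
        then show "y \<in> sym_proj M m -` U \<inter> topspace ?P" using r(2) yM by auto
      qed
      ultimately show "\<exists>V. openin ?P V \<and> x \<in> V \<and> V \<subseteq> sym_proj M m -` U \<inter> topspace ?P" by blast
    qed
    then show "sym_proj M m -` U \<inter> space (borel_of ?P) \<in> sets (borel_of ?P)"
      by (simp add: borel_of_open)
  next
    show "{U. openin S.mtopology U} \<subseteq> Pow (topspace S.mtopology)"
      using openin_subset[of S.mtopology] by auto
  qed
  moreover have "sets (\<Pi>\<^sub>M i\<in>{..<m}. borel_of mtopology) = sets (borel_of ?P)"
    using sc by (intro sets_PiM_borel_of) auto
  ultimately show ?thesis unfolding T by (simp cong: measurable_cong_sets)
qed

end


section \<open>Discretizations\<close>

text \<open>The index \<open>m\<close> starts at 1. The bound on the diameter of \<open>A m j\<close> is spelled out pointwise.\<close>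

definition discretization ::
    "'a topology \<Rightarrow> ('a \<Rightarrow> 'a \<Rightarrow> real) \<Rightarrow> (nat \<Rightarrow> 'a set) \<Rightarrow> (nat \<Rightarrow> nat) \<Rightarrow> (nat \<Rightarrow> nat \<Rightarrow> 'a set) \<Rightarrow> bool" where
  "discretization T d K k A \<longleftrightarrow>
     (\<forall>m\<ge>1. compactin T (K m) \<and> K m \<subseteq> K (Suc m)) \<and>
     (\<Union>m\<in>{1..}. K m) = topspace T \<and>
     (\<forall>m\<ge>1.
        (\<forall>j\<in>{1..k m}. A m j \<in> sets (borel_of T) \<and> (\<forall>x\<in>A m j. \<forall>y\<in>A m j. d x y \<le> 1 / real m)) \<and>
        disjoint_family_on (A m) {1..k m} \<and>
        (\<Union>j\<in>{1..k m}. A m j) = K m \<and>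
        A m (k m + 1) = topspace T - K m)"

definition Pi_fun :: "'a set \<Rightarrow> (nat \<Rightarrow> nat) \<Rightarrow> (nat \<Rightarrow> nat \<Rightarrow> 'a set) \<Rightarrow> real \<Rightarrow> 'a measure \<Rightarrow> ennreal" where
  "Pi_fun X k A r p = liminf (\<lambda>m. ennreal (\<Sum>j=1..k m + 1.
     (measure p (A m j \<inter> X) * (1 - measure p (A m j \<inter> X))) powr (1 / r)))"


section \<open>Square root on the extended nonnegative reals\<close>

definition ennreal_sqrt :: "ennreal \<Rightarrow> ennreal" where
  "ennreal_sqrt x = (if x = \<infinity> then \<infinity> else ennreal (sqrt (enn2real x)))"

end

theory Submission
  imports Defs
begin

text \<open>
  Let \<open>b\<^sub>n = sqrt (n / ln n)\<close>, let \<open>d\<^sub>n\<close> be the Prokhorov distance between \<open>pt\<close> and \<open>e n\<close>, and let \<open>E\<^sub>n\<close>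
  be the conditional expectation of \<open>d\<^sub>n\<close> given the first \<open>n\<close> observations, that is, the integral of
  the distance to \<open>e n\<close> under the posterior. Given \<open>p\<close>, the number of observations in a cell \<open>C\<close> is a
  sum of i.i.d. indicators with variance \<open>v = p(C) (1 - p(C))\<close>. Interpolating between the maximal
  inequalities for second and fourth moments on dyadic blocks bounds the expectation of
  \<open>sup\<^sub>n b\<^sub>n |p(C) - e\<^sub>n(C)|\<close> by a multiple of \<open>v powr (1 / s)\<close>, for every \<open>s\<close> with \<open>2 < s \<le> 4\<close>. Summing over
  the cells of the discretization and applying Fatou's lemma, the expectation of \<open>sup\<^sub>n b\<^sub>n d\<^sub>n\<close> is at
  most a multiple of the integral of \<open>\<Pi>\<^sub>r\<close>, hence finite. This domination gives, as in the
  martingale convergence theorem, \<open>limsup b\<^sub>n E\<^sub>n \<le> limsup b\<^sub>n d\<^sub>n\<close> almost surely. Finally, the first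
  distance in the theorem is at most \<open>sqrt E\<^sub>n\<close> by Markov's inequality (the second measure is a point
  mass), and the second one is at most \<open>sqrt (2 m E\<^sub>n)\<close>, by replacing the coordinates of a Lipschitz
  cut-off function one at a time.
\<close>

section \<open>Prokhorov distance and weak topology\<close>

text \<open>The choice of \<open>s\<close> is dictated from two sides. A smaller \<open>s\<close>
  gives a smaller bound \<open>v powr (1 / s)\<close>, but summing over the dyadic blocks produces
  the series of \<open>k powr - (s / 2)\<close>, which diverges at \<open>s = 2\<close>; this is
  where \<open>r > 2\<close> enters. With \<open>s = min r 4\<close> the two moments are enough, and
  \<open>v \<le> 1\<close> together with \<open>s \<le> r\<close> makes
  \<open>v powr (1 / s)\<close> at most the summand \<open>v powr (1 / r)\<close> of
  \<open>\<Pi>\<^sub>r\<close>. The cell bounds concern a fixed \<open>p\<close>, while the claims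
  concern \<open>pt\<close>. The same bounds close this gap: where \<open>\<Pi>\<^sub>r\<close> is
  finite, they force the empirical measures of a sample from \<open>p\<close> to approach
  \<open>p\<close>, so \<open>pt\<close> equals \<open>p\<close> there and the bounds can be
  integrated over \<open>q\<close>. In \<open>E\<^sub>n\<close> both the integrand and the
  conditioning vary with \<open>n\<close>. Freezing a supremum of late terms removes the first
  dependence; approximating it in mean by a function of finitely many observations handles the
  second. The measurable structure on probability measures is that of the weak topology, so
  everything built from distances has to be measurable for it. The key is that Prokhorov balls are
  weakly open.\<close>

context Metric_space
begin

abbreviation dP :: "'a measure \<Rightarrow> 'a measure \<Rightarrow> real" where
  "dP \<equiv> prokhorov mtopology d"

lemma second_countable_if_separable:
  assumes "separable_space mtopology"
  shows "second_countable mtopology"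
proof -
  obtain C where C: "countable C" "C \<subseteq> M" "mtopology closure_of C = M"
    using assms by (auto simp: separable_space_def)
  define \<B> where "\<B> = (\<lambda>(c, n). mball c (inverse (real (Suc n)))) ` (C \<times> UNIV)"
  have "countable \<B>" using C(1) unfolding \<B>_def by simp
  moreover have "\<forall>V\<in>\<B>. openin mtopology V" by (auto simp: \<B>_def)
  moreover have "\<exists>V\<in>\<B>. x \<in> V \<and> V \<subseteq> U" if U: "openin mtopology U" "x \<in> U" for U x
  proof -
    obtain r where r: "r > 0" "mball x r \<subseteq> U" using U unfolding openin_mtopology by blast
    have xM: "x \<in> M" using U openin_subset by fastforce
    obtain n where n: "inverse (real (Suc n)) < r / 2" using reals_Archimedean[of "r / 2"] r by auto
    have "x \<in> mtopology closure_of C" using xM C(3) by simp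
    then obtain c where c: "c \<in> C" "c \<in> mball x (inverse (real (Suc n)))"
      unfolding metric_closure_of by (smt (verit) inverse_positive_iff_positive mem_Collect_eq of_nat_0_less_iff zero_less_Suc)
    have "mball c (inverse (real (Suc n))) \<subseteq> mball x r"
    proof
      fix y assume "y \<in> mball c (inverse (real (Suc n)))"
      then have "d c y < inverse (real (Suc n))" "y \<in> M" by auto
      moreover have "d x c < inverse (real (Suc n))" "c \<in> M" using c(2) by auto
      ultimately have "d x y < r" using triangle[of x c y] xM n by linarith
      then show "y \<in> mball x r" using xM \<open>y \<in> M\<close> by simp
    qed
    moreover have "x \<in> mball c (inverse (real (Suc n)))" using c commute[of x c] by auto
    moreover have "mball c (inverse (real (Suc n))) \<in> \<B>"
      unfolding \<B>_def using c(1) by (intro image_eqI[where x="(c, n)"]) auto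
    ultimately show ?thesis using r(2) by blast
  qed
  ultimately show ?thesis unfolding second_countable_def by blast
qed

lemma prokhorov_le:
  assumes "\<epsilon> > 0"
    and "\<And>B. B \<in> sets (borel_of mtopology) \<Longrightarrow> measure \<mu> B \<le> measure \<nu> (nbhd B \<epsilon>) + \<epsilon>"
  shows "dP \<mu> \<nu> \<le> \<epsilon>"
  unfolding prokhorov_Inf
  by (rule cInf_lower[OF _ bdd_below_prokhorov_set]) (use assms in \<open>auto simp: prokhorov_set_def\<close>)

lemma prokhorov_le_1:
  assumes "\<mu> \<in> prob_measures mtopology"
  shows "dP \<mu> \<nu> \<le> 1"
  unfolding prokhorov_Inf
  by (rule cInf_lower[OF prokhorov_set_nonempty[OF assms] bdd_below_prokhorov_set])

text \<open>Measurability of the distance needs countably many conditions, while its definition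
  ranges over all Borel sets and all radii. The strict inequality leaves room between
  \<open>\<epsilon>\<close> and \<open>c\<close>: an arbitrary \<open>B\<close> is enlarged to the
  open set \<open>nbhd B \<delta>\<close>, a countable union of base sets, and continuity from below
  passes from finite subunions to it.\<close>

lemma prokhorov_less_iff_base:
  assumes \<mu>: "\<mu> \<in> prob_measures mtopology" and \<nu>: "\<nu> \<in> prob_measures mtopology"
    and \<B>: "countable \<B>" "\<And>V. V \<in> \<B> \<Longrightarrow> openin mtopology V"
      "\<And>U x. openin mtopology U \<Longrightarrow> x \<in> U \<Longrightarrow> \<exists>V\<in>\<B>. x \<in> V \<and> V \<subseteq> U"
  shows "dP \<mu> \<nu> < c \<longleftrightarrow>
    (\<exists>\<epsilon>\<in>{\<epsilon>\<in>\<rat>. 0 < \<epsilon> \<and> \<epsilon> < c}. \<forall>F\<in>{F. finite F \<and> F \<subseteq> \<B>}.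
        measure \<mu> (\<Union>F) \<le> measure \<nu> (nbhd (\<Union>F) \<epsilon>) + \<epsilon>)" (is "_ \<longleftrightarrow> ?R")
proof
  interpret m: prob_space \<mu> using \<mu> by (simp add: prob_measures_def)
  interpret n: prob_space \<nu> using \<nu> by (simp add: prob_measures_def)
  have s: "sets \<mu> = sets (borel_of mtopology)" "sets \<nu> = sets (borel_of mtopology)"
    using \<mu> \<nu> by (auto simp: prob_measures_def)
  have oF: "openin mtopology (\<Union>F)" if "finite F" "F \<subseteq> \<B>" for F
    using \<B>(2) that by (intro openin_Union) auto
  {
    assume "dP \<mu> \<nu> < c"
    then obtain a where a: "a \<in> prokhorov_set \<mu> \<nu>" "a < c" by (rule prokhorov_less[OF \<mu>])
    obtain \<epsilon> where e: "\<epsilon> \<in> \<rat>" "a < \<epsilon>" "\<epsilon> < c" using Rats_dense_in_real[OF a(2)] by blast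
    have "measure \<mu> (\<Union>F) \<le> measure \<nu> (nbhd (\<Union>F) \<epsilon>) + \<epsilon>" if "finite F" "F \<subseteq> \<B>" for F
    proof -
      have B: "\<Union>F \<in> sets (borel_of mtopology)" by (rule borel_of_open[OF oF[OF that]])
      then have "measure \<mu> (\<Union>F) \<le> measure \<nu> (nbhd (\<Union>F) a) + a" using a(1) by (auto simp: prokhorov_set_def)
      moreover have "measure \<nu> (nbhd (\<Union>F) a) \<le> measure \<nu> (nbhd (\<Union>F) \<epsilon>)"
        using sets_nbhd[OF B] nbhd_mono[of a \<epsilon>] e(2) by (intro n.finite_measure_mono) (auto simp: s)
      ultimately show ?thesis using e(2) by linarith
    qed
    then show ?R using e a by (auto simp: prokhorov_set_def intro!: bexI[of _ \<epsilon>])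
  }
  assume ?R
  then obtain \<epsilon> where e: "0 < \<epsilon>" "\<epsilon> < c"
    and le: "\<And>F. finite F \<Longrightarrow> F \<subseteq> \<B> \<Longrightarrow> measure \<mu> (\<Union>F) \<le> measure \<nu> (nbhd (\<Union>F) \<epsilon>) + \<epsilon>" by auto
  \<comment> \<open>Half the gap, so that enlarging \<open>B\<close> by \<open>\<delta>\<close>
    keeps the total radius \<open>\<epsilon> + \<delta>\<close> strictly below
    \<open>c\<close>.\<close>
  define \<delta> where "\<delta> = (c - \<epsilon>) / 2"
  have \<delta>: "\<delta> > 0" "\<epsilon> + \<delta> < c" using e by (auto simp: \<delta>_def field_simps)
  have "dP \<mu> \<nu> \<le> \<epsilon> + \<delta>"
  proof (rule prokhorov_le)
    fix B assume B: "B \<in> sets (borel_of mtopology)"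
    let ?W = "nbhd B \<delta>"
    define \<C> where "\<C> = {V \<in> \<B>. V \<subseteq> ?W}"
    have cC: "countable \<C>" using \<B>(1) by (auto simp: \<C>_def intro: countable_subset)
    have W: "?W = \<Union>\<C>"
      using \<B>(3)[OF openin_nbhd[OF borel_subset[OF B]]] unfolding \<C>_def by blast
    have bound: "measure \<mu> (\<Union>F) \<le> measure \<nu> (nbhd B (\<epsilon> + \<delta>)) + \<epsilon>" if F: "finite F" "F \<subseteq> \<C>" for F
    proof -
      have "nbhd (\<Union>F) \<epsilon> \<subseteq> nbhd B (\<epsilon> + \<delta>)"
      proof
        fix x assume "x \<in> nbhd (\<Union>F) \<epsilon>"
        then obtain y where y: "x \<in> M" "y \<in> \<Union>F" "d x y < \<epsilon>" by (auto simp: nbhd_def)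
        then have "y \<in> ?W" using F W by blast
        then obtain z where z: "y \<in> M" "z \<in> B" "d y z < \<delta>" by (auto simp: nbhd_def)
        then have "z \<in> M" using borel_subset[OF B] by blast
        then have "d x z < \<epsilon> + \<delta>" using triangle[of x y z] y z by linarith
        then show "x \<in> nbhd B (\<epsilon> + \<delta>)" using y z by (auto simp: nbhd_def)
      qed
      then have "measure \<nu> (nbhd (\<Union>F) \<epsilon>) \<le> measure \<nu> (nbhd B (\<epsilon> + \<delta>))"
        using sets_nbhd[OF B] by (intro n.finite_measure_mono) (auto simp: s)
      moreover have "F \<subseteq> \<B>" using F by (auto simp: \<C>_def)
      ultimately show ?thesis using le[OF F(1)] by fastforce
    qed
    have "measure \<mu> (\<Union>\<C>) \<le> measure \<nu> (nbhd B (\<epsilon> + \<delta>)) + \<epsilon>"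
    proof (cases "\<C> = {}")
      case True
      then show ?thesis using e by simp
    next
      case False
      obtain V :: "nat \<Rightarrow> _" where V: "range V = \<C>" using range_from_nat_into[OF False cC] by blast
      have Vo: "openin mtopology (V i)" for i
        using V \<B>(2) by (auto simp: \<C>_def)
      have "(\<lambda>n. measure \<mu> (\<Union>i\<in>{..<n}. V i)) \<longlonglongrightarrow> measure \<mu> (\<Union>n. \<Union>i\<in>{..<n}. V i)"
        by (intro m.finite_Lim_measure_incseq monoI UN_mono image_subsetI)
           (auto simp: s intro!: borel_of_open Vo)
      moreover have "(\<Union>n. \<Union>i\<in>{..<n}. V i) = \<Union>\<C>" unfolding V[symmetric] by auto
      moreover have "measure \<mu> (\<Union>i\<in>{..<n}. V i) \<le> measure \<nu> (nbhd B (\<epsilon> + \<delta>)) + \<epsilon>" for n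
        using bound[of "V ` {..<n}"] V by auto
      ultimately show ?thesis by (intro LIMSEQ_le_const2[where X="\<lambda>n. measure \<mu> (\<Union>i\<in>{..<n}. V i)"]) auto
    qed
    moreover have "measure \<mu> B \<le> measure \<mu> ?W"
      using borel_subset[OF B] \<delta>(1) sets_nbhd[OF B]
      by (intro m.finite_measure_mono) (force simp: nbhd_def, simp add: s)
    ultimately show "measure \<mu> B \<le> measure \<nu> (nbhd B (\<epsilon> + \<delta>)) + (\<epsilon> + \<delta>)"
      using W \<delta>(1) by simp
  qed (use e \<delta> in simp)
  then show "dP \<mu> \<nu> < c" using \<delta>(2) by simp
qed

text \<open>Finite unions of base sets and their neighbourhoods are open, so masses of open sets are
  all that must depend measurably on the parameter. Both measures may vary; this yields the joint
  measurability in sample and limit law on which the conditioning rests.\<close>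

lemma borel_measurable_prokhorov:
  assumes sc: "second_countable mtopology"
    and f: "\<And>\<omega>. \<omega> \<in> space \<Omega> \<Longrightarrow> f \<omega> \<in> prob_measures mtopology"
    and g: "\<And>\<omega>. \<omega> \<in> space \<Omega> \<Longrightarrow> g \<omega> \<in> prob_measures mtopology"
    and mf: "\<And>U. openin mtopology U \<Longrightarrow> (\<lambda>\<omega>. measure (f \<omega>) U) \<in> borel_measurable \<Omega>"
    and mg: "\<And>U. openin mtopology U \<Longrightarrow> (\<lambda>\<omega>. measure (g \<omega>) U) \<in> borel_measurable \<Omega>"
  shows "(\<lambda>\<omega>. dP (f \<omega>) (g \<omega>)) \<in> borel_measurable \<Omega>"
  unfolding borel_measurable_iff_less
proof
  fix c :: real
  obtain \<B> where "countable \<B> \<and> (\<forall>V\<in>\<B>. openin mtopology V) \<and>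
      (\<forall>U x. openin mtopology U \<and> x \<in> U \<longrightarrow> (\<exists>V\<in>\<B>. x \<in> V \<and> V \<subseteq> U))"
    using sc unfolding second_countable_def ..
  then have \<B>: "countable \<B>" "\<And>V. V \<in> \<B> \<Longrightarrow> openin mtopology V"
      "\<And>U x. openin mtopology U \<Longrightarrow> x \<in> U \<Longrightarrow> \<exists>V\<in>\<B>. x \<in> V \<and> V \<subseteq> U" by simp_all
  let ?E = "{\<epsilon>\<in>\<rat>. 0 < \<epsilon> \<and> \<epsilon> < c}" and ?F = "{F. finite F \<and> F \<subseteq> \<B>}"
  have "{\<omega> \<in> space \<Omega>. dP (f \<omega>) (g \<omega>) < c} =
    {\<omega> \<in> space \<Omega>. \<exists>\<epsilon>\<in>?E. \<forall>F\<in>?F. measure (f \<omega>) (\<Union>F) \<le> measure (g \<omega>) (nbhd (\<Union>F) \<epsilon>) + \<epsilon>}"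
    using prokhorov_less_iff_base[OF f g \<B>] by blast
  also have "\<dots> \<in> sets \<Omega>"
  proof -
    have cE: "countable ?E" using countable_rat by (rule countable_subset[rotated]) auto
    have cF: "countable ?F" by (rule countable_Collect_finite_subset[OF \<B>(1)])
    have "{\<omega> \<in> space \<Omega>. measure (f \<omega>) (\<Union>F) \<le> measure (g \<omega>) (nbhd (\<Union>F) \<epsilon>) + \<epsilon>} \<in> sets \<Omega>"
      if "F \<in> ?F" for F \<epsilon>
    proof -
      have o: "openin mtopology (\<Union>F)" using \<B>(2) that by (intro openin_Union) auto
      have "openin mtopology (nbhd (\<Union>F) \<epsilon>)" by (rule openin_nbhd) (use openin_subset[OF o] in simp)
      with mf[OF o] mg show ?thesis by measurable
    qed
    from sets.sets_Collect_countable_All'[OF this cF] show ?thesis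
      by (intro sets.sets_Collect_countable_Ex' cE)
  qed
  finally show "{\<omega> \<in> space \<Omega>. dP (f \<omega>) (g \<omega>) < c} \<in> sets \<Omega>" .
qed

end

text \<open>The portmanteau inequality for open sets in the form of lower semicontinuity. An open
  set of a metrizable space is an increasing union of closed sets; a Urysohn function between one of
  these with large mass and \<open>G\<close> provides the weakly open set.\<close>

lemma openin_weak_measure_greater:
  assumes T: "metrizable_space T" and G: "openin T G"
  shows "openin (weak_topology T) {P \<in> prob_measures T. t < measure P G}"
proof (subst openin_subopen, intro ballI)
  fix P assume "P \<in> {P \<in> prob_measures T. t < measure P G}"
  then have P: "P \<in> prob_measures T" "t < measure P G" by auto
  have *: "finite_measure Q" "sets Q = sets (borel_of T)" "space Q = topspace T"
    if "Q \<in> prob_measures T" for Q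
    using that sets_eq_imp_space_eq[of Q "borel_of T"]
    by (auto simp: prob_measures_def prob_space.finite_measure)
  interpret finite_measure P using *[OF P(1)] by simp
  obtain C where C: "\<And>n. closedin T (C n)" "\<And>n. C n \<subseteq> C (Suc n)" "\<Union>(range C) = G"
    using open_imp_fsigma_in[OF T G] unfolding fsigma_in_ascending by blast
  have Cb: "C n \<in> sets (borel_of T)" for n using C(1)[of n] by (simp add: sets_borel_of_closed)
  have "(\<lambda>n. measure P (C n)) \<longlonglongrightarrow> measure P G"
    unfolding C(3)[symmetric] using C(2) Cb *(2)[OF P(1)]
    by (intro finite_Lim_measure_incseq) (auto intro: incseq_SucI)
  then obtain n where n: "t < measure P (C n)"
    using order_tendstoD(1)[of _ _ sequentially t] P(2) by (force simp: eventually_sequentially)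
  have "disjnt (topspace T - G) (C n)" using C(3) by (auto simp: disjnt_def)
  then obtain f where f: "continuous_map T (top_of_set {0..1::real}) f" "f ` (topspace T - G) \<subseteq> {0}" "f ` C n \<subseteq> {1}"
    using Urysohn_lemma[OF metrizable_imp_normal_space[OF T], of "topspace T - G" "C n" 0 1] C(1) G
    by (metis closedin_diff closedin_topspace zero_le_one)
  have cf: "continuous_map T euclideanreal f" and rf: "\<And>x. x \<in> topspace T \<Longrightarrow> f x \<in> {0..1}"
    using f(1) by (auto simp: continuous_map_in_subtopology)
  have bf: "bounded (f ` topspace T)"
    by (rule bounded_subset[of "{0..1}"]) (use rf in auto)
  let ?W = "{Q \<in> prob_measures T. (\<integral>x. f x \<partial>Q) \<in> {t<..}}"
  have int: "integrable Q f" if Q: "Q \<in> prob_measures T" for Q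
  proof -
    interpret Q: finite_measure Q using *[OF Q] by simp
    show ?thesis
      by (rule Q.integrable_const_bound[where B=1])
         (use rf *[OF Q] continuous_map_measurable[OF cf] in \<open>auto cong: measurable_cong_sets\<close>)
  qed
  have "openin (weak_topology T) ?W"
    using openin_continuous_map_preimage[OF continuous_map_weak_integral[OF cf bf], of "{t<..}"] by simp
  moreover have "P \<in> ?W"
  proof -
    have "measure P (C n) = (\<integral>x. indicator (C n) x \<partial>P)"
      using Cb[of n] sets.sets_into_space[OF Cb[of n]] *[OF P(1)] by (simp add: Int_absorb2)
    also have "\<dots> \<le> (\<integral>x. f x \<partial>P)"
    proof (rule integral_mono[OF _ int[OF P(1)]])
      show "integrable P (indicat_real (C n))" using Cb *[OF P(1)] by (simp add: emeasure_eq_measure)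
      show "indicat_real (C n) x \<le> f x" if "x \<in> space P" for x
        using rf[of x] f(3) that *(3)[OF P(1)] by (auto split: split_indicator)
    qed
    finally show ?thesis using n P(1) by simp
  qed
  moreover have "?W \<subseteq> {P \<in> prob_measures T. t < measure P G}"
  proof
    fix Q assume Q: "Q \<in> ?W"
    then have Qp: "Q \<in> prob_measures T" by simp
    interpret Q: finite_measure Q using *[OF Qp] by simp
    have Gs: "G \<in> sets Q" using borel_of_open[OF G] *[OF Qp] by simp
    have "(\<integral>x. f x \<partial>Q) \<le> (\<integral>x. indicator G x \<partial>Q)"
    proof (rule integral_mono[OF int[OF Qp]])
      show "integrable Q (indicat_real G)" using Gs by (simp add: Q.emeasure_eq_measure)
      show "f x \<le> indicat_real G x" if "x \<in> space Q" for x
        using rf[of x] f(2) that *(3)[OF Qp] by (auto split: split_indicator)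
    qed
    also have "\<dots> = measure Q G" using Gs by simp
    finally show "Q \<in> {P \<in> prob_measures T. t < measure P G}" using Q by auto
  qed
  ultimately show "\<exists>V. openin (weak_topology T) V \<and> P \<in> V \<and> V \<subseteq> {P \<in> prob_measures T. t < measure P G}"
    by blast
qed

section \<open>Weak neighbourhoods and Prokhorov balls\<close>

context Metric_space
begin

text \<open>Finitely many balls of radius \<open>\<delta> / 2\<close> carry all but
  \<open>\<delta> / 2\<close> of the mass of \<open>\<mu>\<close>. The balls that meet a set
  \<open>B\<close> lie in \<open>nbhd B \<delta>\<close>, so it is enough that \<open>\<nu>\<close>
  loses at most \<open>\<delta> / 2\<close> on their union.\<close>

lemma weak_neighbourhood_prokhorov:
  assumes sc: "second_countable mtopology" and \<mu>: "\<mu> \<in> prob_measures mtopology" and \<delta>: "\<delta> > 0"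
  obtains W where "openin (weak_topology mtopology) W" "\<mu> \<in> W" "\<And>\<nu>. \<nu> \<in> W \<Longrightarrow> dP \<mu> \<nu> \<le> \<delta>"
proof -
  interpret m: prob_space \<mu> using \<mu> by (simp add: prob_measures_def)
  have s: "sets \<mu> = sets (borel_of mtopology)" using \<mu> by (auto simp: prob_measures_def)
  have sp: "space \<mu> = M" using s[THEN sets_eq_imp_space_eq] by auto
  have ne: "M \<noteq> {}" using m.not_empty sp by simp
  obtain C where C: "countable C" "C \<subseteq> M" "mtopology closure_of C = M"
    using second_countable_imp_separable_space[OF sc] by (auto simp: separable_space_def)
  have Cne: "C \<noteq> {}" using C(3) ne by auto
  define V where "V i = mball (from_nat_into C i) (\<delta> / 2)" for i
  have Vo: "openin mtopology (V i)" for i by (simp add: V_def)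
  have cover: "(\<Union>i. V i) = M"
  proof (intro equalityI subsetI)
    fix x assume x: "x \<in> M"
    then have "x \<in> mtopology closure_of C" using C(3) by simp
    then obtain c where "c \<in> C" "c \<in> mball x (\<delta> / 2)"
      unfolding metric_closure_of using \<delta> by (smt (verit) half_gt_zero mem_Collect_eq)
    then obtain i where "from_nat_into C i = c" using from_nat_into_surj[OF C(1)] by blast
    then show "x \<in> (\<Union>i. V i)" using \<open>c \<in> mball x (\<delta> / 2)\<close> commute[of x c] by (auto simp: V_def)
  qed (auto simp: V_def)
  have "(\<lambda>n. measure \<mu> (\<Union>i\<in>{..<n}. V i)) \<longlonglongrightarrow> measure \<mu> (\<Union>n. \<Union>i\<in>{..<n}. V i)"
    by (intro m.finite_Lim_measure_incseq monoI UN_mono image_subsetI)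
       (auto simp: s intro!: borel_of_open Vo)
  moreover have "(\<Union>n. \<Union>i\<in>{..<n}. V i) = space \<mu>" using cover sp by auto
  ultimately have "(\<lambda>n. measure \<mu> (\<Union>i\<in>{..<n}. V i)) \<longlonglongrightarrow> 1" by (simp add: m.prob_space)
  then obtain N where N: "1 - \<delta> / 2 < measure \<mu> (\<Union>i\<in>{..<N}. V i)"
    using order_tendstoD(1)[of _ 1 sequentially "1 - \<delta> / 2"] \<delta> by (force simp: eventually_sequentially)
  let ?G = "\<lambda>I. \<Union>i\<in>I. V i"
  have Go: "openin mtopology (?G I)" for I using Vo by auto
  \<comment> \<open>Which union occurs depends on \<open>B\<close>, so all subfamilies are
    controlled. Controlling unions rather than single balls keeps the loss independent of
    \<open>N\<close>.\<close>
  let ?W = "\<Inter>I\<in>Pow {..<N}. {\<nu> \<in> prob_measures mtopology. measure \<mu> (?G I) - \<delta> / 2 < measure \<nu> (?G I)}"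
  have "openin (weak_topology mtopology) ?W"
    by (intro openin_Inter) (auto intro: openin_weak_measure_greater[OF metrizable_space_mtopology Go])
  moreover have "\<mu> \<in> ?W" using \<mu> \<delta> by auto
  moreover have "dP \<mu> \<nu> \<le> \<delta>" if \<nu>: "\<nu> \<in> ?W" for \<nu>
  proof (rule prokhorov_le[OF \<delta>])
    fix B assume B: "B \<in> sets (borel_of mtopology)"
    have \<nu>p: "\<nu> \<in> prob_measures mtopology" using \<nu> by blast
    interpret n: prob_space \<nu> using \<nu>p by (simp add: prob_measures_def)
    have sn: "sets \<nu> = sets (borel_of mtopology)" using \<nu>p by (simp add: prob_measures_def)
    define I where "I = {i \<in> {..<N}. V i \<inter> B \<noteq> {}}"
    have "?G I \<subseteq> nbhd B \<delta>"
    proof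
      fix x assume "x \<in> ?G I"
      then obtain i y where i: "x \<in> V i" "y \<in> V i" "y \<in> B" by (auto simp: I_def)
      let ?c = "from_nat_into C i"
      have "d ?c x < \<delta> / 2" "d ?c y < \<delta> / 2" "x \<in> M" "y \<in> M" "?c \<in> M" using i by (auto simp: V_def)
      then have "d x y < \<delta>" using triangle[of x ?c y] commute[of x ?c] by linarith
      then show "x \<in> nbhd B \<delta>" using i \<open>x \<in> M\<close> by (auto simp: nbhd_def)
    qed
    then have 1: "measure \<nu> (?G I) \<le> measure \<nu> (nbhd B \<delta>)"
      using sets_nbhd[OF B] by (intro n.finite_measure_mono) (auto simp: sn)
    have 2: "measure \<mu> (?G I) - \<delta> / 2 < measure \<nu> (?G I)" using \<nu> by (auto simp: I_def)
    have Gs: "?G J \<in> sets \<mu>" for J using borel_of_open[OF Go] by (simp add: s)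
    have "measure \<mu> B \<le> measure \<mu> (?G I \<union> (space \<mu> - ?G {..<N}))"
      using Gs borel_subset[OF B] by (intro m.finite_measure_mono sets.Un sets.compl_sets) (auto simp: sp I_def)
    also have "\<dots> \<le> measure \<mu> (?G I) + measure \<mu> (space \<mu> - ?G {..<N})"
      using Gs by (intro measure_Un_le) auto
    also have "measure \<mu> (space \<mu> - ?G {..<N}) = 1 - measure \<mu> (?G {..<N})"
      by (rule m.prob_compl[OF Gs])
    finally show "measure \<mu> B \<le> measure \<nu> (nbhd B \<delta>) + \<delta>" using 1 2 N by linarith
  qed
  ultimately show thesis by (rule that)
qed

lemma openin_weak_prokhorov_ball:
  assumes sc: "second_countable mtopology" and \<mu>: "\<mu> \<in> prob_measures mtopology"
  shows "openin (weak_topology mtopology) {\<nu> \<in> prob_measures mtopology. dP \<mu> \<nu> < c}"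
proof (subst openin_subopen, intro ballI)
  fix \<nu> assume "\<nu> \<in> {\<nu> \<in> prob_measures mtopology. dP \<mu> \<nu> < c}"
  then have \<nu>: "\<nu> \<in> prob_measures mtopology" "dP \<mu> \<nu> < c" by auto
  then have "(c - dP \<mu> \<nu>) / 2 > 0" by simp
  from weak_neighbourhood_prokhorov[OF sc \<nu>(1) this] obtain W where
    W: "openin (weak_topology mtopology) W" "\<nu> \<in> W"
      "\<And>\<kappa>. \<kappa> \<in> W \<Longrightarrow> dP \<nu> \<kappa> \<le> (c - dP \<mu> \<nu>) / 2" by metis
  have "W \<subseteq> {\<nu> \<in> prob_measures mtopology. dP \<mu> \<nu> < c}"
  proof
    fix \<kappa> assume \<kappa>: "\<kappa> \<in> W"
    then have "\<kappa> \<in> prob_measures mtopology" using openin_subset[OF W(1)] by auto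
    then show "\<kappa> \<in> {\<nu> \<in> prob_measures mtopology. dP \<mu> \<nu> < c}"
      using prokhorov_triangle[OF \<mu> \<nu>(1), of \<kappa>] W(3)[OF \<kappa>] \<nu>(2) by (simp add: field_simps)
  qed
  then show "\<exists>V. openin (weak_topology mtopology) V \<and> \<nu> \<in> V \<and> V \<subseteq> {\<nu> \<in> prob_measures mtopology. dP \<mu> \<nu> < c}"
    using W by blast
qed

text \<open>A union of weakly open balls, for arbitrary \<open>B\<close>. It makes the
  neighbourhoods in the outer Prokhorov distance Borel sets of the weak topology.\<close>

lemma openin_weak_prokhorov_nbhd:
  assumes sc: "second_countable mtopology" and B: "B \<subseteq> prob_measures mtopology"
  shows "openin (weak_topology mtopology) {p \<in> prob_measures mtopology. \<exists>y\<in>B. dP p y < c}"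
proof -
  have "{p \<in> prob_measures mtopology. \<exists>y\<in>B. dP p y < c} =
      (\<Union>y\<in>B. {p \<in> prob_measures mtopology. dP y p < c})"
    using B prokhorov_commute by auto (metis subset_iff)+
  also have "openin (weak_topology mtopology) \<dots>"
    using B by (intro openin_Union) (auto intro: openin_weak_prokhorov_ball[OF sc])
  finally show ?thesis .
qed

end

section \<open>Maximal inequalities for sums of independent variables\<close>

text \<open>The sets \<open>disjointed E k\<close> (first entrance at index \<open>k\<close>) are
  disjoint and still belong to \<open>F k\<close> because \<open>F\<close> increases; adding the
  local inequalities over them gives the global one. It serves once for partial sums of independent
  variables and once for conditional expectations.\<close>

lemma first_passage:
  fixes E :: "nat \<Rightarrow> 'a set" and F :: "nat \<Rightarrow> 'a set set" and g :: "'a \<Rightarrow> ennreal"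
  assumes F: "\<And>k. sigma_algebra (space M) (F k)" "\<And>k. F k \<subseteq> sets M" "\<And>j k. j \<le> k \<Longrightarrow> F j \<subseteq> F k"
    and E: "\<And>k. E k \<in> F k" and g: "g \<in> borel_measurable M"
    and le: "\<And>k A. A \<in> F k \<Longrightarrow> A \<subseteq> E k \<Longrightarrow> c * emeasure M A \<le> (\<integral>\<^sup>+x\<in>A. g x \<partial>M)"
  shows "c * emeasure M (\<Union>k. E k) \<le> (\<integral>\<^sup>+x. g x \<partial>M)"
proof -
  let ?D = "disjointed E"
  have DF: "?D k \<in> F k" for k
  proof -
    interpret sigma_algebra "space M" "F k" by (rule F)
    have "(\<Union>i\<in>{0..<k}. E i) \<in> F k"
      using E F(3)[of _ k] by (intro finite_UN) (auto intro: less_imp_le)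
    then show ?thesis using E unfolding disjointed_def by blast
  qed
  have Ds: "range ?D \<subseteq> sets M" using DF F(2) by blast
  have "c * emeasure M (\<Union>k. E k) = c * (\<Sum>k. emeasure M (?D k))"
    using suminf_emeasure[OF Ds disjoint_family_disjointed] by (simp add: UN_disjointed_eq)
  also have "\<dots> = (\<Sum>k. c * emeasure M (?D k))" by simp
  also have "\<dots> \<le> (\<Sum>k. \<integral>\<^sup>+x\<in>?D k. g x \<partial>M)"
    using le[OF DF disjointed_subset] by (intro suminf_le) auto
  also have "\<dots> = (\<integral>\<^sup>+x\<in>(\<Union>k. ?D k). g x \<partial>M)"
    using Ds by (intro nn_integral_disjoint_family[symmetric] g disjoint_family_disjointed) auto
  also have "\<dots> \<le> (\<integral>\<^sup>+x. g x \<partial>M)"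
    by (intro nn_integral_mono) (auto split: split_indicator)
  finally show ?thesis .
qed

text \<open>The sigma-algebra generated by the first \<open>n\<close> variables, kept as explicit
  preimages: each of its events comes with a set \<open>B\<close> in the product, and it is against
  such \<open>B\<close> that conditional expectations are tested later.\<close>

definition past :: "'a measure \<Rightarrow> 'b measure \<Rightarrow> (nat \<Rightarrow> 'a \<Rightarrow> 'b) \<Rightarrow> nat \<Rightarrow> 'a set set" where
  "past M N X n = {(\<lambda>\<omega>. \<lambda>i\<in>{..<n}. X i \<omega>) -` B \<inter> space M | B. B \<in> sets (\<Pi>\<^sub>M i\<in>{..<n}. N)}"

lemma pastI: "B \<in> sets (\<Pi>\<^sub>M i\<in>{..<n}. N) \<Longrightarrow> (\<lambda>\<omega>. \<lambda>i\<in>{..<n}. X i \<omega>) -` B \<inter> space M \<in> past M N X n"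
  by (auto simp: past_def)

context
  fixes M :: "'a measure" and N :: "'b measure" and X :: "nat \<Rightarrow> 'a \<Rightarrow> 'b"
  assumes X: "\<And>i. X i \<in> M \<rightarrow>\<^sub>M N"
begin

lemma measurable_past_restrict: "(\<lambda>\<omega>. \<lambda>i\<in>{..<n}. X i \<omega>) \<in> M \<rightarrow>\<^sub>M (\<Pi>\<^sub>M i\<in>{..<n}. N)"
  using X by measurable

lemma past_subset: "past M N X n \<subseteq> sets M"
  using measurable_sets[OF measurable_past_restrict] by (auto simp: past_def)

lemma sigma_algebra_past: "sigma_algebra (space M) (past M N X n)"
proof -
  have "past M N X n = sets (vimage_algebra (space M) (\<lambda>\<omega>. \<lambda>i\<in>{..<n}. X i \<omega>) (\<Pi>\<^sub>M i\<in>{..<n}. N))"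
    using measurable_space[OF measurable_past_restrict[of n]]
    by (subst sets_vimage_algebra2) (auto simp: past_def)
  then show ?thesis
    using sets.sigma_algebra_axioms[of "vimage_algebra (space M) (\<lambda>\<omega>. \<lambda>i\<in>{..<n}. X i \<omega>) (\<Pi>\<^sub>M i\<in>{..<n}. N)"] by simp
qed

lemma past_mono: assumes "j \<le> k" shows "past M N X j \<subseteq> past M N X k"
proof
  fix A assume "A \<in> past M N X j"
  then obtain B where B: "B \<in> sets (\<Pi>\<^sub>M i\<in>{..<j}. N)" "A = (\<lambda>\<omega>. \<lambda>i\<in>{..<j}. X i \<omega>) -` B \<inter> space M"
    by (auto simp: past_def)
  have "(\<lambda>z. restrict z {..<j}) \<in> (\<Pi>\<^sub>M i\<in>{..<k}. N) \<rightarrow>\<^sub>M (\<Pi>\<^sub>M i\<in>{..<j}. N)"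
    using assms by (intro measurable_restrict_subset) auto
  from measurable_sets[OF this B(1)]
  have "(\<lambda>z. restrict z {..<j}) -` B \<inter> space (\<Pi>\<^sub>M i\<in>{..<k}. N) \<in> sets (\<Pi>\<^sub>M i\<in>{..<k}. N)" .
  moreover have "A = (\<lambda>\<omega>. \<lambda>i\<in>{..<k}. X i \<omega>) -` ((\<lambda>z. restrict z {..<j}) -` B \<inter> space (\<Pi>\<^sub>M i\<in>{..<k}. N)) \<inter> space M"
  proof -
    have "restrict (\<lambda>i\<in>{..<k}. X i \<omega>) {..<j} = (\<lambda>i\<in>{..<j}. X i \<omega>)" for \<omega>
      using assms by (auto simp: restrict_def)
    then show ?thesis unfolding B(2) using measurable_space[OF measurable_past_restrict[of k]] by auto
  qed
  ultimately show "A \<in> past M N X k" unfolding past_def by blast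
qed

end

text \<open>Meant for \<open>X i = indicator A - a\<close> with \<open>v = a * (1 - a)\<close>. The
  bounds by 1 on \<open>X i\<close> and on \<open>v\<close> make the fourth moment of
  \<open>S n\<close> linear in \<open>v\<close>, like the second, so that the two can be
  interpolated.\<close>

locale bounded_centered = prob_space +
  fixes X :: "nat \<Rightarrow> 'a \<Rightarrow> real" and v :: real
  assumes indep: "indep_vars (\<lambda>_. borel) X UNIV"
    and bounded: "\<And>i \<omega>. \<bar>X i \<omega>\<bar> \<le> 1"
    and centered: "\<And>i. expectation (X i) = 0"
    and variance_le: "\<And>i. expectation (\<lambda>\<omega>. (X i \<omega>)\<^sup>2) \<le> v"
    and v_le_1: "v \<le> 1"
begin

definition S :: "nat \<Rightarrow> 'a \<Rightarrow> real" where "S n \<omega> = (\<Sum>i<n. X i \<omega>)"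

lemma X_measurable [measurable]: "X i \<in> borel_measurable M"
  using indep by (auto simp: indep_vars_def)

lemma S_measurable [measurable]: "S n \<in> borel_measurable M"
  unfolding S_def by measurable

lemma v_nonneg: "0 \<le> v"
  using order_trans[OF Bochner_Integration.integral_nonneg variance_le[of 0]] by simp

lemma S_bounded: "\<bar>S n \<omega>\<bar> \<le> real n"
proof -
  have "\<bar>S n \<omega>\<bar> \<le> (\<Sum>i<n. \<bar>X i \<omega>\<bar>)" unfolding S_def by (rule sum_abs)
  also have "\<dots> \<le> (\<Sum>i<n. 1)" by (intro sum_mono bounded)
  finally show ?thesis by simp
qed

lemma integrable_S_power [intro, simp]: "integrable M (\<lambda>\<omega>. S n \<omega> ^ p)"
  by (rule integrable_const_bound[where B="real n ^ p"])
     (auto intro!: power_mono S_bounded simp: power_abs)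

lemma integrable_X_power [intro, simp]: "integrable M (\<lambda>\<omega>. X i \<omega> ^ p)"
  by (rule integrable_const_bound[where B=1])
     (auto intro!: power_le_one bounded simp: power_abs)

lemma indep_X_S: "indep_var borel (X n) borel (S n)"
proof -
  have "indep_var borel (X n) borel (\<lambda>\<omega>. \<Sum>i\<in>{..<n}. X i \<omega>)"
    using indep by (intro indep_vars_sum) (auto intro: indep_vars_subset)
  then show ?thesis by (simp add: S_def[abs_def])
qed

lemma expectation_S_X:
  "integrable M (\<lambda>\<omega>. S n \<omega> ^ p * X n \<omega> ^ q)"
  "expectation (\<lambda>\<omega>. S n \<omega> ^ p * X n \<omega> ^ q) = expectation (\<lambda>\<omega>. S n \<omega> ^ p) * expectation (\<lambda>\<omega>. X n \<omega> ^ q)"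
proof -
  have "indep_var borel ((\<lambda>x. x ^ q) \<circ> X n) borel ((\<lambda>x. x ^ p) \<circ> S n)"
    by (rule indep_var_compose[OF indep_X_S]) auto
  then have i: "indep_var borel (\<lambda>\<omega>. X n \<omega> ^ q) borel (\<lambda>\<omega>. S n \<omega> ^ p)" by (simp add: comp_def)
  show "integrable M (\<lambda>\<omega>. S n \<omega> ^ p * X n \<omega> ^ q)"
    using indep_var_integrable[OF i] by (simp add: mult.commute)
  show "expectation (\<lambda>\<omega>. S n \<omega> ^ p * X n \<omega> ^ q) = expectation (\<lambda>\<omega>. S n \<omega> ^ p) * expectation (\<lambda>\<omega>. X n \<omega> ^ q)"
    using indep_var_lebesgue_integral[OF i] by (simp add: mult.commute)
qed

lemma expectation_S: "expectation (S n) = 0"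
  unfolding S_def[abs_def] using centered integrable_X_power[of _ 1] by simp

lemma expectation_S2: "expectation (\<lambda>\<omega>. S n \<omega> ^ 2) \<le> real n * v"
proof (induction n)
  case 0
  then show ?case by (simp add: S_def)
next
  case (Suc n)
  have "S (Suc n) \<omega> ^ 2 = S n \<omega> ^ 2 + 2 * (S n \<omega> ^ 1 * X n \<omega> ^ 1) + X n \<omega> ^ 2" for \<omega>
    by (simp add: S_def power2_eq_square algebra_simps)
  then have "expectation (\<lambda>\<omega>. S (Suc n) \<omega> ^ 2) =
      expectation (\<lambda>\<omega>. S n \<omega> ^ 2) + 2 * expectation (\<lambda>\<omega>. S n \<omega> ^ 1 * X n \<omega> ^ 1) + expectation (\<lambda>\<omega>. X n \<omega> ^ 2)"
    using expectation_S_X(1)[of n 1 1] by (simp add: algebra_simps)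
  also have "\<dots> = expectation (\<lambda>\<omega>. S n \<omega> ^ 2) + expectation (\<lambda>\<omega>. X n \<omega> ^ 2)"
    unfolding expectation_S_X(2) by (simp add: expectation_S)
  finally show ?case using Suc variance_le[of n] by (simp add: algebra_simps)
qed

text \<open>In the expanded recursion the mixed terms with an exponent 1 vanish, because
  \<open>S n\<close> and \<open>X n\<close> are independent and centered. What is left is an
  increment of at most \<open>6 n v + v\<close>, below the increment \<open>8 n v + 4 v\<close> of
  \<open>4 n\<^sup>2 v\<close>.\<close>

lemma expectation_S4: "expectation (\<lambda>\<omega>. S n \<omega> ^ 4) \<le> 4 * (real n)\<^sup>2 * v"
proof (induction n)
  case 0
  then show ?case by (simp add: S_def)
next
  case (Suc n)
  have X4: "expectation (\<lambda>\<omega>. X n \<omega> ^ 4) \<le> expectation (\<lambda>\<omega>. X n \<omega> ^ 2)"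
  proof (rule integral_mono)
    fix \<omega>
    have "(X n \<omega>)\<^sup>2 \<le> 1" using bounded[of n \<omega>] by (simp add: abs_square_le_1)
    then have "(X n \<omega>)\<^sup>2 * (X n \<omega>)\<^sup>2 \<le> (X n \<omega>)\<^sup>2" by (intro mult_left_le) auto
    then show "X n \<omega> ^ 4 \<le> X n \<omega> ^ 2" by (simp flip: power_add)
  qed auto
  have "S (Suc n) \<omega> ^ 4 = S n \<omega> ^ 4 + 4 * (S n \<omega> ^ 3 * X n \<omega> ^ 1) + 6 * (S n \<omega> ^ 2 * X n \<omega> ^ 2)
      + 4 * (S n \<omega> ^ 1 * X n \<omega> ^ 3) + X n \<omega> ^ 4" for \<omega>
    by (simp add: S_def eval_nat_numeral algebra_simps)
  then have "expectation (\<lambda>\<omega>. S (Suc n) \<omega> ^ 4) = expectation (\<lambda>\<omega>. S n \<omega> ^ 4)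
      + 4 * expectation (\<lambda>\<omega>. S n \<omega> ^ 3 * X n \<omega> ^ 1) + 6 * expectation (\<lambda>\<omega>. S n \<omega> ^ 2 * X n \<omega> ^ 2)
      + 4 * expectation (\<lambda>\<omega>. S n \<omega> ^ 1 * X n \<omega> ^ 3) + expectation (\<lambda>\<omega>. X n \<omega> ^ 4)"
    using expectation_S_X(1)[of n 3 1] expectation_S_X(1)[of n 1 3] by (simp add: expectation_S_X(1))
  also have "\<dots> = expectation (\<lambda>\<omega>. S n \<omega> ^ 4) + 6 * (expectation (\<lambda>\<omega>. S n \<omega> ^ 2) * expectation (\<lambda>\<omega>. X n \<omega> ^ 2))
      + expectation (\<lambda>\<omega>. X n \<omega> ^ 4)"
    unfolding expectation_S_X(2) by (simp add: expectation_S centered)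
  \<comment> \<open>One of the two factors \<open>v\<close> is bounded by 1 to keep the estimate
    linear in \<open>v\<close>.\<close>
  also have "expectation (\<lambda>\<omega>. S n \<omega> ^ 2) * expectation (\<lambda>\<omega>. X n \<omega> ^ 2) \<le> (real n * v) * 1"
    using expectation_S2[of n] variance_le[of n] v_le_1 v_nonneg
    by (intro mult_mono) auto
  finally have "expectation (\<lambda>\<omega>. S (Suc n) \<omega> ^ 4) \<le> 4 * (real n)\<^sup>2 * v + 6 * (real n * v) + v"
    using Suc X4 variance_le[of n] by linarith
  also have "\<dots> \<le> 4 * (real (Suc n))\<^sup>2 * v"
    using v_nonneg by (simp add: power2_eq_square algebra_simps)
  finally show ?case .
qed

text \<open>The second condition on \<open>p\<close> is the tangent line inequality for the convex
  function \<open>x ^ p\<close>, used with \<open>a = S k\<close> and \<open>b = S n - S k\<close>.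
  On an event known at index \<open>k\<close> the linear term has mean zero, since later increments
  are centered and independent of the past. This is the local inequality that
  \<open>first_passage\<close> asks for.\<close>

lemma maximal_inequality:
  assumes p: "even p" "\<And>a b::real. a ^ p + real p * a ^ (p - 1) * b \<le> (a + b) ^ p" and l: "0 \<le> l"
  shows "l ^ p * prob (\<Union>k\<in>{..n}. {\<omega> \<in> space M. l \<le> \<bar>S k \<omega>\<bar>}) \<le> expectation (\<lambda>\<omega>. S n \<omega> ^ p)"
proof -
  let ?F = "past M borel X"
  \<comment> \<open>Indices beyond \<open>n\<close> are switched off: \<open>S n\<close> controls
    only the sums up to \<open>n\<close>.\<close>
  define E where "E k = (if k \<le> n then {\<omega> \<in> space M. l \<le> \<bar>S k \<omega>\<bar>} else {})" for k
  have SU: "(\<Union>k\<in>{..n}. {\<omega> \<in> space M. l \<le> \<bar>S k \<omega>\<bar>}) = (\<Union>k. E k)"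
    by (auto simp: E_def split: if_splits)
  have "ennreal (l ^ p) * emeasure M (\<Union>k. E k) \<le> (\<integral>\<^sup>+\<omega>. ennreal (S n \<omega> ^ p) \<partial>M)"
  proof (rule first_passage[where F="?F"])
    show "E k \<in> ?F k" for k
    proof (cases "k \<le> n")
      case True
      have "{z \<in> space (\<Pi>\<^sub>M i\<in>{..<k}. (borel :: real measure)). l \<le> \<bar>\<Sum>i<k. z i\<bar>} \<in> sets (\<Pi>\<^sub>M i\<in>{..<k}. borel)"
        by measurable
      from pastI[OF this, where X=X and M=M] show ?thesis
        by (rule back_subst[of "\<lambda>A. A \<in> ?F k"]) (auto simp: E_def True S_def space_PiM)
    next
      case False
      then show ?thesis using pastI[OF sets.empty_sets, where X=X and M=M] by (simp add: E_def)
    qed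
    fix k A assume A: "A \<in> ?F k" "A \<subseteq> E k"
    have As: "A \<in> sets M" using A(1) past_subset[where X=X, OF X_measurable] by blast
    show "ennreal (l ^ p) * emeasure M A \<le> (\<integral>\<^sup>+\<omega>\<in>A. ennreal (S n \<omega> ^ p) \<partial>M)"
    proof (cases "k \<le> n")
      case False
      then show ?thesis using A(2) by (simp add: E_def)
    next
      case True
      obtain B where B: "B \<in> sets (\<Pi>\<^sub>M i\<in>{..<k}. borel)" "A = (\<lambda>\<omega>. \<lambda>i\<in>{..<k}. X i \<omega>) -` B \<inter> space M"
        using A(1) by (auto simp: past_def)
      \<comment> \<open>Both factors become functions of disjoint blocks of coordinates, so that
        independence of the blocks carries over to them.\<close>
      let ?f = "\<lambda>z. indicator B z * (\<Sum>i<k. z i) ^ (p - 1) :: real" and ?g = "\<lambda>z. \<Sum>i\<in>{k..<n}. z i :: real"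
      have "indep_var (\<Pi>\<^sub>M i\<in>{..<k}. borel) (\<lambda>\<omega>. \<lambda>i\<in>{..<k}. X i \<omega>) (\<Pi>\<^sub>M i\<in>{k..<n}. borel) (\<lambda>\<omega>. \<lambda>i\<in>{k..<n}. X i \<omega>)"
        by (rule indep_var_restrict[OF indep]) auto
      then have "indep_var borel (?f \<circ> (\<lambda>\<omega>. \<lambda>i\<in>{..<k}. X i \<omega>)) borel (?g \<circ> (\<lambda>\<omega>. \<lambda>i\<in>{k..<n}. X i \<omega>))"
      proof (rule indep_var_compose)
        show "?f \<in> borel_measurable (\<Pi>\<^sub>M i\<in>{..<k}. borel)" using B(1) by measurable
        show "?g \<in> borel_measurable (\<Pi>\<^sub>M i\<in>{k..<n}. borel)" by measurable
      qed
      then have ind: "indep_var borel (\<lambda>\<omega>. ?f (\<lambda>i\<in>{..<k}. X i \<omega>)) borel (\<lambda>\<omega>. S n \<omega> - S k \<omega>)"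
      proof (rule arg_cong2[where f="\<lambda>a b. indep_var borel a borel b", THEN iffD1, rotated -1])
        have "S n \<omega> - S k \<omega> = (\<Sum>i\<in>{k..<n}. X i \<omega>)" for \<omega>
          using True by (simp add: S_def lessThan_atLeast0 sum_diff_nat_ivl)
        then show "?g \<circ> (\<lambda>\<omega>. \<lambda>i\<in>{k..<n}. X i \<omega>) = (\<lambda>\<omega>. S n \<omega> - S k \<omega>)" by (simp add: fun_eq_iff)
      qed (simp add: fun_eq_iff)
      have bd: "integrable M (\<lambda>\<omega>. indicator A \<omega> * S j \<omega> ^ q)" for j q
        using As by (intro integrable_real_mult_indicator[of A M, unfolded mult.commute[of _ "indicator _ _"]]) auto
      have fi: "integrable M (\<lambda>\<omega>. ?f (\<lambda>i\<in>{..<k}. X i \<omega>))"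
        using bd[of k "p - 1"] by (rule Bochner_Integration.integrable_cong[THEN iffD1, rotated -1])
           (auto simp: S_def B(2) split: split_indicator)
      have gi: "integrable M (\<lambda>\<omega>. S n \<omega> - S k \<omega>)"
        using integrable_S_power[of n 1] integrable_S_power[of k 1] by simp
      have g0: "expectation (\<lambda>\<omega>. S n \<omega> - S k \<omega>) = 0"
        using integrable_S_power[of n 1] integrable_S_power[of k 1] by (simp add: expectation_S)
      have "expectation (\<lambda>\<omega>. (indicator A \<omega> * S k \<omega> ^ (p - 1)) * (S n \<omega> - S k \<omega>)) =
          expectation (\<lambda>\<omega>. ?f (\<lambda>i\<in>{..<k}. X i \<omega>) * (S n \<omega> - S k \<omega>))"
        by (rule Bochner_Integration.integral_cong) (auto simp: S_def B(2) split: split_indicator)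
      also have "\<dots> = 0"
        using indep_var_lebesgue_integral[OF ind fi gi] g0 by simp
      finally have zero: "expectation (\<lambda>\<omega>. (indicator A \<omega> * S k \<omega> ^ (p - 1)) * (S n \<omega> - S k \<omega>)) = 0" .
      have zi: "integrable M (\<lambda>\<omega>. (indicator A \<omega> * S k \<omega> ^ (p - 1)) * (S n \<omega> - S k \<omega>))"
        using indep_var_integrable[OF ind fi gi]
        by (rule Bochner_Integration.integrable_cong[THEN iffD1, rotated -1])
           (auto simp: S_def B(2) split: split_indicator)
      have "l ^ p * prob A = expectation (\<lambda>\<omega>. indicator A \<omega> * l ^ p)" using As by simp
      also have "\<dots> \<le> expectation (\<lambda>\<omega>. indicator A \<omega> * S k \<omega> ^ p)"
      proof (rule integral_mono[OF _ bd])
        show "integrable M (\<lambda>\<omega>. indicator A \<omega> * l ^ p)" using As by (simp add: emeasure_eq_measure)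
        fix \<omega> assume "\<omega> \<in> space M"
        have "l ^ p \<le> S k \<omega> ^ p" if "\<omega> \<in> A"
        proof -
          have "l \<le> \<bar>S k \<omega>\<bar>" using that A(2) True by (auto simp: E_def)
          then have "l ^ p \<le> \<bar>S k \<omega>\<bar> ^ p" using l by (rule power_mono)
          then show ?thesis using p(1) by (simp add: power_even_abs)
        qed
        then show "indicator A \<omega> * l ^ p \<le> indicator A \<omega> * S k \<omega> ^ p" by (auto split: split_indicator)
      qed
      \<comment> \<open>Inserting a term of mean zero turns the integrand into the tangent line at
        \<open>S k\<close>.\<close>
      also have "\<dots> = expectation (\<lambda>\<omega>. indicator A \<omega> * S k \<omega> ^ p + real p * ((indicator A \<omega> * S k \<omega> ^ (p - 1)) * (S n \<omega> - S k \<omega>)))"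
        using bd[of k p] zi zero by simp
      also have "\<dots> \<le> expectation (\<lambda>\<omega>. indicator A \<omega> * S n \<omega> ^ p)"
      proof (rule integral_mono[OF _ bd])
        show "integrable M (\<lambda>\<omega>. indicator A \<omega> * S k \<omega> ^ p + real p * ((indicator A \<omega> * S k \<omega> ^ (p - 1)) * (S n \<omega> - S k \<omega>)))"
          using bd[of k p] zi by simp
        show "indicator A \<omega> * S k \<omega> ^ p + real p * ((indicator A \<omega> * S k \<omega> ^ (p - 1)) * (S n \<omega> - S k \<omega>))
            \<le> indicator A \<omega> * S n \<omega> ^ p" for \<omega>
          using p(2)[of "S k \<omega>" "S n \<omega> - S k \<omega>"] by (auto split: split_indicator)
      qed
      finally have "ennreal (l ^ p * prob A) \<le> ennreal (expectation (\<lambda>\<omega>. indicator A \<omega> * S n \<omega> ^ p))"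
        by (rule ennreal_leI)
      also have "\<dots> = (\<integral>\<^sup>+\<omega>. ennreal (indicator A \<omega> * S n \<omega> ^ p) \<partial>M)"
        using p(1) by (intro nn_integral_eq_integral[symmetric] bd) (auto simp: zero_le_even_power)
      also have "\<dots> = (\<integral>\<^sup>+\<omega>\<in>A. ennreal (S n \<omega> ^ p) \<partial>M)"
        by (intro nn_integral_cong) (auto split: split_indicator)
      finally show ?thesis using l by (simp add: emeasure_eq_measure ennreal_mult)
    qed
  next
    show "sigma_algebra (space M) (?F k)" "?F k \<subseteq> sets M" for k
      by (rule sigma_algebra_past[where X=X, OF X_measurable], rule past_subset[where X=X, OF X_measurable])
    show "?F j \<subseteq> ?F k" if "j \<le> k" for j k
      using past_mono[where X=X, OF X_measurable that] .
  qed measurable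
  also have "\<dots> = ennreal (expectation (\<lambda>\<omega>. S n \<omega> ^ p))"
    using p(1) by (intro nn_integral_eq_integral) (auto simp: zero_le_even_power)
  finally have "ennreal (l ^ p * prob (\<Union>k. E k)) \<le> ennreal (expectation (\<lambda>\<omega>. S n \<omega> ^ p))"
    using l by (simp add: emeasure_eq_measure ennreal_mult)
  moreover have "0 \<le> expectation (\<lambda>\<omega>. S n \<omega> ^ p)"
    using p(1) by (intro integral_nonneg_AE) (auto simp: zero_le_even_power)
  ultimately show ?thesis unfolding SU by (simp add: ennreal_le_iff)
qed

end

section \<open>Expectations from polynomial tail bounds\<close>

context prob_space
begin

text \<open>The part of \<open>T\<close> below a free threshold \<open>c\<close> costs
  \<open>c\<close>, and the slice from \<open>c * 2 ^ j\<close> to \<open>c * 2 ^ Suc j\<close> is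
  charged to the probability of exceeding its lower end. Since \<open>s\<close> is at least 2, the
  resulting series is dominated by a geometric one with ratio \<open>1 / 2\<close>.\<close>

lemma nn_integral_weak_tail_aux:
  fixes T :: "'a \<Rightarrow> ennreal"
  assumes T [measurable]: "T \<in> borel_measurable M" and s: "2 \<le> s" and v: "0 \<le> v" and K: "0 \<le> K"
    and tail: "\<And>l. 0 < l \<Longrightarrow> emeasure M {\<omega> \<in> space M. ennreal l < T \<omega>} \<le> ennreal (K * v * l powr - s)"
    and c: "0 < c"
  shows "(\<integral>\<^sup>+\<omega>. T \<omega> \<partial>M) \<le> ennreal (c + 4 * K * v * c powr (1 - s))"
proof -
  let ?E = "\<lambda>j::nat. {\<omega> \<in> space M. ennreal (c * 2 ^ j) < T \<omega>}"
  let ?R = "\<lambda>\<omega>. \<Sum>j. ennreal (c * 2 ^ Suc j) * indicator (?E j) \<omega>"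
  have pw: "T \<omega> \<le> ennreal c + ?R \<omega>" if \<omega>: "\<omega> \<in> space M" for \<omega>
  proof -
    \<comment> \<open>The cap allows an induction on the number of levels even where
      \<open>T \<omega>\<close> is infinite.\<close>
    have part: "min (T \<omega>) (ennreal (c * 2 ^ J)) \<le> ennreal c + (\<Sum>j<J. ennreal (c * 2 ^ Suc j) * indicator (?E j) \<omega>)" for J
    proof (induction J)
      case (Suc J)
      show ?case
      proof (cases "ennreal (c * 2 ^ J) < T \<omega>")
        case True
        have "min (T \<omega>) (ennreal (c * 2 ^ Suc J)) \<le> ennreal (c * 2 ^ Suc J) * indicator (?E J) \<omega>"
          using True \<omega> by simp
        also have "\<dots> \<le> ennreal c + (\<Sum>j<Suc J. ennreal (c * 2 ^ Suc j) * indicator (?E j) \<omega>)"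
          unfolding sum.lessThan_Suc by (rule order_trans[OF _ add_increasing]) (auto intro: add_increasing)
        finally show ?thesis .
      next
        case False
        then have "min (T \<omega>) (ennreal (c * 2 ^ Suc J)) \<le> min (T \<omega>) (ennreal (c * 2 ^ J))" by simp
        also note Suc
        also have "ennreal c + (\<Sum>j<J. ennreal (c * 2 ^ Suc j) * indicator (?E j) \<omega>)
            \<le> ennreal c + (\<Sum>j<Suc J. ennreal (c * 2 ^ Suc j) * indicator (?E j) \<omega>)"
          by (intro add_left_mono) simp
        finally show ?thesis .
      qed
    qed simp
    have le: "min (T \<omega>) (ennreal (c * 2 ^ J)) \<le> ennreal c + ?R \<omega>" for J
      by (rule order_trans[OF part]) (intro add_left_mono sum_le_suminf, auto)
    show ?thesis
    proof (rule ccontr)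
      assume n: "\<not> T \<omega> \<le> ennreal c + ?R \<omega>"
      then obtain x where x: "0 \<le> x" "ennreal c + ?R \<omega> = ennreal x"
        by (cases "ennreal c + ?R \<omega>") (auto simp: top_unique)
      obtain J where "x / c < 2 ^ J" using real_arch_pow[of 2 "x / c"] by auto
      then have "x < c * 2 ^ J" using c by (simp add: field_simps)
      then have "ennreal x < min (T \<omega>) (ennreal (c * 2 ^ J))"
        using n x by (simp add: ennreal_less_iff)
      with le[of J] x(2) show False by (metis not_le)
    qed
  qed
  have "(\<integral>\<^sup>+\<omega>. T \<omega> \<partial>M) \<le> (\<integral>\<^sup>+\<omega>. ennreal c + ?R \<omega> \<partial>M)"
    by (intro nn_integral_mono pw)
  also have "\<dots> = ennreal c + (\<Sum>j. ennreal (c * 2 ^ Suc j) * emeasure M (?E j))"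
    by (subst nn_integral_add) (auto simp: emeasure_space_1 nn_integral_suminf nn_integral_cmult)
  also have "(\<Sum>j. ennreal (c * 2 ^ Suc j) * emeasure M (?E j)) \<le> (\<Sum>j. ennreal (2 * K * v * c powr (1 - s) * (1 / 2) ^ j))"
  proof (intro suminf_le allI)
    fix j
    have "ennreal (c * 2 ^ Suc j) * emeasure M (?E j) \<le> ennreal (c * 2 ^ Suc j) * ennreal (K * v * (c * 2 ^ j) powr - s)"
      using c by (intro mult_left_mono tail) auto
    also have "\<dots> = ennreal ((c * 2 ^ Suc j) * (K * v * (c * 2 ^ j) powr - s))"
      using c K v by (intro ennreal_mult[symmetric]) auto
    also have "\<dots> \<le> ennreal (2 * K * v * c powr (1 - s) * (1 / 2) ^ j)"
    proof (rule ennreal_leI)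
      have "(2 ^ j :: real) powr - s \<le> (2 ^ j) powr (- 2)" using s by (intro powr_mono) auto
      also have "\<dots> = (1 / 2) ^ j * (1 / 2) ^ j"
        by (simp add: powr_minus powr_numeral power2_eq_square field_simps)
      finally have "2 ^ j * (2 ^ j :: real) powr - s \<le> 2 ^ j * ((1 / 2) ^ j * (1 / 2) ^ j)" by (rule mult_left_mono) simp
      also have "\<dots> = (1 / 2) ^ j" by (simp add: field_simps)
      finally have "(2 * K * v * (c * c powr - s)) * (2 ^ j * (2 ^ j) powr - s) \<le> (2 * K * v * (c * c powr - s)) * (1 / 2) ^ j"
        using c K v by (intro mult_left_mono) auto
      moreover have "c * c powr - s = c powr (1 - s)"
        using c by (simp add: powr_diff powr_minus field_simps)
      moreover have "(c * 2 ^ j) powr - s = c powr - s * (2 ^ j) powr - s" using c by (simp add: powr_mult)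
      moreover from this have "(c * 2 ^ Suc j) * (K * v * (c * 2 ^ j) powr - s) =
          (2 * K * v * (c * c powr - s)) * (2 ^ j * (2 ^ j) powr - s)" by simp
      ultimately show "(c * 2 ^ Suc j) * (K * v * (c * 2 ^ j) powr - s) \<le> 2 * K * v * c powr (1 - s) * (1 / 2) ^ j"
        by metis
    qed
    finally show "ennreal (c * 2 ^ Suc j) * emeasure M (?E j) \<le> ennreal (2 * K * v * c powr (1 - s) * (1 / 2) ^ j)" .
  qed auto
  also have "(\<Sum>j. ennreal (2 * K * v * c powr (1 - s) * (1 / 2) ^ j)) = ennreal (2 * K * v * c powr (1 - s) * 2)"
  proof (rule suminf_ennreal_eq)
    have "(\<lambda>j. (1 / 2 :: real) ^ j) sums 2" using geometric_sums[of "1 / 2 :: real"] by simp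
    then show "(\<lambda>j. 2 * K * v * c powr (1 - s) * (1 / 2) ^ j) sums (2 * K * v * c powr (1 - s) * 2)" by (rule sums_mult)
  qed (use K v in auto)
  also have "ennreal c + ennreal (2 * K * v * c powr (1 - s) * 2) = ennreal (c + 4 * K * v * c powr (1 - s))"
    using c K v by (subst ennreal_plus[symmetric]) auto
  finally show ?thesis by (simp add: add_left_mono)
qed

text \<open>The threshold \<open>c = v powr (1 / s)\<close> balances the two terms of the preceding
  bound, since then \<open>v * c powr (1 - s) = c\<close>. For \<open>v = 0\<close> the threshold is
  sent to 0 instead.\<close>

lemma nn_integral_weak_tail:
  fixes T :: "'a \<Rightarrow> ennreal"
  assumes T: "T \<in> borel_measurable M" and s: "2 \<le> s" and v: "0 \<le> v" and K: "0 \<le> K"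
    and tail: "\<And>l. 0 < l \<Longrightarrow> emeasure M {\<omega> \<in> space M. ennreal l < T \<omega>} \<le> ennreal (K * v * l powr - s)"
  shows "(\<integral>\<^sup>+\<omega>. T \<omega> \<partial>M) \<le> ennreal ((1 + 4 * K) * v powr (1 / s))"
proof (cases "v = 0")
  case True
  have "(\<integral>\<^sup>+\<omega>. T \<omega> \<partial>M) \<le> 0"
    by (rule ennreal_le_epsilon) (use nn_integral_weak_tail_aux[OF assms] True in simp)
  then show ?thesis by simp
next
  case False
  then have v0: "v > 0" using v by simp
  have "v * (v powr (1 / s)) powr (1 - s) = v powr (1 + (1 / s) * (1 - s))"
    using v0 by (simp add: powr_powr powr_add)
  also have "1 + (1 / s) * (1 - s) = 1 / s" using s by (simp add: field_simps)
  finally have "v powr (1 / s) + 4 * K * v * (v powr (1 / s)) powr (1 - s) = (1 + 4 * K) * v powr (1 / s)"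
    by (simp add: algebra_simps)
  then show ?thesis using nn_integral_weak_tail_aux[OF assms, of "v powr (1 / s)"] v0 by simp
qed

end

text \<open>The factor 4 comes from the fourth moment, \<open>2 / ln 2\<close> from the ratio of the
  right end \<open>2 ^ (k + 2)\<close> of a dyadic block to the squared normalisation
  \<open>2 ^ (k + 1) * (k + 1) * ln 2\<close> at its left end, and the series from summing over the
  blocks. \<open>sup_const\<close> is what \<open>nn_integral_weak_tail\<close> makes of it.\<close>

definition tail_const :: "real \<Rightarrow> real" where
  "tail_const s = 4 * (2 / ln 2) powr (s / 2) * (\<Sum>k. real (Suc k) powr - (s / 2))"

definition sup_const :: "real \<Rightarrow> real" where
  "sup_const s = 1 + 4 * tail_const s"

lemma summable_tail_const: "2 < s \<Longrightarrow> summable (\<lambda>k. real (Suc k) powr - (s / 2))"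
  using summable_real_powr_iff[of "- (s / 2)"] unfolding summable_Suc_iff[of "\<lambda>k. real k powr - (s / 2)"] by simp

lemma tail_const_nonneg: "2 < s \<Longrightarrow> 0 \<le> tail_const s"
  unfolding tail_const_def by (intro mult_nonneg_nonneg suminf_nonneg summable_tail_const) auto

section \<open>Tails of the normalised partial sums\<close>

context bounded_centered
begin

text \<open>With \<open>u = n / l\<^sup>2\<close> the moments give the bounds \<open>4 v u\<close>
  and \<open>4 v u\<^sup>2\<close>. As \<open>s / 2\<close> lies between 1 and 2, the power
  \<open>u powr (s / 2)\<close> dominates \<open>u\<close> for \<open>u \<ge> 1\<close> and
  \<open>u\<^sup>2\<close> for \<open>u < 1\<close>.\<close>

lemma max_tail:
  assumes l: "0 < l" and s: "2 \<le> s" "s \<le> 4"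
  shows "prob (\<Union>k\<in>{..n}. {\<omega> \<in> space M. l \<le> \<bar>S k \<omega>\<bar>}) \<le> 4 * v * (real n / l\<^sup>2) powr (s / 2)" (is "?p \<le> _")
proof -
  define u where "u = real n / l\<^sup>2"
  have u: "u \<ge> 0" by (simp add: u_def)
  have "l ^ 2 * ?p \<le> real n * v"
    by (rule order_trans[OF maximal_inequality expectation_S2]) (use l in \<open>auto simp: power2_sum\<close>)
  then have "?p \<le> v * u" using l by (simp add: u_def field_simps)
  also have "\<dots> \<le> 4 * v * u" using v_nonneg u by (simp add: mult_right_mono)
  finally have 2: "?p \<le> 4 * v * u" .
  have "a ^ 4 + real 4 * a ^ (4 - 1) * b \<le> (a + b) ^ 4" for a b :: real
  proof -
    \<comment> \<open>The remainder of the tangent line, written with squares to show its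
      sign.\<close>
    have "(a + b) ^ 4 - (a ^ 4 + real 4 * a ^ (4 - 1) * b) = b\<^sup>2 * ((2 * a + b)\<^sup>2 + 2 * a\<^sup>2)"
      by (simp add: eval_nat_numeral algebra_simps)
    also have "\<dots> \<ge> 0" by simp
    finally show ?thesis by simp
  qed
  then have "l ^ 4 * ?p \<le> 4 * (real n)\<^sup>2 * v"
    by (intro order_trans[OF maximal_inequality expectation_S4]) (use l in auto)
  then have 4: "?p \<le> 4 * v * u\<^sup>2" using l by (simp add: u_def field_simps flip: power_mult)
  have "u \<le> u powr (s / 2) \<or> u\<^sup>2 \<le> u powr (s / 2)"
  proof (cases "u \<ge> 1")
    case True
    then have "u powr 1 \<le> u powr (s / 2)" using s by (intro powr_mono) auto
    then show ?thesis using True by simp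
  next
    case False
    show ?thesis
    proof (cases "u = 0")
      case False
      then have "u > 0" "u \<le> 1" using u \<open>\<not> u \<ge> 1\<close> by auto
      then have "u powr 2 \<le> u powr (s / 2)" using s by (intro powr_mono') auto
      then show ?thesis using \<open>u > 0\<close> by (simp add: powr_numeral)
    qed simp
  qed
  then have "4 * v * u \<le> 4 * v * u powr (s / 2) \<or> 4 * v * u\<^sup>2 \<le> 4 * v * u powr (s / 2)"
    using v_nonneg by (meson mult_left_mono mult_nonneg_nonneg zero_le_numeral)
  then show ?thesis using 2 4 unfolding u_def by linarith
qed

text \<open>The supremum starts at 2 because \<open>ln 1 = 0\<close>. Its values are extended
  because its finiteness is only a consequence of the tail bound.\<close>

definition sup_ratio :: "'a \<Rightarrow> ennreal" where
  "sup_ratio \<omega> = (SUP n\<in>{2..}. ennreal (\<bar>S n \<omega>\<bar> / sqrt (real n * ln (real n))))"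

lemma sup_ratio_measurable [measurable]: "sup_ratio \<in> borel_measurable M"
  unfolding sup_ratio_def by measurable

lemma sup_ratio_tail:
  assumes l: "0 < l" and s: "2 < s" "s \<le> 4"
  shows "emeasure M {\<omega> \<in> space M. ennreal l < sup_ratio \<omega>} \<le> ennreal (tail_const s * v * l powr - s)"
proof -
  \<comment> \<open>\<open>l\<close> times the normalisation at the left end
    \<open>2 ^ Suc k\<close> of block \<open>k\<close>, the smallest one on that block.\<close>
  define h where "h k = l * sqrt (2 ^ Suc k * (real (Suc k) * ln 2))" for k
  have h: "h k > 0" for k using l by (simp add: h_def)
  let ?B = "\<lambda>k. \<Union>n\<in>{..2 ^ Suc (Suc k)}. {\<omega> \<in> space M. h k \<le> \<bar>S n \<omega>\<bar>}"
  have "{\<omega> \<in> space M. ennreal l < sup_ratio \<omega>} \<subseteq> (\<Union>k. ?B k)"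
  proof
    fix \<omega> assume "\<omega> \<in> {\<omega> \<in> space M. ennreal l < sup_ratio \<omega>}"
    then obtain n where \<omega>: "\<omega> \<in> space M" and n: "n \<ge> 2" "ennreal l < ennreal (\<bar>S n \<omega>\<bar> / sqrt (real n * ln (real n)))"
      by (auto simp: sup_ratio_def less_SUP_iff)
    obtain j where j: "2 ^ j \<le> n" "n < 2 ^ (j + 1)" using ex_power_ivl1[of 2 n] n(1) by auto
    \<comment> \<open>Since \<open>n \<ge> 2\<close> the exponent is positive, so the logarithm at
      the left end of the block does not vanish.\<close>
    have "j \<noteq> 0" using j(2) n(1) by (cases j) auto
    then obtain k where k: "j = Suc k" by (cases j) auto
    have "real n \<ge> 2 ^ Suc k" using j(1) unfolding k by (metis of_nat_le_iff of_nat_numeral of_nat_power)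
    moreover from this have "ln (real n) \<ge> ln (2 ^ Suc k)" by (intro ln_mono) auto
    then have "ln (real n) \<ge> real (Suc k) * ln 2" by (simp only: ln_realpow)
    ultimately have "2 ^ Suc k * (real (Suc k) * ln 2) \<le> real n * ln (real n)"
      by (intro mult_mono) auto
    then have "h k \<le> l * sqrt (real n * ln (real n))"
      unfolding h_def using l by (intro mult_left_mono real_sqrt_le_mono) auto
    also have "\<dots> \<le> \<bar>S n \<omega>\<bar>"
    proof -
      have "l < \<bar>S n \<omega>\<bar> / sqrt (real n * ln (real n))" using n(2) l by (simp add: ennreal_less_iff)
      moreover have "sqrt (real n * ln (real n)) > 0" using n(1) by simp
      ultimately show ?thesis by (simp add: field_simps)
    qed
    finally show "\<omega> \<in> (\<Union>k. ?B k)" using \<omega> j(2) k by (auto intro!: exI[of _ k] bexI[of _ n])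
  qed
  then have "emeasure M {\<omega> \<in> space M. ennreal l < sup_ratio \<omega>} \<le> emeasure M (\<Union>k. ?B k)"
    by (intro emeasure_mono) auto
  also have "\<dots> \<le> (\<Sum>k. emeasure M (?B k))" by (intro emeasure_subadditive_countably) auto
  also have "\<dots> \<le> (\<Sum>k. ennreal (4 * (2 / ln 2) powr (s / 2) * v * l powr - s * real (Suc k) powr - (s / 2)))"
  proof (intro suminf_le allI)
    fix k
    have "prob (?B k) \<le> 4 * v * (real (2 ^ Suc (Suc k)) / (h k)\<^sup>2) powr (s / 2)"
      using s by (intro max_tail h) auto
    also have "real (2 ^ Suc (Suc k)) / (h k)\<^sup>2 = (2 / ln 2) * (1 / l\<^sup>2) * (1 / real (Suc k))"
    proof -
      have "4 * y / (l\<^sup>2 * (2 * y * (w * L))) = 2 / L * (1 / l\<^sup>2) * (1 / w)" if "y > 0" "w > 0" "L > 0" for y w L :: real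
        using that l by (simp add: field_simps)
      from this[of "2 ^ k" "real (Suc k)" "ln 2"]
      have "4 * 2 ^ k / (l\<^sup>2 * (2 * 2 ^ k * (real (Suc k) * ln 2))) = 2 / ln 2 * (1 / l\<^sup>2) * (1 / real (Suc k))"
        by simp
      moreover have "(h k)\<^sup>2 = l\<^sup>2 * (2 * 2 ^ k * (real (Suc k) * ln 2))" by (simp add: h_def power_mult_distrib)
      moreover have "real (2 ^ Suc (Suc k)) = 4 * 2 ^ k" by simp
      ultimately show ?thesis by simp
    qed
    also have "\<dots> powr (s / 2) = (2 / ln 2) powr (s / 2) * (1 / l\<^sup>2) powr (s / 2) * (1 / real (Suc k)) powr (s / 2)"
      by (simp only: powr_mult)
    also have "(1 / l\<^sup>2) powr (s / 2) = l powr - s"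
    proof -
      have "(1 / l\<^sup>2) = l powr (- 2)" using l by (simp add: powr_minus divide_inverse)
      then show ?thesis using l by (simp add: powr_powr)
    qed
    also have "(1 / real (Suc k)) powr (s / 2) = real (Suc k) powr - (s / 2)"
      by (simp only: powr_divide powr_one_eq_one powr_minus_divide)
    finally show "emeasure M (?B k) \<le> ennreal (4 * (2 / ln 2) powr (s / 2) * v * l powr - s * real (Suc k) powr - (s / 2))"
      by (simp add: emeasure_eq_measure ac_simps ennreal_leI)
  qed auto
  also have "\<dots> = ennreal (4 * (2 / ln 2) powr (s / 2) * v * l powr - s * (\<Sum>k. real (Suc k) powr - (s / 2)))"
    by (rule suminf_ennreal_eq)
       (use v_nonneg s in \<open>auto intro!: sums_mult summable_sums summable_tail_const simp del: of_nat_Suc\<close>)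
  finally show ?thesis by (simp add: tail_const_def ac_simps)
qed

lemma nn_integral_sup_ratio:
  assumes "2 < s" "s \<le> 4"
  shows "(\<integral>\<^sup>+\<omega>. sup_ratio \<omega> \<partial>M) \<le> ennreal (sup_const s * v powr (1 / s))"
  unfolding sup_const_def
  by (rule nn_integral_weak_tail[OF sup_ratio_measurable _ v_nonneg tail_const_nonneg sup_ratio_tail]) (use assms in auto)

end

section \<open>Empirical measures of independent samples\<close>

lemma indep_vars_PiM_coordinates:
  assumes "prob_space p"
  shows "prob_space.indep_vars (\<Pi>\<^sub>M i\<in>(UNIV::nat set). p) (\<lambda>_. p) (\<lambda>i \<omega>. \<omega> i) UNIV"
proof -
  interpret P: prob_space "\<Pi>\<^sub>M i\<in>(UNIV::nat set). p" using assms by (intro prob_space_PiM)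
  have "distr (\<Pi>\<^sub>M i\<in>(UNIV::nat set). p) p (\<lambda>\<omega>. \<omega> i) = p" for i
    using assms by (intro distr_PiM_component) auto
  then show ?thesis
    by (subst P.indep_vars_iff_distr_eq_PiM') (auto simp: distr_id restrict_UNIV)
qed

text \<open>The factor \<open>b\<^sub>n\<close> of the overview. By the conventions for division,
  \<open>rate 0\<close> and \<open>rate 1\<close> are 0.\<close>

definition rate :: "nat \<Rightarrow> real" where "rate n = sqrt (real n / ln (real n))"

lemma rate_nonneg [simp]: "0 \<le> rate n"
  by (cases "n = 0") (auto simp: rate_def)

text \<open>For the centered indicators of \<open>A\<close> the sum \<open>S n\<close> is
  \<open>n\<close> times the discrepancy of \<open>A\<close>, up to sign, and
  \<open>n / sqrt (n * ln n) = rate n\<close>. So the weighted discrepancy is exactly the ratio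
  bounded in \<open>sup_ratio\<close>.\<close>

lemma nn_integral_sup_empirical:
  assumes p: "prob_space p" "sets p = sets N" and A: "A \<in> sets N" and s: "2 < s" "s \<le> 4"
  defines "D \<equiv> \<lambda>\<omega>. SUP n\<in>{2..}. ennreal (rate n * \<bar>measure p A - measure (empirical N n \<omega>) A\<bar>)"
  shows "D \<in> borel_measurable (\<Pi>\<^sub>M i\<in>(UNIV::nat set). p)"
    "(\<integral>\<^sup>+\<omega>. D \<omega> \<partial>(\<Pi>\<^sub>M i\<in>(UNIV::nat set). p))
      \<le> ennreal (sup_const s * (measure p A * (1 - measure p A)) powr (1 / s))"
proof -
  let ?P = "\<Pi>\<^sub>M i\<in>(UNIV::nat set). p"
  define a where "a = measure p A"
  interpret p: prob_space p by fact
  have Ap: "A \<in> sets p" using A p by simp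
  have a: "0 \<le> a" "a \<le> 1" by (auto simp: a_def)
  have comp: "distr ?P p (\<lambda>\<omega>. \<omega> i) = p" for i
    using p by (intro distr_PiM_component) auto
  have integral_comp: "(\<integral>\<omega>. f (\<omega> i) \<partial>?P) = (\<integral>x. f x \<partial>p)" if "f \<in> borel_measurable p" for f :: "_ \<Rightarrow> real" and i
    using integral_distr[of "\<lambda>\<omega>. \<omega> i" ?P p f] that comp[of i] by simp
  interpret P: prob_space ?P using p by (intro prob_space_PiM)
  interpret P: bounded_centered ?P "\<lambda>i \<omega>. indicator A (\<omega> i) - a" "a * (1 - a)"
  proof
    show "P.indep_vars (\<lambda>_. borel) (\<lambda>i \<omega>. indicat_real A (\<omega> i) - a) UNIV"
      using Ap by (intro P.indep_vars_compose2[OF indep_vars_PiM_coordinates[OF p(1)]]) auto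
    show "\<bar>indicat_real A (\<omega> i) - a\<bar> \<le> 1" for i \<omega> using a by (auto split: split_indicator)
    show "P.expectation (\<lambda>\<omega>. indicat_real A (\<omega> i) - a) = 0" for i
      using Ap by (subst integral_comp) (auto simp: p.prob_space a_def p.emeasure_eq_measure)
    show "P.expectation (\<lambda>\<omega>. (indicat_real A (\<omega> i) - a)\<^sup>2) \<le> a * (1 - a)" for i
    proof -
      have "P.expectation (\<lambda>\<omega>. (indicat_real A (\<omega> i) - a)\<^sup>2) = (\<integral>x. (indicat_real A x - a)\<^sup>2 \<partial>p)"
        using Ap by (intro integral_comp) auto
      also have "\<dots> = (\<integral>x. indicat_real A x * (1 - 2 * a) + a\<^sup>2 \<partial>p)"
        by (intro Bochner_Integration.integral_cong) (auto simp: power2_eq_square algebra_simps split: split_indicator)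
      also have "\<dots> = a * (1 - 2 * a) + a\<^sup>2"
        using Ap by (subst Bochner_Integration.integral_add) (auto simp: p.prob_space a_def p.emeasure_eq_measure)
      finally show ?thesis by (simp add: power2_eq_square algebra_simps)
    qed
    show "a * (1 - a) \<le> 1" using a by (simp add: mult_le_one)
  qed
  have eq: "rate n * \<bar>a - measure (empirical N n \<omega>) A\<bar> = \<bar>P.S n \<omega>\<bar> / sqrt (real n * ln (real n))" if n: "n \<ge> 2" for n \<omega>
  proof -
    have card: "(\<Sum>i<n. indicat_real A (\<omega> i)) = real (card {i \<in> {..<n}. \<omega> i \<in> A})"
      by (simp add: indicator_def sum.If_cases Int_def)
    have "P.S n \<omega> = real (card {i \<in> {..<n}. \<omega> i \<in> A}) - real n * a"
      unfolding P.S_def by (simp add: sum_subtractf card)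
    also have "\<dots> = - (real n * (a - measure (empirical N n \<omega>) A))"
      using n measure_empirical[OF A, of n \<omega>] by (simp add: field_simps)
    finally have S: "\<bar>P.S n \<omega>\<bar> = real n * \<bar>a - measure (empirical N n \<omega>) A\<bar>" by (simp add: abs_mult)
    have "real n / sqrt (real n * ln (real n)) = rate n"
      using n by (simp add: rate_def real_sqrt_divide real_sqrt_mult real_div_sqrt field_simps)
    then show ?thesis unfolding S by (metis times_divide_eq_left)
  qed
  have D_eq: "D = P.sup_ratio"
    unfolding D_def P.sup_ratio_def[abs_def] a_def[symmetric] by (intro ext SUP_cong refl) (simp add: eq)
  show "D \<in> borel_measurable ?P" unfolding D_eq by (rule P.sup_ratio_measurable)
  show "(\<integral>\<^sup>+\<omega>. D \<omega> \<partial>?P) \<le> ennreal (sup_const s * (measure p A * (1 - measure p A)) powr (1 / s))"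
    unfolding D_eq a_def[symmetric] by (rule P.nn_integral_sup_ratio[OF s])
qed

lemma sup_const_nonneg: "2 < s \<Longrightarrow> 0 \<le> sup_const s"
  using tail_const_nonneg[of s] by (simp add: sup_const_def)

section \<open>From cell frequencies to the Prokhorov distance\<close>

context Metric_space
begin

text \<open>A Borel set is compared with the union of the cells that meet it. This union lies in the
  neighbourhood because the cells are small; exchanging the measures costs the discrepancies of the
  cells, and the part outside the cells costs the mass of \<open>R\<close>.\<close>

lemma prokhorov_le_partition:
  assumes \<mu>: "\<mu> \<in> prob_measures mtopology" and \<nu>: "\<nu> \<in> prob_measures mtopology"
    and J: "finite J" and C: "\<And>j. j \<in> J \<Longrightarrow> C j \<in> sets (borel_of mtopology)" "disjoint_family_on C J"
    and R: "R \<in> sets (borel_of mtopology)" "(\<Union>j\<in>J. C j) \<union> R = M"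
    and diam: "\<And>j x y. j \<in> J \<Longrightarrow> x \<in> C j \<Longrightarrow> y \<in> C j \<Longrightarrow> d x y < \<delta>" and \<delta>: "\<delta> > 0"
  shows "dP \<mu> \<nu> \<le> \<delta> + (\<Sum>j\<in>J. \<bar>measure \<mu> (C j) - measure \<nu> (C j)\<bar>) + measure \<mu> R"
    (is "_ \<le> ?e")
proof (rule prokhorov_le)
  interpret m: prob_space \<mu> using \<mu> by (simp add: prob_measures_def)
  interpret n: prob_space \<nu> using \<nu> by (simp add: prob_measures_def)
  have s: "sets \<mu> = sets (borel_of mtopology)" "sets \<nu> = sets (borel_of mtopology)"
    using \<mu> \<nu> by (auto simp: prob_measures_def)
  have pos: "0 \<le> (\<Sum>j\<in>J. \<bar>measure \<mu> (C j) - measure \<nu> (C j)\<bar>)" by (intro sum_nonneg) auto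
  then show "?e > 0" using \<delta> by (simp add: add_pos_nonneg)
  fix B assume B: "B \<in> sets (borel_of mtopology)"
  define I where "I = {j \<in> J. C j \<inter> B \<noteq> {}}"
  have I: "finite I" "I \<subseteq> J" using J by (auto simp: I_def)
  have CI: "C ` I \<subseteq> sets (borel_of mtopology)" "disjoint_family_on C I"
    using C I(2) by (auto simp: disjoint_family_on_def)
  have "measure \<mu> B \<le> measure \<mu> ((\<Union>j\<in>I. C j) \<union> R)"
  proof (rule m.finite_measure_mono)
    show "B \<subseteq> (\<Union>j\<in>I. C j) \<union> R" using borel_subset[OF B] R(2) unfolding I_def by blast
  qed (use CI I R in \<open>auto simp: s intro!: sets.Un sets.finite_UN\<close>)
  also have "\<dots> \<le> measure \<mu> (\<Union>j\<in>I. C j) + measure \<mu> R"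
    using CI I R by (intro measure_Un_le sets.finite_UN) (auto simp: s)
  also have "measure \<mu> (\<Union>j\<in>I. C j) = (\<Sum>j\<in>I. measure \<mu> (C j))"
    using CI I by (intro m.finite_measure_finite_Union) (auto simp: s)
  also have "\<dots> \<le> (\<Sum>j\<in>I. measure \<nu> (C j) + \<bar>measure \<mu> (C j) - measure \<nu> (C j)\<bar>)"
    by (intro sum_mono) auto
  also have "\<dots> = (\<Sum>j\<in>I. measure \<nu> (C j)) + (\<Sum>j\<in>I. \<bar>measure \<mu> (C j) - measure \<nu> (C j)\<bar>)"
    by (rule sum.distrib)
  also have "(\<Sum>j\<in>I. measure \<nu> (C j)) = measure \<nu> (\<Union>j\<in>I. C j)"
    using CI I by (intro n.finite_measure_finite_Union[symmetric]) (auto simp: s)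
  also have "\<dots> \<le> measure \<nu> (nbhd B ?e)"
  proof (rule n.finite_measure_mono)
    show "(\<Union>j\<in>I. C j) \<subseteq> nbhd B ?e"
    proof
      fix x assume "x \<in> (\<Union>j\<in>I. C j)"
      then obtain j y where j: "j \<in> J" "x \<in> C j" "y \<in> C j" "y \<in> B" by (auto simp: I_def)
      then have "d x y < ?e" using diam[OF j(1-3)] pos measure_nonneg[of \<mu> R] by linarith
      then show "x \<in> nbhd B ?e" using j borel_subset[OF C(1)[OF j(1)]] by (auto simp: nbhd_def)
    qed
  qed (simp add: s sets_nbhd[OF B])
  also have "(\<Sum>j\<in>I. \<bar>measure \<mu> (C j) - measure \<nu> (C j)\<bar>) \<le> (\<Sum>j\<in>J. \<bar>measure \<mu> (C j) - measure \<nu> (C j)\<bar>)"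
    using J I by (intro sum_mono2) auto
  finally show "measure \<mu> B \<le> measure \<nu> (nbhd B ?e) + ?e" using \<delta> by simp
qed

text \<open>The error of the partition bound depends on \<open>m\<close> and gets multiplied by
  \<open>rate n\<close>, so it cannot be made small for all \<open>n\<close> at once. Hence
  \<open>m\<close> tends to infinity for each fixed \<open>n\<close>, and only then comes the
  supremum over \<open>n\<close>; the liminf of cellwise suprema that bounds it does not involve
  \<open>n\<close> any more.\<close>

lemma nn_integral_sup_prokhorov_empirical:
  fixes C :: "nat \<Rightarrow> nat \<Rightarrow> 'a set" and k :: "nat \<Rightarrow> nat"
  assumes p: "p \<in> prob_measures mtopology" and r: "2 < r"
    and C: "\<And>m j. m \<ge> 1 \<Longrightarrow> j \<in> {1..k m + 1} \<Longrightarrow> C m j \<in> sets (borel_of mtopology)"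
      "\<And>m. m \<ge> 1 \<Longrightarrow> disjoint_family_on (C m) {1..k m}" "\<And>m. m \<ge> 1 \<Longrightarrow> (\<Union>j\<in>{1..k m + 1}. C m j) = M"
    and diam: "\<And>m j x y. m \<ge> 1 \<Longrightarrow> j \<in> {1..k m} \<Longrightarrow> x \<in> C m j \<Longrightarrow> y \<in> C m j \<Longrightarrow> d x y \<le> 1 / real m"
    and rest: "\<And>m. m \<ge> 1 \<Longrightarrow> C (Suc m) (k (Suc m) + 1) \<subseteq> C m (k m + 1)" "(\<Inter>m\<in>{1..}. C m (k m + 1)) = {}"
  shows "(\<integral>\<^sup>+\<omega>. (SUP n\<in>{2..}. ennreal (rate n * dP p (empirical (borel_of mtopology) n \<omega>)))
      \<partial>(\<Pi>\<^sub>M i\<in>(UNIV::nat set). p))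
    \<le> ennreal (sup_const (min r 4)) *
      liminf (\<lambda>m. ennreal (\<Sum>j=1..k m + 1. (measure p (C m j) * (1 - measure p (C m j))) powr (1 / r)))"
proof -
  let ?P = "\<Pi>\<^sub>M i\<in>(UNIV::nat set). p"
  let ?e = "empirical (borel_of mtopology)"
  let ?G = "\<lambda>m. ennreal (\<Sum>j=1..k m + 1. (measure p (C m j) * (1 - measure p (C m j))) powr (1 / r))"
  define s where "s = min r 4"
  have s: "2 < s" "s \<le> 4" "s \<le> r" using r by (auto simp: s_def)
  interpret p: prob_space p using p by (simp add: prob_measures_def)
  have sp: "sets p = sets (borel_of mtopology)" "space p = M"
    using p sets_eq_imp_space_eq[of p "borel_of mtopology"] by (auto simp: prob_measures_def)
  define T where "T m j \<omega> = (SUP n\<in>{2..}. ennreal (rate n * \<bar>measure p (C m j) - measure (?e n \<omega>) (C m j)\<bar>))" for m j \<omega>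
  have Tm: "T m j \<in> borel_measurable ?P" and
    TI: "(\<integral>\<^sup>+\<omega>. T m j \<omega> \<partial>?P) \<le> ennreal (sup_const s * (measure p (C m j) * (1 - measure p (C m j))) powr (1 / s))"
    if "m \<ge> 1" "j \<in> {1..k m + 1}" for m j
    unfolding T_def using nn_integral_sup_empirical[OF p.prob_space_axioms sp(1) C(1)[OF that] s(1,2)] by auto
  \<comment> \<open>\<open>Suc m\<close>, because the cells are controlled from index 1 on.\<close>
  define R where "R m \<omega> = (\<Sum>j=1..k (Suc m) + 1. T (Suc m) j \<omega>)" for m \<omega>
  have Rm: "R m \<in> borel_measurable ?P" for m
    unfolding R_def[abs_def] using Tm by (intro borel_measurable_sum) auto
  \<comment> \<open>Twice the diameter bound, because \<open>prokhorov_le_partition\<close> asks for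
    a strict inequality.\<close>
  define \<eta> where "\<eta> m = 2 / real (Suc m) + measure p (C (Suc m) (k (Suc m) + 1))" for m
  have "(\<lambda>m. 2 / real (Suc m)) \<longlonglongrightarrow> 0"
    using LIMSEQ_Suc[OF lim_const_over_n[of "2::real"]] by simp
  moreover have "(\<lambda>m. measure p (C (Suc m) (k (Suc m) + 1))) \<longlonglongrightarrow> measure p (\<Inter>m. C (Suc m) (k (Suc m) + 1))"
    using C(1) rest(1) by (intro p.finite_Lim_measure_decseq decseq_SucI) (auto simp: sp)
  moreover have "(\<Inter>m. C (Suc m) (k (Suc m) + 1)) = (\<Inter>m\<in>Suc ` UNIV. C m (k m + 1))" by auto
  moreover have "Suc ` UNIV = {1..}" by (auto simp: image_iff) (metis Suc_le_D)
  ultimately have \<eta>0: "\<eta> \<longlonglongrightarrow> 0"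
    unfolding \<eta>_def[abs_def] using rest(2) tendsto_add[of "\<lambda>m. 2 / real (Suc m)" 0 sequentially _ 0] by simp
  have key: "rate n * dP p (?e n \<omega>) \<le> rate n * \<eta> m + rate n * (\<Sum>j=1..k (Suc m) + 1. \<bar>measure p (C (Suc m) j) - measure (?e n \<omega>) (C (Suc m) j)\<bar>)"
    if \<omega>: "\<omega> \<in> space ?P" and n: "n \<ge> 2" for n \<omega> m
  proof -
    have e: "?e n \<omega> \<in> prob_measures mtopology"
      using \<omega> n sp(2) by (intro empirical_prob_measures) (auto simp: space_PiM PiE_iff)
    let ?m = "Suc m"
    have un: "(\<Union>j\<in>{1..k ?m}. C ?m j) \<union> C ?m (k ?m + 1) = M"
      using C(3)[of ?m] by (simp add: atLeastAtMostSuc_conv Un_commute)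
    have "d x y < 2 / real ?m" if "j \<in> {1..k ?m}" "x \<in> C ?m j" "y \<in> C ?m j" for j x y
    proof -
      have "d x y \<le> 1 / real ?m" using diam[of ?m j x y] that by simp
      also have "\<dots> < 2 / real ?m" by (rule divide_strict_right_mono) auto
      finally show ?thesis .
    qed
    then have "dP p (?e n \<omega>) \<le> 2 / real ?m
        + (\<Sum>j\<in>{1..k ?m}. \<bar>measure p (C ?m j) - measure (?e n \<omega>) (C ?m j)\<bar>) + measure p (C ?m (k ?m + 1))"
      using C(1,2)[of ?m] un by (intro prokhorov_le_partition[OF p e]) auto
    \<comment> \<open>The last cell already counts as remainder in \<open>\<eta> m\<close>; its
      discrepancy is added to match the range of the sum in \<open>\<Pi>\<^sub>r\<close>.\<close>
    also have "\<dots> \<le> \<eta> m + (\<Sum>j=1..k ?m + 1. \<bar>measure p (C ?m j) - measure (?e n \<omega>) (C ?m j)\<bar>)"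
      by (simp add: \<eta>_def)
    finally show ?thesis unfolding distrib_left[symmetric] by (rule mult_left_mono) simp
  qed
  have "(SUP n\<in>{2..}. ennreal (rate n * dP p (?e n \<omega>))) \<le> liminf (\<lambda>m. R m \<omega>)"
    if \<omega>: "\<omega> \<in> space ?P" for \<omega>
  proof (rule SUP_least)
    fix n :: nat assume "n \<in> {2..}"
    then have n: "n \<ge> 2" by simp
    show "ennreal (rate n * dP p (?e n \<omega>)) \<le> liminf (\<lambda>m. R m \<omega>)"
    proof (rule ennreal_le_epsilon)
      fix e :: real assume e: "e > 0"
      have "(\<lambda>m. rate n * \<eta> m) \<longlonglongrightarrow> rate n * 0" by (intro tendsto_mult \<eta>0 tendsto_const)
      then have "eventually (\<lambda>m. rate n * \<eta> m < e) sequentially"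
        using e by (intro order_tendstoD(2)) auto
      then have "eventually (\<lambda>m. ennreal (rate n * dP p (?e n \<omega>)) \<le> R m \<omega> + ennreal e) sequentially"
      proof eventually_elim
        case (elim m)
        let ?D = "\<lambda>j. \<bar>measure p (C (Suc m) j) - measure (?e n \<omega>) (C (Suc m) j)\<bar>"
        have "ennreal (rate n * dP p (?e n \<omega>)) \<le> ennreal ((\<Sum>j=1..k (Suc m) + 1. rate n * ?D j) + e)"
          using key[OF \<omega> n, of m] elim by (intro ennreal_leI) (simp add: sum_distrib_left del: sum.cl_ivl_Suc)
        also have "\<dots> = (\<Sum>j=1..k (Suc m) + 1. ennreal (rate n * ?D j)) + ennreal e"
          using e by (subst ennreal_plus) (auto intro!: sum_nonneg simp: sum_ennreal simp del: sum.cl_ivl_Suc)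
        also have "\<dots> \<le> R m \<omega> + ennreal e"
          unfolding R_def T_def using n by (intro add_right_mono sum_mono SUP_upper) auto
        finally show ?case .
      qed
      then have "ennreal (rate n * dP p (?e n \<omega>)) \<le> liminf (\<lambda>m. R m \<omega> + ennreal e)"
        by (rule Liminf_bounded)
      also have "\<dots> = liminf (\<lambda>m. R m \<omega>) + ennreal e" by (rule Liminf_add_const) simp
      finally show "ennreal (rate n * dP p (?e n \<omega>)) \<le> liminf (\<lambda>m. R m \<omega>) + ennreal e" .
    qed
  qed
  then have "(\<integral>\<^sup>+\<omega>. (SUP n\<in>{2..}. ennreal (rate n * dP p (?e n \<omega>))) \<partial>?P)
      \<le> (\<integral>\<^sup>+\<omega>. liminf (\<lambda>m. R m \<omega>) \<partial>?P)"
    by (rule nn_integral_mono)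
  also have "\<dots> \<le> liminf (\<lambda>m. \<integral>\<^sup>+\<omega>. R m \<omega> \<partial>?P)" by (rule nn_integral_liminf[OF Rm])
  also have "\<dots> \<le> liminf (\<lambda>m. ennreal (sup_const s) * ?G (Suc m))"
  proof (intro Liminf_mono always_eventually allI)
    fix m
    let ?v = "\<lambda>j. measure p (C (Suc m) j) * (1 - measure p (C (Suc m) j))"
    have "(\<integral>\<^sup>+\<omega>. R m \<omega> \<partial>?P) = (\<Sum>j=1..k (Suc m) + 1. \<integral>\<^sup>+\<omega>. T (Suc m) j \<omega> \<partial>?P)"
      unfolding R_def using Tm by (intro nn_integral_sum) auto
    also have "\<dots> \<le> (\<Sum>j=1..k (Suc m) + 1. ennreal (sup_const s * ?v j powr (1 / r)))"
    proof (rule sum_mono)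
      fix j assume j: "j \<in> {1..k (Suc m) + 1}"
      \<comment> \<open>The base lies between 0 and 1, so the smaller exponent \<open>1 / r\<close>
        gives the larger value.\<close>
      have "?v j powr (1 / s) \<le> ?v j powr (1 / r)"
        using s by (intro powr_mono' mult_le_one) (auto simp: frac_le)
      then have le: "sup_const s * ?v j powr (1 / s) \<le> sup_const s * ?v j powr (1 / r)"
        using sup_const_nonneg[OF s(1)] by (rule mult_left_mono)
      show "(\<integral>\<^sup>+\<omega>. T (Suc m) j \<omega> \<partial>?P) \<le> ennreal (sup_const s * ?v j powr (1 / r))"
        by (rule order_trans[OF TI ennreal_leI[OF le]]) (use j in simp_all)
    qed
    also have "\<dots> = ennreal (sup_const s) * ennreal (\<Sum>j=1..k (Suc m) + 1. ?v j powr (1 / r))"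
      using sup_const_nonneg[OF s(1)]
      by (subst sum_ennreal) (auto simp: sum_distrib_left[symmetric] ennreal_mult intro!: sum_nonneg ennreal_mult simp del: sum.cl_ivl_Suc)
    finally show "(\<integral>\<^sup>+\<omega>. R m \<omega> \<partial>?P) \<le> ennreal (sup_const s) * ennreal (\<Sum>j=1..k (Suc m) + 1. ?v j powr (1 / r))" .
  qed
  also have "\<dots> = ennreal (sup_const s) * liminf (\<lambda>m. ?G (Suc m))"
    by (rule Liminf_compose_continuous_mono)
       (auto intro!: ennreal_continuous_on_cmult continuous_on_id monoI mult_left_mono)
  also have "liminf (\<lambda>m. ?G (Suc m))
     = liminf (\<lambda>m. ?G m)"
    unfolding Suc_eq_plus1
    by (rule liminf_shift[of ?G])
  finally show ?thesis by (simp add: s_def)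
qed

end

section \<open>Conditional expectations of dominated sequences\<close>

context prob_space
begin

context
  fixes N :: "'b measure" and X :: "nat \<Rightarrow> 'a \<Rightarrow> 'b"
  assumes X: "\<And>i. X i \<in> M \<rightarrow>\<^sub>M N"
    and gen: "sets M = sigma_sets (space M) (\<Union>n. past M N X n)"
begin

text \<open>The events that finitely many observations determine up to small probability form a
  sigma-algebra. For a countable union, all but finitely many sets are dropped and the others are
  approximated at a common index. Together with \<open>first_passage\<close> this takes the place of
  martingale convergence.\<close>

lemma past_approx:
  assumes "A \<in> sets M" "0 < \<delta>"
  shows "\<exists>n. \<exists>B\<in>past M N X n. prob ((A - B) \<union> (B - A)) \<le> \<delta>"
proof -
  note sub = past_subset[where X=X, OF X] and sig = sigma_algebra_past[where X=X, OF X] and mono = past_mono[where X=X, OF X]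
  have "A \<in> sigma_sets (space M) (\<Union>n. past M N X n)" using assms(1) gen by simp
  then show ?thesis using assms(2)
  proof (induction A arbitrary: \<delta> rule: sigma_sets.induct)
    case (Basic A)
    then obtain n where "A \<in> past M N X n" by blast
    then show ?case using Basic by (intro exI[of _ n] bexI[of _ A]) auto
  next
    case Empty
    interpret sigma_algebra "space M" "past M N X 0" by (rule sig)
    show ?case using Empty by (intro exI[of _ 0] bexI[of _ "{}"]) auto
  next
    case (Compl A)
    then obtain n B where B: "B \<in> past M N X n" "prob ((A - B) \<union> (B - A)) \<le> \<delta>" by blast
    interpret sigma_algebra "space M" "past M N X n" by (rule sig)
    have As: "A \<in> sets M" using Compl(1) gen by simp
    have "B \<subseteq> space M" using space_closed B(1) by blast
    then have "(space M - A - (space M - B)) \<union> ((space M - B) - (space M - A)) = (A - B) \<union> (B - A)"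
      using sets.sets_into_space[OF As] by blast
    then show ?case using B by (intro exI[of _ n] bexI[of _ "space M - B"]) auto
  next
    case (Union A)
    have As: "A i \<in> sets M" for i using Union(1) gen by simp
    have "(\<lambda>K. prob (\<Union>i\<in>{..<K}. A i)) \<longlonglongrightarrow> prob (\<Union>K. \<Union>i\<in>{..<K}. A i)"
      using As by (intro finite_Lim_measure_incseq monoI UN_mono) auto
    moreover have "(\<Union>K. \<Union>i\<in>{..<K}. A i) = (\<Union>i. A i)" by auto
    ultimately have "(\<lambda>K. prob (\<Union>i\<in>{..<K}. A i)) \<longlonglongrightarrow> prob (\<Union>i. A i)" by simp
    then obtain K where K: "prob (\<Union>i. A i) - \<delta> / 2 < prob (\<Union>i\<in>{..<K}. A i)"
      using order_tendstoD(1)[of _ _ sequentially "prob (\<Union>i. A i) - \<delta> / 2"] Union.prems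
      by (force simp: eventually_sequentially)
    \<comment> \<open>At most \<open>K\<close> errors of this size add up to at most
      \<open>\<delta> / 2\<close>; \<open>Suc K\<close> keeps the denominator positive.\<close>
    define \<gamma> where "\<gamma> = \<delta> / (2 * real (Suc K))"
    have \<gamma>: "\<gamma> > 0" using Union.prems by (simp add: \<gamma>_def)
    have "\<forall>i. \<exists>n B. B \<in> past M N X n \<and> prob ((A i - B) \<union> (B - A i)) \<le> \<gamma>" using Union.IH[OF \<gamma>] by blast
    then obtain n B where B: "\<And>i. B i \<in> past M N X (n i)" "\<And>i. prob ((A i - B i) \<union> (B i - A i)) \<le> \<gamma>"
      by metis
    define m where "m = Max (insert 0 (n ` {..<K}))"
    have nm: "n i \<le> m" if "i < K" for i unfolding m_def using that by (intro Max_ge) auto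
    interpret sigma_algebra "space M" "past M N X m" by (rule sig)
    have Bs: "B i \<in> sets M" for i using B(1) sub by blast
    let ?B = "\<Union>i\<in>{..<K}. B i" and ?A = "\<Union>i\<in>{..<K}. A i"
    have Bm: "?B \<in> past M N X m" using B(1) nm mono by (intro finite_UN) blast+
    have "prob (((\<Union>i. A i) - ?B) \<union> (?B - (\<Union>i. A i)))
        \<le> prob (((\<Union>i. A i) - ?A) \<union> (\<Union>i\<in>{..<K}. (A i - B i) \<union> (B i - A i)))"
      using As Bs by (intro finite_measure_mono) auto
    also have "\<dots> \<le> prob ((\<Union>i. A i) - ?A) + prob (\<Union>i\<in>{..<K}. (A i - B i) \<union> (B i - A i))"
      using As Bs by (intro measure_Un_le) auto
    also have "prob ((\<Union>i. A i) - ?A) = prob (\<Union>i. A i) - prob ?A"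
      using As by (intro finite_measure_Diff) auto
    also have "prob (\<Union>i\<in>{..<K}. (A i - B i) \<union> (B i - A i)) \<le> (\<Sum>i<K. prob ((A i - B i) \<union> (B i - A i)))"
      using As Bs by (intro finite_measure_subadditive_finite) auto
    also have "\<dots> \<le> (\<Sum>i<K. \<gamma>)" by (intro sum_mono B)
    also have "\<dots> \<le> \<delta> / 2" using Union.prems by (simp add: \<gamma>_def field_simps)
    finally show ?case using K Bm by (intro exI[of _ m] bexI[of _ ?B]) auto
  qed
qed

abbreviation Z :: "nat \<Rightarrow> 'a \<Rightarrow> nat \<Rightarrow> 'b" where "Z n \<omega> \<equiv> \<lambda>i\<in>{..<n}. X i \<omega>"

lemma restrict_Z: "m \<le> n \<Longrightarrow> restrict (Z n \<omega>) {..<m} = Z m \<omega>"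
  by (auto simp: restrict_def)

text \<open>Extends \<open>past_approx\<close> from indicators to sums and dominated limits. The two
  summands may use samples of different length, so both are read off the longer one by
  \<open>restrict\<close>.\<close>

lemma L1_approx_past:
  fixes f :: "'a \<Rightarrow> real"
  assumes "integrable M f" "0 < \<delta>"
  shows "\<exists>n. \<exists>g\<in>borel_measurable (\<Pi>\<^sub>M i\<in>{..<n}. N).
    integrable M (\<lambda>\<omega>. g (Z n \<omega>)) \<and> (\<integral>\<omega>. \<bar>f \<omega> - g (Z n \<omega>)\<bar> \<partial>M) \<le> \<delta>"
  using assms
proof (induction f arbitrary: \<delta> rule: integrable_induct)
  case (base A c)
  have "\<delta> / (\<bar>c\<bar> + 1) > 0" using base by simp
  from past_approx[OF base(1) this] obtain n B where
    B: "B \<in> past M N X n" "prob ((A - B) \<union> (B - A)) \<le> \<delta> / (\<bar>c\<bar> + 1)" by blast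
  obtain B' where B': "B' \<in> sets (\<Pi>\<^sub>M i\<in>{..<n}. N)" "B = Z n -` B' \<inter> space M"
    using B(1) by (auto simp: past_def)
  have Bs: "B \<in> sets M" using B(1) past_subset[where X=X, OF X] by blast
  let ?g = "\<lambda>z. indicator B' z * c :: real"
  have g: "?g (Z n \<omega>) = indicator B \<omega> * c" if "\<omega> \<in> space M" for \<omega>
    using that by (simp add: B'(2) indicator_def)
  have "(\<integral>\<omega>. \<bar>indicator A \<omega> *\<^sub>R c - ?g (Z n \<omega>)\<bar> \<partial>M) = (\<integral>\<omega>. indicator ((A - B) \<union> (B - A)) \<omega> * \<bar>c\<bar> \<partial>M)"
    by (intro Bochner_Integration.integral_cong refl) (auto simp: B'(2) split: split_indicator)
  also have "\<dots> = prob ((A - B) \<union> (B - A)) * \<bar>c\<bar>" using base Bs by simp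
  also have "\<dots> \<le> \<delta> / (\<bar>c\<bar> + 1) * \<bar>c\<bar>" by (intro mult_right_mono B) auto
  also have "\<dots> \<le> \<delta>" using base by (simp add: field_simps)
  finally have "(\<integral>\<omega>. \<bar>indicator A \<omega> *\<^sub>R c - ?g (Z n \<omega>)\<bar> \<partial>M) \<le> \<delta>" .
  moreover have "integrable M (\<lambda>\<omega>. ?g (Z n \<omega>))"
    by (subst Bochner_Integration.integrable_cong[OF refl g]) (use Bs in \<open>auto simp: emeasure_eq_measure\<close>)
  moreover have "?g \<in> borel_measurable (\<Pi>\<^sub>M i\<in>{..<n}. N)" using B'(1) by measurable
  ultimately show ?case by (intro exI[of _ n] bexI[of _ ?g] conjI)
next
  case (add f1 f2)
  have "\<delta> / 2 > 0" using add.prems by simp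
  from add.IH(1)[OF this] add.IH(2)[OF this] obtain n1 n2 g1 g2 where
    g: "g1 \<in> borel_measurable (\<Pi>\<^sub>M i\<in>{..<n1}. N)" "integrable M (\<lambda>\<omega>. g1 (Z n1 \<omega>))" "(\<integral>\<omega>. \<bar>f1 \<omega> - g1 (Z n1 \<omega>)\<bar> \<partial>M) \<le> \<delta> / 2"
      "g2 \<in> borel_measurable (\<Pi>\<^sub>M i\<in>{..<n2}. N)" "integrable M (\<lambda>\<omega>. g2 (Z n2 \<omega>))" "(\<integral>\<omega>. \<bar>f2 \<omega> - g2 (Z n2 \<omega>)\<bar> \<partial>M) \<le> \<delta> / 2"
    by blast
  define n where "n = max n1 n2"
  let ?g = "\<lambda>z. g1 (restrict z {..<n1}) + g2 (restrict z {..<n2})"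
  have eq: "?g (Z n \<omega>) = g1 (Z n1 \<omega>) + g2 (Z n2 \<omega>)" for \<omega>
    by (simp add: restrict_Z n_def del: restrict_restrict)
  have r: "(\<lambda>z. restrict z {..<m}) \<in> (\<Pi>\<^sub>M i\<in>{..<n}. N) \<rightarrow>\<^sub>M (\<Pi>\<^sub>M i\<in>{..<m}. N)" if "m \<le> n" for m
    using that by (intro measurable_restrict_subset) auto
  have "?g \<in> borel_measurable (\<Pi>\<^sub>M i\<in>{..<n}. N)"
    using measurable_compose[OF r g(1)] measurable_compose[OF r g(4)] by (intro borel_measurable_add) (auto simp: n_def)
  moreover have "(\<integral>\<omega>. \<bar>f1 \<omega> + f2 \<omega> - ?g (Z n \<omega>)\<bar> \<partial>M) \<le> \<delta>"
  proof -
    have "(\<integral>\<omega>. \<bar>f1 \<omega> + f2 \<omega> - ?g (Z n \<omega>)\<bar> \<partial>M) \<le> (\<integral>\<omega>. \<bar>f1 \<omega> - g1 (Z n1 \<omega>)\<bar> + \<bar>f2 \<omega> - g2 (Z n2 \<omega>)\<bar> \<partial>M)"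
      unfolding eq using g add.hyps by (intro integral_mono) auto
    also have "\<dots> = (\<integral>\<omega>. \<bar>f1 \<omega> - g1 (Z n1 \<omega>)\<bar> \<partial>M) + (\<integral>\<omega>. \<bar>f2 \<omega> - g2 (Z n2 \<omega>)\<bar> \<partial>M)"
      using g add.hyps by (intro Bochner_Integration.integral_add) auto
    finally show ?thesis using g by simp
  qed
  moreover have "integrable M (\<lambda>\<omega>. ?g (Z n \<omega>))" unfolding eq using g by auto
  ultimately show ?case by (intro exI[of _ n] bexI[of _ ?g] conjI)
next
  case (lim f s)
  have "(\<lambda>i. \<integral>\<omega>. \<bar>f \<omega> - s i \<omega>\<bar> \<partial>M) \<longlonglongrightarrow> (\<integral>\<omega>. 0 \<partial>M)"
  proof (rule integral_dominated_convergence[where w="\<lambda>\<omega>. 3 * \<bar>f \<omega>\<bar>"])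
    show "AE \<omega> in M. (\<lambda>i. \<bar>f \<omega> - s i \<omega>\<bar>) \<longlonglongrightarrow> 0"
    proof (rule AE_I2)
      fix \<omega> assume "\<omega> \<in> space M"
      then have "(\<lambda>i. \<bar>f \<omega> - s i \<omega>\<bar>) \<longlonglongrightarrow> \<bar>f \<omega> - f \<omega>\<bar>" using lim by (intro tendsto_intros) auto
      then show "(\<lambda>i. \<bar>f \<omega> - s i \<omega>\<bar>) \<longlonglongrightarrow> 0" by simp
    qed
    show "AE \<omega> in M. norm \<bar>f \<omega> - s i \<omega>\<bar> \<le> 3 * \<bar>f \<omega>\<bar>" for i
    proof (rule AE_I2)
      fix \<omega> assume "\<omega> \<in> space M"
      then have "norm (s i \<omega>) \<le> 2 * norm (f \<omega>)" using lim by blast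
      then show "norm \<bar>f \<omega> - s i \<omega>\<bar> \<le> 3 * \<bar>f \<omega>\<bar>" by simp
    qed
  qed (use lim in auto)
  then obtain i where i: "(\<integral>\<omega>. \<bar>f \<omega> - s i \<omega>\<bar> \<partial>M) < \<delta> / 2"
    using order_tendstoD(2)[of _ 0 sequentially "\<delta> / 2"] lim.prems by (force simp: eventually_sequentially)
  have "\<delta> / 2 > 0" using lim.prems by simp
  from lim.IH[OF this, of i] obtain n g where
    g: "g \<in> borel_measurable (\<Pi>\<^sub>M i\<in>{..<n}. N)" "integrable M (\<lambda>\<omega>. g (Z n \<omega>))" "(\<integral>\<omega>. \<bar>s i \<omega> - g (Z n \<omega>)\<bar> \<partial>M) \<le> \<delta> / 2"
    by blast
  have "(\<integral>\<omega>. \<bar>f \<omega> - g (Z n \<omega>)\<bar> \<partial>M) \<le> (\<integral>\<omega>. \<bar>f \<omega> - s i \<omega>\<bar> + \<bar>s i \<omega> - g (Z n \<omega>)\<bar> \<partial>M)"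
    using g lim.hyps by (intro integral_mono) auto
  also have "\<dots> = (\<integral>\<omega>. \<bar>f \<omega> - s i \<omega>\<bar> \<partial>M) + (\<integral>\<omega>. \<bar>s i \<omega> - g (Z n \<omega>)\<bar> \<partial>M)"
    using g lim.hyps by (intro Bochner_Integration.integral_add) auto
  also have "\<dots> \<le> \<delta>" using g i by linarith
  finally show ?case using g(1,2) by (intro exI[of _ n] bexI[of _ g] conjI)
qed

text \<open>By \<open>cond\<close>, \<open>h n (Z n)\<close> is the conditional expectation of
  \<open>D n\<close> given the first \<open>n\<close> observations, in a form suited to values in
  \<open>ennreal\<close>. If the majorant \<open>W\<close> were a function of finitely many
  observations, later conditional expectations could not exceed it. In general \<open>W\<close> is
  close in mean to such a function, and the maximal inequality bounds the probability that the
  difference ever becomes visible.\<close>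

lemma limsup_cond_le_bound:
  fixes W :: "'a \<Rightarrow> ennreal" and h :: "nat \<Rightarrow> (nat \<Rightarrow> 'b) \<Rightarrow> ennreal" and D :: "nat \<Rightarrow> 'a \<Rightarrow> ennreal"
  assumes W [measurable]: "W \<in> borel_measurable M" "(\<integral>\<^sup>+\<omega>. W \<omega> \<partial>M) < \<infinity>"
    and h: "\<And>n. n \<ge> n0 \<Longrightarrow> h n \<in> borel_measurable (\<Pi>\<^sub>M i\<in>{..<n}. N)"
    and cond: "\<And>n B. n \<ge> n0 \<Longrightarrow> B \<in> sets (\<Pi>\<^sub>M i\<in>{..<n}. N) \<Longrightarrow>
      (\<integral>\<^sup>+\<omega>\<in>Z n -` B \<inter> space M. h n (Z n \<omega>) \<partial>M) = (\<integral>\<^sup>+\<omega>\<in>Z n -` B \<inter> space M. D n \<omega> \<partial>M)"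
    and dom: "\<And>n \<omega>. n \<ge> n0 \<Longrightarrow> \<omega> \<in> space M \<Longrightarrow> D n \<omega> \<le> W \<omega>"
  shows "AE \<omega> in M. limsup (\<lambda>n. h n (Z n \<omega>)) \<le> W \<omega>"
proof -
  have Zm [measurable]: "Z n \<in> M \<rightarrow>\<^sub>M (\<Pi>\<^sub>M i\<in>{..<n}. N)" for n by (rule measurable_past_restrict[where X=X, OF X])
  define w where "w \<omega> = enn2real (W \<omega>)" for \<omega>
  have fin: "AE \<omega> in M. W \<omega> = ennreal (w \<omega>)"
    using nn_integral_PInf_AE[OF W(1)] W(2) by (auto simp: w_def less_top elim!: eventually_mono)
  have wm [measurable]: "w \<in> borel_measurable M" unfolding w_def by measurable
  have wi: "integrable M w"
  proof (rule integrableI_nonneg)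
    have "(\<integral>\<^sup>+\<omega>. ennreal (w \<omega>) \<partial>M) = (\<integral>\<^sup>+\<omega>. W \<omega> \<partial>M)"
      using fin by (intro nn_integral_cong_AE) auto
    then show "(\<integral>\<^sup>+\<omega>. ennreal (w \<omega>) \<partial>M) < \<infinity>" using W(2) by simp
  qed (auto simp: w_def)
  have main: "AE \<omega> in M. limsup (\<lambda>n. h n (Z n \<omega>)) \<le> W \<omega> + 2 * ennreal l" if l: "l > 0" for l :: real
  proof -
    have hm: "(\<lambda>\<omega>. h (n + n0) (Z (n + n0) \<omega>)) \<in> borel_measurable M" for n
      using measurable_compose[OF Zm h] by simp
    have shift: "limsup (\<lambda>n. h n (Z n \<omega>)) = limsup (\<lambda>n. h (n + n0) (Z (n + n0) \<omega>))" for \<omega>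
      by (rule limsup_shift_k[symmetric])
    let ?G = "{\<omega> \<in> space M. \<not> limsup (\<lambda>n. h n (Z n \<omega>)) \<le> W \<omega> + 2 * ennreal l}"
    have G: "?G \<in> sets M" unfolding shift using hm by measurable
    have "ennreal l * emeasure M ?G \<le> 0"
    proof (rule ennreal_le_epsilon)
      fix e :: real assume e: "0 < e"
      then have "e / 2 > 0" by simp
      from L1_approx_past[OF wi this] obtain n1 g where
        g: "g \<in> borel_measurable (\<Pi>\<^sub>M i\<in>{..<n1}. N)" "integrable M (\<lambda>\<omega>. g (Z n1 \<omega>))"
          "(\<integral>\<omega>. \<bar>w \<omega> - g (Z n1 \<omega>)\<bar> \<partial>M) \<le> e / 2" by blast
      have gm [measurable]: "(\<lambda>\<omega>. g (Z n1 \<omega>)) \<in> borel_measurable M" using g(2) by auto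
      \<comment> \<open>\<open>ennreal\<close> clips the approximation at 0. The clipped function
        \<open>?U\<close> and the error \<open>?V\<close> still satisfy
        \<open>w \<le> ?V + ?U\<close>.\<close>
      let ?U = "\<lambda>\<omega>. ennreal (g (Z n1 \<omega>))" and ?V = "\<lambda>\<omega>. ennreal \<bar>w \<omega> - g (Z n1 \<omega>)\<bar>"
      have V: "(\<integral>\<^sup>+\<omega>. ?V \<omega> \<partial>M) \<le> ennreal (e / 2)"
        using g wi by (subst nn_integral_eq_integral) (auto intro!: ennreal_leI)
      \<comment> \<open>From \<open>n1\<close> on \<open>?U\<close> is known at index
        \<open>n\<close>; from \<open>n0\<close> on the hypotheses on \<open>h\<close> and
        \<open>D\<close> are available.\<close>
      define n2 where "n2 = max n1 n0"
      define E where "E n = (if n < n2 then {} else {\<omega> \<in> space M. ?U \<omega> + ennreal l < h n (Z n \<omega>)})" for n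
      have "ennreal l * emeasure M (\<Union>n. E n) \<le> (\<integral>\<^sup>+\<omega>. ?V \<omega> \<partial>M)"
      proof (rule first_passage[where F="past M N X"])
        show "sigma_algebra (space M) (past M N X k)" "past M N X k \<subseteq> sets M" for k
          by (rule sigma_algebra_past[where X=X, OF X], rule past_subset[where X=X, OF X])
        show "past M N X j \<subseteq> past M N X k" if "j \<le> k" for j k
          using past_mono[where X=X, OF X that] .
        show "E n \<in> past M N X n" for n
        proof (cases "n < n2")
          case True
          then show ?thesis using pastI[OF sets.empty_sets, where X=X and M=M] by (simp add: E_def)
        next
          case False
          then have n: "n1 \<le> n" "n0 \<le> n" by (auto simp: n2_def)
          have "(\<lambda>z. restrict z {..<n1}) \<in> (\<Pi>\<^sub>M i\<in>{..<n}. N) \<rightarrow>\<^sub>M (\<Pi>\<^sub>M i\<in>{..<n1}. N)"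
            using n by (intro measurable_restrict_subset) auto
          from measurable_compose[OF this g(1)] h[OF n(2)]
          have "{z \<in> space (\<Pi>\<^sub>M i\<in>{..<n}. N). ennreal (g (restrict z {..<n1})) + ennreal l < h n z} \<in> sets (\<Pi>\<^sub>M i\<in>{..<n}. N)"
            by measurable
          from pastI[OF this, where X=X and M=M] show ?thesis
            by (rule back_subst[of "\<lambda>A. A \<in> past M N X n"])
               (use False measurable_space[OF Zm[of n]] in \<open>auto simp: E_def restrict_Z[OF n(1)] simp del: restrict_restrict\<close>)
        qed
        fix n A assume A: "A \<in> past M N X n" "A \<subseteq> E n"
        show "ennreal l * emeasure M A \<le> (\<integral>\<^sup>+\<omega>\<in>A. ?V \<omega> \<partial>M)"
        proof (cases "n < n2")
          case True
          then show ?thesis using A(2) by (simp add: E_def)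
        next
          case False
          then have n: "n1 \<le> n" "n0 \<le> n" by (auto simp: n2_def)
          obtain B where B: "B \<in> sets (\<Pi>\<^sub>M i\<in>{..<n}. N)" "A = Z n -` B \<inter> space M"
            using A(1) by (auto simp: past_def)
          have As [measurable]: "A \<in> sets M" using A(1) past_subset[where X=X, OF X] by blast
          \<comment> \<open>On \<open>A\<close> the function \<open>h\<close> exceeds
            \<open>?U + l\<close>; its integral over \<open>A\<close> is that of \<open>D\<close>,
            which is below that of \<open>W\<close> and hence of \<open>?V + ?U\<close>. Cancelling
            the finite integral of \<open>?U\<close> leaves the claim.\<close>
          have "ennreal l * emeasure M A + (\<integral>\<^sup>+\<omega>\<in>A. ?U \<omega> \<partial>M) = (\<integral>\<^sup>+\<omega>\<in>A. ?U \<omega> + ennreal l \<partial>M)"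
            using nn_integral_cmult_indicator[OF As, of "ennreal l"]
            by (simp add: distrib_right nn_integral_add add.commute)
          also have "\<dots> \<le> (\<integral>\<^sup>+\<omega>\<in>A. h n (Z n \<omega>) \<partial>M)"
            using A(2) False by (intro nn_integral_mono) (auto simp: E_def split: split_indicator intro: less_imp_le)
          also have "\<dots> = (\<integral>\<^sup>+\<omega>\<in>A. D n \<omega> \<partial>M)" unfolding B(2) by (rule cond[OF n(2) B(1)])
          also have "\<dots> \<le> (\<integral>\<^sup>+\<omega>\<in>A. W \<omega> \<partial>M)"
            using dom[OF n(2)] by (intro nn_integral_mono mult_right_mono) auto
          also have "\<dots> = (\<integral>\<^sup>+\<omega>\<in>A. ennreal (w \<omega>) \<partial>M)"
            using fin by (intro nn_integral_cong_AE) auto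
          also have "\<dots> \<le> (\<integral>\<^sup>+\<omega>\<in>A. ?V \<omega> + ?U \<omega> \<partial>M)"
          proof (intro nn_integral_mono mult_right_mono)
            fix \<omega>
            have "ennreal (w \<omega>) \<le> ennreal (\<bar>w \<omega> - g (Z n1 \<omega>)\<bar> + max 0 (g (Z n1 \<omega>)))" by (intro ennreal_leI) auto
            then show "ennreal (w \<omega>) \<le> ?V \<omega> + ?U \<omega>" by (simp add: ennreal_max_0)
          qed simp
          also have "\<dots> = (\<integral>\<^sup>+\<omega>\<in>A. ?V \<omega> \<partial>M) + (\<integral>\<^sup>+\<omega>\<in>A. ?U \<omega> \<partial>M)"
            by (simp add: distrib_right nn_integral_add)
          finally have "ennreal l * emeasure M A + (\<integral>\<^sup>+\<omega>\<in>A. ?U \<omega> \<partial>M) \<le> (\<integral>\<^sup>+\<omega>\<in>A. ?V \<omega> \<partial>M) + (\<integral>\<^sup>+\<omega>\<in>A. ?U \<omega> \<partial>M)" .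
          moreover have "(\<integral>\<^sup>+\<omega>\<in>A. ?U \<omega> \<partial>M) < \<infinity>"
          proof -
            have "(\<integral>\<^sup>+\<omega>\<in>A. ?U \<omega> \<partial>M) \<le> (\<integral>\<^sup>+\<omega>. ennreal (norm (g (Z n1 \<omega>))) \<partial>M)"
              by (intro nn_integral_mono) (auto split: split_indicator intro!: ennreal_leI)
            also have "\<dots> < \<infinity>" using g(2) by (simp add: integrable_iff_bounded)
            finally show ?thesis .
          qed
          ultimately show ?thesis by (auto simp: ennreal_add_left_cancel_le add.commute)
        qed
      qed measurable
      moreover
      \<comment> \<open>The second bad event: the approximation exceeds \<open>W\<close> by more
        than \<open>l\<close>. By Markov's inequality the same error in mean controls it. Outside
        both bad events, \<open>h n\<close> is at most \<open>W + 2 l\<close> from \<open>n2\<close>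
        on.\<close>
      let ?F = "{\<omega> \<in> space M. \<not> ?U \<omega> \<le> W \<omega> + ennreal l}"
      have "ennreal l * emeasure M ?F \<le> (\<integral>\<^sup>+\<omega>. ?V \<omega> \<partial>M)"
      proof -
        have "ennreal l * emeasure M ?F = (\<integral>\<^sup>+\<omega>. ennreal l * indicator ?F \<omega> \<partial>M)"
          by (rule nn_integral_cmult_indicator[symmetric]) measurable
        also have "\<dots> \<le> (\<integral>\<^sup>+\<omega>. ?V \<omega> \<partial>M)"
        proof (rule nn_integral_mono_AE)
          show "AE \<omega> in M. ennreal l * indicator ?F \<omega> \<le> ?V \<omega>"
            using fin
          proof eventually_elim
            case (elim \<omega>)
            have "l \<le> \<bar>w \<omega> - g (Z n1 \<omega>)\<bar>" if "\<not> ?U \<omega> \<le> W \<omega> + ennreal l"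
            proof (rule ccontr)
              assume "\<not> ?thesis"
              then have "ennreal (g (Z n1 \<omega>)) \<le> ennreal (w \<omega> + l)" by (intro ennreal_leI) auto
              then show False using that l unfolding elim by (simp add: w_def)
            qed
            then show ?case by (auto split: split_indicator intro: ennreal_leI)
          qed
        qed
        finally show ?thesis .
      qed
      moreover have "emeasure M ?G \<le> emeasure M ((\<Union>n. E n) \<union> ?F)"
      proof (rule emeasure_mono)
        show "(\<Union>n. E n) \<union> ?F \<in> sets M"
        proof (intro sets.Un sets.countable_UN)
          have "(\<lambda>\<omega>. h n (Z n \<omega>)) \<in> borel_measurable M" if "n \<ge> n0" for n
            using measurable_compose[OF Zm h] that by simp
          then show "range E \<subseteq> sets M" by (auto simp: E_def n2_def)
        qed measurable
        show "?G \<subseteq> (\<Union>n. E n) \<union> ?F"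
        proof
          fix \<omega> assume \<omega>: "\<omega> \<in> ?G"
          show "\<omega> \<in> (\<Union>n. E n) \<union> ?F"
          proof (rule ccontr)
            assume n: "\<omega> \<notin> (\<Union>n. E n) \<union> ?F"
            have "h n (Z n \<omega>) \<le> W \<omega> + 2 * ennreal l" if "n \<ge> n2" for n
            proof -
              have "h n (Z n \<omega>) \<le> ?U \<omega> + ennreal l" using n \<omega> that by (auto simp: E_def not_less)
              also have "\<dots> \<le> (W \<omega> + ennreal l) + ennreal l" using n \<omega> by (intro add_right_mono) auto
              finally show ?thesis by (simp add: mult_2 add.assoc)
            qed
            then have "limsup (\<lambda>n. h n (Z n \<omega>)) \<le> W \<omega> + 2 * ennreal l"
              by (intro Limsup_bounded) (auto simp: eventually_sequentially)
            then show False using \<omega> by simp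
          qed
        qed
      qed
      moreover have "emeasure M ((\<Union>n. E n) \<union> ?F) \<le> emeasure M (\<Union>n. E n) + emeasure M ?F"
      proof (rule emeasure_subadditive)
        have "(\<lambda>\<omega>. h n (Z n \<omega>)) \<in> borel_measurable M" if "n \<ge> n0" for n
          using measurable_compose[OF Zm h] that by simp
        then show "(\<Union>n. E n) \<in> sets M" by (intro sets.countable_UN) (auto simp: E_def n2_def)
      qed measurable
      ultimately have "ennreal l * emeasure M ?G \<le> ennreal l * (emeasure M (\<Union>n. E n) + emeasure M ?F)"
          "ennreal l * emeasure M (\<Union>n. E n) \<le> ennreal (e / 2)" "ennreal l * emeasure M ?F \<le> ennreal (e / 2)"
        using V by (auto intro: mult_left_mono order_trans)
      then have "ennreal l * emeasure M ?G \<le> ennreal (e / 2) + ennreal (e / 2)"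
        unfolding distrib_left by (meson add_mono order_trans)
      also have "\<dots> = ennreal e" using e by (subst ennreal_plus[symmetric]) auto
      finally show "ennreal l * emeasure M ?G \<le> 0 + ennreal e" by simp
    qed
    then have "emeasure M ?G = 0" using l by simp
    then show ?thesis using G by (intro AE_I[of _ _ ?G]) auto
  qed
  have "AE \<omega> in M. \<forall>k. limsup (\<lambda>n. h n (Z n \<omega>)) \<le> W \<omega> + 2 * ennreal (inverse (real (Suc k)))"
    unfolding AE_all_countable using main by simp
  then show ?thesis
  proof eventually_elim
    case (elim \<omega>)
    show ?case
    proof (rule ennreal_le_epsilon)
      fix e :: real assume e: "0 < e"
      obtain k where k: "inverse (real (Suc k)) < e / 2" using reals_Archimedean[of "e / 2"] e by auto
      have "2 * ennreal (inverse (real (Suc k))) = ennreal (2 * inverse (real (Suc k)))"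
        by (subst ennreal_mult) auto
      also have "\<dots> \<le> ennreal e" using k by (intro ennreal_leI) linarith
      finally show "limsup (\<lambda>n. h n (Z n \<omega>)) \<le> W \<omega> + ennreal e"
        using elim by (meson add_left_mono order_trans)
    qed
  qed
qed

text \<open>The preceding lemma is applied with the supremum of \<open>D n\<close> over
  \<open>n \<ge> m\<close> as majorant. These suprema decrease to the limsup, and only countably
  many null sets have to be collected.\<close>

lemma limsup_cond_le_limsup:
  fixes h :: "nat \<Rightarrow> (nat \<Rightarrow> 'b) \<Rightarrow> ennreal" and D :: "nat \<Rightarrow> 'a \<Rightarrow> ennreal"
  assumes D: "\<And>n. n \<ge> n0 \<Longrightarrow> D n \<in> borel_measurable M"
    and int: "(\<integral>\<^sup>+\<omega>. (SUP n\<in>{n0..}. D n \<omega>) \<partial>M) < \<infinity>"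
    and h: "\<And>n. n \<ge> n0 \<Longrightarrow> h n \<in> borel_measurable (\<Pi>\<^sub>M i\<in>{..<n}. N)"
    and cond: "\<And>n B. n \<ge> n0 \<Longrightarrow> B \<in> sets (\<Pi>\<^sub>M i\<in>{..<n}. N) \<Longrightarrow>
      (\<integral>\<^sup>+\<omega>\<in>Z n -` B \<inter> space M. h n (Z n \<omega>) \<partial>M) = (\<integral>\<^sup>+\<omega>\<in>Z n -` B \<inter> space M. D n \<omega> \<partial>M)"
  shows "AE \<omega> in M. limsup (\<lambda>n. h n (Z n \<omega>)) \<le> limsup (\<lambda>n. D n \<omega>)"
proof -
  have "AE \<omega> in M. \<forall>m. limsup (\<lambda>n. h n (Z n \<omega>)) \<le> (SUP n\<in>{max m n0..}. D n \<omega>)"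
    unfolding AE_all_countable
  proof
    fix m
    show "AE \<omega> in M. limsup (\<lambda>n. h n (Z n \<omega>)) \<le> (SUP n\<in>{max m n0..}. D n \<omega>)"
    proof (rule limsup_cond_le_bound[where ?n0.0="max m n0" and D=D])
      show "(\<lambda>\<omega>. SUP n\<in>{max m n0..}. D n \<omega>) \<in> borel_measurable M"
        using D by (intro borel_measurable_SUP) auto
      have "(\<integral>\<^sup>+\<omega>. (SUP n\<in>{max m n0..}. D n \<omega>) \<partial>M) \<le> (\<integral>\<^sup>+\<omega>. (SUP n\<in>{n0..}. D n \<omega>) \<partial>M)"
        by (intro nn_integral_mono SUP_subset_mono) auto
      then show "(\<integral>\<^sup>+\<omega>. (SUP n\<in>{max m n0..}. D n \<omega>) \<partial>M) < \<infinity>" using int by simp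
      fix n assume n: "n \<ge> max m n0"
      then show "h n \<in> borel_measurable (\<Pi>\<^sub>M i\<in>{..<n}. N)" using h by simp
      show "(\<integral>\<^sup>+\<omega>\<in>Z n -` B \<inter> space M. h n (Z n \<omega>) \<partial>M) = (\<integral>\<^sup>+\<omega>\<in>Z n -` B \<inter> space M. D n \<omega> \<partial>M)"
        if "B \<in> sets (\<Pi>\<^sub>M i\<in>{..<n}. N)" for B
        by (rule cond[OF _ that]) (use n in simp)
      show "D n \<omega> \<le> (SUP n\<in>{max m n0..}. D n \<omega>)" for \<omega>
        using n by (intro SUP_upper) simp
    qed
  qed
  then show ?thesis
  proof eventually_elim
    case (elim \<omega>)
    have "limsup (\<lambda>n. h n (Z n \<omega>)) \<le> (SUP n\<in>{m..}. D n \<omega>)" for m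
      using elim[rule_format, of m] by (rule order_trans) (intro SUP_subset_mono, auto)
    then show ?case unfolding limsup_INF_SUP[of "\<lambda>n. D n \<omega>"] by (intro INF_greatest) auto
  qed
qed

end
end

text \<open>A regular conditional distribution is defined by testing rectangles. The distances to be
  integrated depend both on \<open>pt\<close> and, through the empirical measure, on the sample, so
  the joint law of \<open>Z\<close> and \<open>Y\<close> is identified first, from its values on
  rectangles.\<close>

lemma nn_integral_regular_cond_distr:
  fixes f :: "'z \<times> 'y \<Rightarrow> ennreal"
  assumes M: "prob_space M" and Z [measurable]: "Z \<in> M \<rightarrow>\<^sub>M N" and Y [measurable]: "Y \<in> M \<rightarrow>\<^sub>M K"
    and rcd: "regular_cond_distr M N Z K Y \<kappa>"
    and f [measurable]: "f \<in> borel_measurable (N \<Otimes>\<^sub>M K)"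
  shows "(\<integral>\<^sup>+\<omega>. f (Z \<omega>, Y \<omega>) \<partial>M) = (\<integral>\<^sup>+\<omega>. (\<integral>\<^sup>+y. f (Z \<omega>, y) \<partial>\<kappa> (Z \<omega>)) \<partial>M)"
proof -
  interpret prob_space M by fact
  have \<kappa>: "\<kappa> \<in> N \<rightarrow>\<^sub>M prob_algebra K" and
    r: "\<And>A B. A \<in> sets K \<Longrightarrow> B \<in> sets N \<Longrightarrow> emeasure M {\<omega> \<in> space M. Z \<omega> \<in> B \<and> Y \<omega> \<in> A} =
        (\<integral>\<^sup>+\<omega>\<in>Z -` B \<inter> space M. emeasure (\<kappa> (Z \<omega>)) A \<partial>M)"
    using rcd by (auto simp: regular_cond_distr_def)
  have \<kappa>Z: "(\<lambda>\<omega>. \<kappa> (Z \<omega>)) \<in> M \<rightarrow>\<^sub>M subprob_algebra K"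
    using measurable_compose[OF Z measurable_prob_algebraD[OF \<kappa>]] .
  have \<kappa>p: "prob_space (\<kappa> (Z \<omega>))" "sets (\<kappa> (Z \<omega>)) = sets K" if "\<omega> \<in> space M" for \<omega>
    using measurable_space[OF \<kappa> measurable_space[OF Z that]] by (auto simp: space_prob_algebra)
  define \<mu> where "\<mu> = distr M (N \<Otimes>\<^sub>M K) (\<lambda>\<omega>. (Z \<omega>, Y \<omega>))"
  define L where "L \<omega> = distr (\<kappa> (Z \<omega>)) (N \<Otimes>\<^sub>M K) (Pair (Z \<omega>))" for \<omega>
  have L: "L \<in> M \<rightarrow>\<^sub>M subprob_algebra (N \<Otimes>\<^sub>M K)"
    unfolding L_def by (rule measurable_distr2[OF _ \<kappa>Z]) measurable
  define \<nu> where "\<nu> = M \<bind> L"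
  have s\<nu>: "sets \<nu> = sets (N \<Otimes>\<^sub>M K)" unfolding \<nu>_def by (rule sets_bind[OF sets_kernel[OF L] not_empty])
  have pm: "Pair (Z \<omega>) \<in> \<kappa> (Z \<omega>) \<rightarrow>\<^sub>M N \<Otimes>\<^sub>M K" if "\<omega> \<in> space M" for \<omega>
  proof -
    have "Z \<omega> \<in> space N" using measurable_space[OF Z that] .
    then have "Pair (Z \<omega>) \<in> K \<rightarrow>\<^sub>M N \<Otimes>\<^sub>M K" by measurable
    then show ?thesis using \<kappa>p(2)[OF that] by (simp cong: measurable_cong_sets)
  qed
  have "\<mu> = \<nu>"
  proof (rule measure_eqI_generator_eq[OF Int_stable_pair_measure_generator[of N K]])
    show "{a \<times> b | a b. a \<in> sets N \<and> b \<in> sets K} \<subseteq> Pow (space N \<times> space K)" by (rule pair_measure_closed)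
    show "sets \<mu> = sigma_sets (space N \<times> space K) {a \<times> b | a b. a \<in> sets N \<and> b \<in> sets K}"
      "sets \<nu> = sigma_sets (space N \<times> space K) {a \<times> b | a b. a \<in> sets N \<and> b \<in> sets K}"
      unfolding s\<nu> by (simp_all add: \<mu>_def sets_pair_measure)
    show "range (\<lambda>_::nat. space N \<times> space K) \<subseteq> {a \<times> b | a b. a \<in> sets N \<and> b \<in> sets K}" by auto
    show "emeasure \<mu> (space N \<times> space K) \<noteq> \<infinity>" for i
    proof -
      have "finite_measure \<mu>" unfolding \<mu>_def by (intro finite_measure_distr) measurable
      then show ?thesis by (simp add: finite_measure.emeasure_finite)
    qed
    fix R assume "R \<in> {a \<times> b | a b. a \<in> sets N \<and> b \<in> sets K}"
    then obtain B A where R: "R = B \<times> A" and B: "B \<in> sets N" and A: "A \<in> sets K" by blast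
    have "emeasure \<mu> R = emeasure M {\<omega> \<in> space M. Z \<omega> \<in> B \<and> Y \<omega> \<in> A}"
      unfolding \<mu>_def R using A B by (subst emeasure_distr) (auto intro!: arg_cong[where f="emeasure M"])
    also have "\<dots> = (\<integral>\<^sup>+\<omega>. emeasure (L \<omega>) R \<partial>M)"
      unfolding r[OF A B]
    proof (rule nn_integral_cong)
      fix \<omega> assume \<omega>: "\<omega> \<in> space M"
      have "emeasure (L \<omega>) R = emeasure (\<kappa> (Z \<omega>)) (Pair (Z \<omega>) -` R \<inter> space (\<kappa> (Z \<omega>)))"
        unfolding L_def using A B by (intro emeasure_distr pm[OF \<omega>]) (auto simp: R)
      also have "Pair (Z \<omega>) -` R \<inter> space (\<kappa> (Z \<omega>)) = (if Z \<omega> \<in> B then A else {})"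
        using sets.sets_into_space[OF A] sets_eq_imp_space_eq[OF \<kappa>p(2)[OF \<omega>]] by (auto simp: R)
      finally show "emeasure (\<kappa> (Z \<omega>)) A * indicator (Z -` B \<inter> space M) \<omega> = emeasure (L \<omega>) R"
        using \<omega> by simp
    qed
    also have "\<dots> = emeasure \<nu> R"
      unfolding \<nu>_def using A B by (intro emeasure_bind[symmetric, OF not_empty L]) (simp add: R)
    finally show "emeasure \<mu> R = emeasure \<nu> R" .
  qed auto
  then have "(\<integral>\<^sup>+x. f x \<partial>\<mu>) = (\<integral>\<^sup>+x. f x \<partial>\<nu>)" by simp
  also have "(\<integral>\<^sup>+x. f x \<partial>\<mu>) = (\<integral>\<^sup>+\<omega>. f (Z \<omega>, Y \<omega>) \<partial>M)"
    unfolding \<mu>_def by (rule nn_integral_distr) measurable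
  also have "(\<integral>\<^sup>+x. f x \<partial>\<nu>) = (\<integral>\<^sup>+\<omega>. (\<integral>\<^sup>+x. f x \<partial>L \<omega>) \<partial>M)"
    unfolding \<nu>_def by (rule nn_integral_bind[OF f L])
  also have "\<dots> = (\<integral>\<^sup>+\<omega>. (\<integral>\<^sup>+y. f (Z \<omega>, y) \<partial>\<kappa> (Z \<omega>)) \<partial>M)"
    unfolding L_def by (intro nn_integral_cong nn_integral_distr pm) auto
  finally show ?thesis .
qed

section \<open>Lipschitz comparison of product measures\<close>

context Metric_space
begin

lemma measurable_measure_weak:
  assumes "sets Q = sets (borel_of (weak_topology mtopology))" and "U \<in> sets (borel_of mtopology)"
  shows "(\<lambda>p. measure p U) \<in> borel_measurable Q"
proof -
  have "(\<lambda>P. P) \<in> Q \<rightarrow>\<^sub>M subprob_algebra (borel_of mtopology)"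
    using measurable_prob_algebraD[OF measurable_weak_topology[OF metrizable_space_mtopology]] assms
    by (simp cong: measurable_cong_sets)
  from measurable_emeasure_kernel[OF this assms(2)] show ?thesis
    unfolding measure_def by measurable
qed

lemma integrable_prokhorov:
  assumes sc: "second_countable mtopology"
    and Q: "Q \<in> prob_measures (weak_topology mtopology)" and e: "e \<in> prob_measures mtopology"
  shows "integrable Q (\<lambda>p. dP p e)"
proof -
  interpret Q: prob_space Q using Q by (simp add: prob_measures_def)
  have sQ: "sets Q = sets (borel_of (weak_topology mtopology))" using Q by (simp add: prob_measures_def)
  have spQ: "space Q = prob_measures mtopology" using sets_eq_imp_space_eq[OF sQ] by simp
  show ?thesis
  proof (rule Q.integrable_const_bound[where B=1])
    show "AE p in Q. norm (dP p e) \<le> 1"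
      by (rule AE_I2) (auto simp: spQ prokhorov_nonneg prokhorov_le_1)
    show "(\<lambda>p. dP p e) \<in> borel_measurable Q"
      using measurable_measure_weak[OF sQ borel_of_open]
      by (intro borel_measurable_prokhorov[OF sc]) (auto simp: spQ e)
  qed
qed

text \<open>Either \<open>e\<close> lies in the neighbourhood of \<open>B\<close>, which then has
  full mass under the point mass, or \<open>B\<close> keeps distance at least
  \<open>\<epsilon>\<close> from \<open>e\<close>. In the second case Markov's inequality gives
  \<open>Q B \<le> E / \<epsilon>\<close> for the mean distance \<open>E\<close>, and this is at
  most \<open>\<epsilon>\<close> once \<open>\<epsilon>\<^sup>2 \<ge> E\<close>.\<close>

lemma prokhorov_return_le_sqrt:
  assumes sc: "second_countable mtopology"
    and Q: "Q \<in> prob_measures (weak_topology mtopology)" and e: "e \<in> prob_measures mtopology"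
  shows "prokhorov (weak_topology mtopology) dP Q (return (borel_of (weak_topology mtopology)) e)
    \<le> sqrt (\<integral>p. dP p e \<partial>Q)" (is "?D \<le> sqrt ?E")
proof (rule dense_ge)
  \<comment> \<open>Strictly above the root, so that the radius is positive even when the integral
    is 0.\<close>
  fix \<epsilon> assume \<epsilon>: "sqrt ?E < \<epsilon>"
  let ?W = "weak_topology mtopology"
  interpret Q: prob_space Q using Q by (simp add: prob_measures_def)
  have sQ: "sets Q = sets (borel_of ?W)" using Q by (simp add: prob_measures_def)
  have spQ: "space Q = prob_measures mtopology" using sets_eq_imp_space_eq[OF sQ] by simp
  have E0: "0 \<le> ?E" by (intro Bochner_Integration.integral_nonneg) (auto simp: spQ intro: prokhorov_nonneg)
  then have \<epsilon>0: "\<epsilon> > 0" using \<epsilon> real_sqrt_ge_zero[OF E0] by linarith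
  have E\<epsilon>: "?E \<le> \<epsilon> * \<epsilon>"
    using \<epsilon> E0 \<epsilon>0 by (metis less_imp_le power2_eq_square real_sqrt_less_iff real_sqrt_unique)
  \<comment> \<open>The topology of the ground space is \<open>weak_topology\<close> and is not
    presented as an \<open>mtopology\<close>, so membership in the defining set is shown
    directly.\<close>
  have "\<epsilon> \<in> {\<epsilon>. \<epsilon> > 0 \<and> (\<forall>B\<in>sets (borel_of ?W). measure Q B \<le>
      measure (return (borel_of ?W) e) {x \<in> topspace ?W. \<exists>y\<in>B. dP x y < \<epsilon>} + \<epsilon>)}"
  proof (intro CollectI conjI ballI \<epsilon>0)
    fix B assume B: "B \<in> sets (borel_of ?W)"
    let ?N = "{x \<in> topspace ?W. \<exists>y\<in>B. dP x y < \<epsilon>}"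
    have Bsub: "B \<subseteq> prob_measures mtopology" using sets.sets_into_space[OF B] by simp
    have N: "?N \<in> sets (borel_of ?W)"
      using openin_weak_prokhorov_nbhd[OF sc Bsub, of \<epsilon>] by (intro borel_of_open) simp
    show "measure Q B \<le> measure (return (borel_of ?W) e) ?N + \<epsilon>"
    proof (cases "e \<in> ?N")
      case True
      then have "measure (return (borel_of ?W) e) ?N = 1" using N by (simp add: measure_return)
      then show ?thesis using Q.prob_le_1[of B] \<epsilon>0 by linarith
    next
      case False
      have far: "\<epsilon> \<le> dP p e" if "p \<in> B" for p
        using False that e Bsub prokhorov_commute[OF e, of p] by force
      have "\<epsilon> * measure Q B = (\<integral>p. indicator B p * \<epsilon> \<partial>Q)" using B sQ by simp
      also have "\<dots> \<le> ?E"
      proof (rule integral_mono[OF _ integrable_prokhorov[OF sc Q e]])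
        show "integrable Q (\<lambda>p. indicator B p * \<epsilon>)" using B sQ by (simp add: Q.emeasure_eq_measure)
        show "indicator B p * \<epsilon> \<le> dP p e" if "p \<in> space Q" for p
          using far[of p] that by (auto simp: spQ prokhorov_nonneg split: split_indicator)
      qed
      also note E\<epsilon>
      finally have "measure Q B \<le> \<epsilon>" using \<epsilon>0 by simp
      then show ?thesis by (simp add: add_increasing)
    qed
  qed
  then show "?D \<le> \<epsilon>" unfolding prokhorov_def by (rule cInf_lower) (auto intro!: bdd_belowI[of _ 0])
qed

end

text \<open>A staircase with \<open>n\<close> steps approximates \<open>y\<close> from below with
  error at most \<open>1 / n\<close>. It reduces integrals to masses of level sets, which the
  Prokhorov distance can compare.\<close>

lemma card_threshold:
  fixes y :: real
  assumes n: "n \<ge> 1" and y: "0 \<le> y"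
  shows "(\<Sum>i=1..n. of_bool (real i / real n \<le> y) :: real) \<le> real n * y"
    "y \<le> 1 \<Longrightarrow> real n * y \<le> 1 + (\<Sum>i=1..n. of_bool (real i / real n \<le> y))"
proof -
  define k where "k = nat \<lfloor>real n * y\<rfloor>"
  have iff: "real i / real n \<le> y \<longleftrightarrow> i \<le> k" for i
  proof -
    have "real i / real n \<le> y \<longleftrightarrow> real i \<le> real n * y" using n by (simp add: field_simps)
    also have "\<dots> \<longleftrightarrow> i \<le> k" using y unfolding k_def by (simp add: le_nat_iff le_floor_iff)
    finally show ?thesis .
  qed
  have "(\<Sum>i=1..n. of_bool (real i / real n \<le> y) :: real) = (\<Sum>i\<in>{1..n}. if i \<le> k then 1 else 0)"
    by (intro sum.cong) (auto simp: iff)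
  also have "\<dots> = real (card ({1..n} \<inter> {i. i \<le> k}))" by (simp add: sum.If_cases)
  also have "{1..n} \<inter> {i. i \<le> k} = {1..min n k}" by auto
  finally have sum: "(\<Sum>i=1..n. of_bool (real i / real n \<le> y) :: real) = real (min n k)" by simp
  have k: "real k \<le> real n * y" "real n * y < real k + 1"
    using y unfolding k_def by (auto simp: of_nat_floor)
  show "(\<Sum>i=1..n. of_bool (real i / real n \<le> y) :: real) \<le> real n * y" unfolding sum using k by simp
  assume "y \<le> 1"
  then have "real n * y \<le> real n" by (simp add: mult_left_le)
  then show "real n * y \<le> 1 + (\<Sum>i=1..n. of_bool (real i / real n \<le> y))" unfolding sum using k by simp
qed

context Metric_space
begin

text \<open>For an admissible radius \<open>a\<close>, the level set \<open>{t \<le> g}\<close> has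
  \<open>p\<close>-mass at most \<open>a\<close> plus the \<open>e\<close>-mass of its
  \<open>a\<close>-neighbourhood, on which \<open>t \<le> g + L * a\<close>. Averaging over the
  levels \<open>t\<close> adds the errors \<open>a\<close> and \<open>L * a\<close>.\<close>

lemma integral_lipschitz_prokhorov:
  assumes p: "p \<in> prob_measures mtopology" and e: "e \<in> prob_measures mtopology"
    and g: "g \<in> borel_measurable (borel_of mtopology)" and g01: "\<And>x. x \<in> M \<Longrightarrow> 0 \<le> g x \<and> g x \<le> 1"
    and L: "0 \<le> L" and lip: "\<And>x y. x \<in> M \<Longrightarrow> y \<in> M \<Longrightarrow> g x \<le> g y + L * d x y"
  shows "(\<integral>x. g x \<partial>p) \<le> (\<integral>x. g x \<partial>e) + (L + 1) * dP p e"
proof -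
  interpret p: prob_space p using p by (simp add: prob_measures_def)
  interpret e: prob_space e using e by (simp add: prob_measures_def)
  have sets: "sets p = sets (borel_of mtopology)" "sets e = sets (borel_of mtopology)"
    using p e by (auto simp: prob_measures_def)
  have sp: "space p = M" "space e = M" using sets[THEN sets_eq_imp_space_eq] by auto
  have gm [measurable]: "g \<in> borel_measurable p" "g \<in> borel_measurable e"
    using g sets by (simp_all cong: measurable_cong_sets)
  have ig: "integrable p g" "integrable e g"
    by (rule p.integrable_const_bound[where B=1] e.integrable_const_bound[where B=1];
        use g01 sp gm in \<open>auto\<close>)+
  have step: "(\<integral>x. g x \<partial>p) \<le> (\<integral>x. g x \<partial>e) + (L + 1) * a" if a: "a \<in> prokhorov_set p e" for a
  proof (rule field_le_epsilon)
    fix \<gamma> :: real assume "\<gamma> > 0"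
    then obtain n where n: "n \<ge> 1" "1 / real n < \<gamma>" using real_arch_inverse[of \<gamma>] by (auto simp: inverse_eq_divide Suc_le_eq)
    have a0: "0 < a" using a by (simp add: prokhorov_set_def)
    let ?t = "\<lambda>i. real i / real n"
    let ?G = "\<lambda>i. {x \<in> M. ?t i \<le> g x}"
    have Gs: "?G i \<in> sets (borel_of mtopology)" for i
      using measurable_sets[OF g, of "{?t i..}"] by (simp add: vimage_def Int_def conj_commute)
    have "real n * (\<integral>x. g x \<partial>p) = (\<integral>x. real n * g x \<partial>p)" by simp
    also have "\<dots> \<le> (\<integral>x. 1 + (\<Sum>i=1..n. indicator (?G i) x) \<partial>p)"
    proof (rule integral_mono)
      show "integrable p (\<lambda>x. 1 + (\<Sum>i=1..n. indicat_real (?G i) x))"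
        using Gs by (auto intro!: Bochner_Integration.integrable_add Bochner_Integration.integrable_sum simp: sets p.emeasure_eq_measure simp del: sum.cl_ivl_Suc)
      fix x assume "x \<in> space p"
      then have x: "x \<in> M" by (simp add: sp)
      show "real n * g x \<le> 1 + (\<Sum>i=1..n. indicat_real (?G i) x)"
        using card_threshold(2)[OF n(1), of "g x"] g01[OF x] x by (simp add: indicator_def of_bool_def)
    qed (use ig in simp)
    also have "\<dots> = 1 + (\<Sum>i=1..n. measure p (?G i))"
      using Gs by (subst Bochner_Integration.integral_add)
        (auto intro!: Bochner_Integration.integrable_sum simp: Bochner_Integration.integral_sum sets p.emeasure_eq_measure p.prob_space[unfolded sp] sp Int_absorb2 simp del: sum.cl_ivl_Suc)
    also have "\<dots> \<le> 1 + (\<Sum>i=1..n. measure e (nbhd (?G i) a) + a)"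
      using a Gs by (intro add_left_mono sum_mono) (auto simp: prokhorov_set_def)
    also have "(\<Sum>i=1..n. measure e (nbhd (?G i) a) + a) = (\<Sum>i=1..n. measure e (nbhd (?G i) a)) + real n * a"
      by (simp add: sum.distrib)
    also have "(\<Sum>i=1..n. measure e (nbhd (?G i) a)) = (\<integral>x. (\<Sum>i=1..n. indicator (nbhd (?G i) a) x) \<partial>e)"
      using sets_nbhd[OF Gs] borel_subset[OF sets_nbhd[OF Gs]]
      by (subst Bochner_Integration.integral_sum) (auto simp: sets e.emeasure_eq_measure sp Int_absorb2)
    also have "\<dots> \<le> (\<integral>x. real n * (g x + L * a) \<partial>e)"
    proof (rule integral_mono)
      show "integrable e (\<lambda>x. \<Sum>i=1..n. indicat_real (nbhd (?G i) a) x)"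
        using sets_nbhd[OF Gs] by (intro Bochner_Integration.integrable_sum) (auto simp: sets e.emeasure_eq_measure)
      fix x assume "x \<in> space e"
      then have x: "x \<in> M" by (simp add: sp)
      have "(\<Sum>i=1..n. indicat_real (nbhd (?G i) a) x) \<le> (\<Sum>i=1..n. of_bool (?t i \<le> g x + L * a))"
      proof (rule sum_mono)
        fix i
        have "?t i \<le> g x + L * a" if xn: "x \<in> nbhd (?G i) a"
        proof -
          obtain y where y: "y \<in> M" "?t i \<le> g y" "d x y < a" using xn by (auto simp: nbhd_def)
          have "g y \<le> g x + L * d y x" using lip y x by blast
          also have "L * d y x \<le> L * a" using L y commute[of x y] by (intro mult_left_mono) auto
          finally show ?thesis using y by simp
        qed
        then show "indicat_real (nbhd (?G i) a) x \<le> of_bool (?t i \<le> g x + L * a)" by (auto split: split_indicator)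
      qed
      also have "\<dots> \<le> real n * (g x + L * a)"
        using g01[OF x] L a0 by (intro card_threshold n) auto
      finally show "(\<Sum>i=1..n. indicat_real (nbhd (?G i) a) x) \<le> real n * (g x + L * a)" .
    qed (use ig in simp)
    also have "\<dots> = real n * ((\<integral>x. g x \<partial>e) + L * a)" using ig by (simp add: e.prob_space)
    finally have "real n * (\<integral>x. g x \<partial>p) \<le> real n * ((\<integral>x. g x \<partial>e) + (L + 1) * a) + 1" by (simp add: algebra_simps)
    then have "(\<integral>x. g x \<partial>p) \<le> (\<integral>x. g x \<partial>e) + (L + 1) * a + 1 / real n" using n(1) by (simp add: field_simps)
    then show "(\<integral>x. g x \<partial>p) \<le> (\<integral>x. g x \<partial>e) + (L + 1) * a + \<gamma>" using n(2) by linarith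
  qed
  \<comment> \<open>Passage to the infimum over \<open>a\<close>: the quotient is a lower bound of
    all admissible radii.\<close>
  have "((\<integral>x. g x \<partial>p) - (\<integral>x. g x \<partial>e)) / (L + 1) \<le> dP p e"
    unfolding prokhorov_Inf
  proof (rule cInf_greatest)
    show "prokhorov_set p e \<noteq> {}" using prokhorov_set_nonempty[OF p, of e] by blast
    show "((\<integral>x. g x \<partial>p) - (\<integral>x. g x \<partial>e)) / (L + 1) \<le> a" if "a \<in> prokhorov_set p e" for a
      using step[OF that] L by (simp add: field_simps)
  qed
  then show ?thesis using L by (simp add: field_simps)
qed

lemma nn_integral_lipschitz_prokhorov:
  assumes p: "p \<in> prob_measures mtopology" and e: "e \<in> prob_measures mtopology"
    and g: "g \<in> borel_measurable (borel_of mtopology)" and g01: "\<And>x. x \<in> M \<Longrightarrow> 0 \<le> g x \<and> g x \<le> 1"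
    and L: "0 \<le> L" and lip: "\<And>x y. x \<in> M \<Longrightarrow> y \<in> M \<Longrightarrow> g x \<le> g y + L * d x y"
  shows "(\<integral>\<^sup>+x. ennreal (g x) \<partial>p) \<le> (\<integral>\<^sup>+x. ennreal (g x) \<partial>e) + ennreal ((L + 1) * dP p e)"
proof -
  have eq: "(\<integral>\<^sup>+x. ennreal (g x) \<partial>q) = ennreal (\<integral>x. g x \<partial>q) \<and> 0 \<le> (\<integral>x. g x \<partial>q)"
    if q: "q \<in> prob_measures mtopology" for q
  proof -
    interpret q: prob_space q using q by (simp add: prob_measures_def)
    have sets: "sets q = sets (borel_of mtopology)" using q by (auto simp: prob_measures_def)
    have sp: "space q = M" using sets_eq_imp_space_eq[OF sets] by auto
    have gm: "g \<in> borel_measurable q" using g sets by (simp cong: measurable_cong_sets)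
    have "integrable q g"
      by (rule q.integrable_const_bound[where B=1]) (use g01 sp gm in auto)
    then show ?thesis
      using g01 sp by (auto intro!: nn_integral_eq_integral Bochner_Integration.integral_nonneg)
  qed
  have "0 \<le> (L + 1) * dP p e" using L prokhorov_nonneg[OF p] by simp
  then show ?thesis
    using eq[OF p] eq[OF e] integral_lipschitz_prokhorov[OF assms] by (simp flip: ennreal_plus add: ennreal_leI)
qed

lemma nn_integral_PiM_lipschitz:
  assumes p: "p \<in> prob_measures mtopology" and e: "e \<in> prob_measures mtopology"
    and F: "F \<in> borel_measurable (\<Pi>\<^sub>M i\<in>{..<m}. borel_of mtopology)"
    and F01: "\<And>x. x \<in> {..<m} \<rightarrow>\<^sub>E M \<Longrightarrow> 0 \<le> F x \<and> F x \<le> 1"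
    and L: "0 \<le> L"
    and lip: "\<And>x i u v. x \<in> {..<m} \<rightarrow>\<^sub>E M \<Longrightarrow> i < m \<Longrightarrow> u \<in> M \<Longrightarrow> v \<in> M \<Longrightarrow> F (x(i := u)) \<le> F (x(i := v)) + L * d u v"
  shows "(\<integral>\<^sup>+x. ennreal (F x) \<partial>(\<Pi>\<^sub>M i\<in>{..<m}. p)) \<le> (\<integral>\<^sup>+x. ennreal (F x) \<partial>(\<Pi>\<^sub>M i\<in>{..<m}. e))
    + ennreal (real m * (L + 1) * dP p e)"
proof -
  \<comment> \<open>Hybrid products: \<open>e\<close> in the first \<open>j\<close> coordinates,
    \<open>p\<close> in the others. Consecutive hybrids differ in a single factor, which Fubini
    isolates.\<close>
  define H where "H j i = (if i < j then e else p)" for j i :: nat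
  let ?I = "\<lambda>j. \<integral>\<^sup>+x. ennreal (F x) \<partial>(\<Pi>\<^sub>M i\<in>{..<m}. H j i)"
  let ?c = "(L + 1) * dP p e"
  have c: "0 \<le> ?c" using L prokhorov_nonneg[OF p] by simp
  have H: "H j i \<in> prob_measures mtopology" for j i using p e by (simp add: H_def)
  have Hs: "sets (H j i) = sets (borel_of mtopology)" "prob_space (H j i)" for j i
    using H[of j i] by (auto simp: prob_measures_def)
  have Hsp: "space (H j i) = M" for j i using sets_eq_imp_space_eq[OF Hs(1)] by simp
  have Fm: "F \<in> borel_measurable (\<Pi>\<^sub>M i\<in>{..<m}. H j i)" for j
  proof -
    have "sets (PiM {..<m} (H j)) = sets (\<Pi>\<^sub>M i\<in>{..<m}. borel_of mtopology)" by (intro sets_PiM_cong refl Hs)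
    then show ?thesis using F by (simp cong: measurable_cong_sets)
  qed
  have step: "?I j \<le> ?I (Suc j) + ennreal ?c"
    if j: "j < m" for j
  proof -
    let ?J = "{..<m} - {j}"
    have ins: "insert j ?J = {..<m}" using j by auto
    have fin: "finite ?J" "j \<notin> ?J" by auto
    interpret A: product_sigma_finite "H k" for k
      unfolding product_sigma_finite_def by (intro allI prob_space_imp_sigma_finite Hs)
    have same: "PiM ?J (H j) = PiM ?J (H (Suc j))" by (rule PiM_cong) (auto simp: H_def)
    have expand: "?I k = (\<integral>\<^sup>+x. (\<integral>\<^sup>+y. ennreal (F (x(j := y))) \<partial>H k j) \<partial>PiM ?J (H k))" for k
      using A.product_nn_integral_insert[OF fin, of "\<lambda>x. ennreal (F x)" k] Fm[of k] unfolding ins by simp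
    have inner: "(\<integral>\<^sup>+y. ennreal (F (x(j := y))) \<partial>H j j) \<le> (\<integral>\<^sup>+y. ennreal (F (x(j := y))) \<partial>H (Suc j) j) + ennreal ?c"
      if x: "x \<in> space (PiM ?J (H j))" for x
    proof -
      have xp: "x(j := u) \<in> {..<m} \<rightarrow>\<^sub>E M" if "u \<in> M" for u
        using x that j by (auto simp: space_PiM PiE_iff Hsp extensional_def)
      have "(\<lambda>y. x(j := y)) \<in> borel_of mtopology \<rightarrow>\<^sub>M (\<Pi>\<^sub>M i\<in>insert j ?J. borel_of mtopology)"
        using x by (intro measurable_component_update fin) (auto simp: space_PiM Hsp)
      from measurable_compose[OF this[unfolded ins] F] have "(\<lambda>y. F (x(j := y))) \<in> borel_measurable (borel_of mtopology)" .
      moreover have "F (x(j := u)) \<le> F (x(j := v)) + L * d u v" if "u \<in> M" "v \<in> M" for u v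
        using lip[OF xp[OF that(1)] j that] by simp
      ultimately have "(\<integral>\<^sup>+y. ennreal (F (x(j := y))) \<partial>p) \<le> (\<integral>\<^sup>+y. ennreal (F (x(j := y))) \<partial>e) + ennreal ?c"
        using F01[OF xp] by (intro nn_integral_lipschitz_prokhorov p e L) auto
      then show ?thesis by (simp add: H_def)
    qed
    have "?I j \<le>
        (\<integral>\<^sup>+x. (\<integral>\<^sup>+y. ennreal (F (x(j := y))) \<partial>H (Suc j) j) + ennreal ?c \<partial>PiM ?J (H (Suc j)))"
      unfolding expand same[symmetric] by (intro nn_integral_mono inner)
    also have "\<dots> = (\<integral>\<^sup>+x. (\<integral>\<^sup>+y. ennreal (F (x(j := y))) \<partial>H (Suc j) j) \<partial>PiM ?J (H (Suc j))) + ennreal ?c"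
    proof (subst nn_integral_add)
      have "(\<lambda>(x, y). x(j := y)) \<in> PiM ?J (H (Suc j)) \<Otimes>\<^sub>M H (Suc j) j \<rightarrow>\<^sub>M PiM (insert j ?J) (H (Suc j))"
        by (rule measurable_add_dim)
      then have "(\<lambda>z. ennreal (F (case z of (x, y) \<Rightarrow> x(j := y)))) \<in> borel_measurable (PiM ?J (H (Suc j)) \<Otimes>\<^sub>M H (Suc j) j)"
        unfolding ins using Fm[of "Suc j"] by measurable
      from sigma_finite_measure.borel_measurable_nn_integral_fst[OF prob_space_imp_sigma_finite[OF Hs(2)] this]
      show "(\<lambda>x. \<integral>\<^sup>+y. ennreal (F (x(j := y))) \<partial>H (Suc j) j) \<in> borel_measurable (PiM ?J (H (Suc j)))"
        by simp
      have "prob_space (PiM ?J (H (Suc j)))" by (intro prob_space_PiM Hs)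
      then show "(\<integral>\<^sup>+x. (\<integral>\<^sup>+y. ennreal (F (x(j := y))) \<partial>H (Suc j) j) \<partial>PiM ?J (H (Suc j))) + (\<integral>\<^sup>+x. ennreal ?c \<partial>PiM ?J (H (Suc j))) =
        (\<integral>\<^sup>+x. (\<integral>\<^sup>+y. ennreal (F (x(j := y))) \<partial>H (Suc j) j) \<partial>PiM ?J (H (Suc j))) + ennreal ?c"
        by (simp add: prob_space.emeasure_space_1)
    qed simp
    finally show ?thesis unfolding expand .
  qed
  have "?I 0 \<le> ?I j + ennreal (real j * ?c)"
    if "j \<le> m" for j
    using that
  proof (induction j)
    case (Suc j)
    then have "?I 0 \<le> ?I j + ennreal (real j * ?c)" by simp
    also have "\<dots> \<le> (?I (Suc j) + ennreal ?c) + ennreal (real j * ?c)"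
      using Suc by (intro add_right_mono step) auto
    also have "\<dots> = ?I (Suc j) + ennreal (real (Suc j) * ?c)"
      using c by (simp add: add.assoc distrib_right flip: ennreal_plus)
    finally show ?case .
  qed simp
  from this[of m] have "?I 0 \<le> ?I m + ennreal (real m * ?c)" by simp
  moreover have "(\<Pi>\<^sub>M i\<in>{..<m}. H 0 i) = (\<Pi>\<^sub>M i\<in>{..<m}. p)" "(\<Pi>\<^sub>M i\<in>{..<m}. H m i) = (\<Pi>\<^sub>M i\<in>{..<m}. e)"
    by (auto intro!: PiM_cong simp: H_def)
  ultimately show ?thesis by (simp add: mult.assoc)
qed

text \<open>For nonempty \<open>B\<close> the function is \<open>1\<close> minus the distance to
  \<open>B\<close> over \<open>\<eta>\<close>, cut at 0, written as a supremum of functions with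
  Lipschitz constant \<open>1 / \<eta>\<close>. Real suprema need a nonempty index set, hence the
  case split.\<close>

lemma lipschitz_cutoff:
  assumes B: "B \<subseteq> M" and \<eta>: "0 < \<eta>"
  obtains f where "f \<in> borel_measurable (borel_of mtopology)" "\<And>x. 0 \<le> f x \<and> f x \<le> 1"
    "\<And>x. x \<in> B \<Longrightarrow> f x = 1" "\<And>x. x \<in> M \<Longrightarrow> 0 < f x \<Longrightarrow> x \<in> nbhd B \<eta>"
    "\<And>x y. x \<in> M \<Longrightarrow> y \<in> M \<Longrightarrow> f x \<le> f y + d x y / \<eta>"
proof (cases "B = {}")
  case True
  then show ?thesis using \<eta> by (intro that[of "\<lambda>_. 0"]) auto
next
  case False
  let ?h = "\<lambda>x z. max 0 (1 - d x z / \<eta>)"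
  define f where "f x = (SUP z\<in>B. ?h x z)" for x
  have h: "0 \<le> ?h x z" "?h x z \<le> 1" for x z using \<eta> by auto
  have bdd: "bdd_above (?h x ` B)" for x using h(2) by (intro bdd_aboveI2[where M=1])
  have up: "?h x z \<le> f x" if "z \<in> B" for x z unfolding f_def by (rule cSUP_upper[OF that bdd])
  have le1: "f x \<le> 1" for x unfolding f_def using False h(2) by (intro cSUP_least)
  have ge0: "0 \<le> f x" for x using up h(1) False by (meson all_not_in_conv order_trans)
  have lip: "f x \<le> f y + d x y / \<eta>" if x: "x \<in> M" and y: "y \<in> M" for x y
    unfolding f_def[of x]
  proof (rule cSUP_least[OF False])
    fix z assume z: "z \<in> B"
    have "d y z \<le> d x z + d x y" using triangle[of y x z] x y z B commute[of x y] by auto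
    then have "d y z / \<eta> \<le> d x z / \<eta> + d x y / \<eta>" using \<eta> by (simp add: divide_right_mono flip: add_divide_distrib)
    moreover have "0 \<le> d x y / \<eta>" using \<eta> by simp
    ultimately have "?h x z \<le> ?h y z + d x y / \<eta>" by (auto simp: max_def)
    then show "?h x z \<le> f y + d x y / \<eta>" using up[OF z, of y] by linarith
  qed
  show ?thesis
  proof (rule that[of f])
    show "f \<in> borel_measurable (borel_of mtopology)"
      unfolding borel_measurable_iff_greater
    proof
      fix a
      have "openin mtopology {x \<in> M. a < f x}"
        unfolding openin_mtopology
      proof (intro conjI allI impI)
        fix x assume x: "x \<in> {x \<in> M. a < f x}"
        have "mball x ((f x - a) * \<eta>) \<subseteq> {x \<in> M. a < f x}"
        proof
          fix y assume "y \<in> mball x ((f x - a) * \<eta>)"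
          then have y: "y \<in> M" "d x y < (f x - a) * \<eta>" by auto
          then have "d x y / \<eta> < f x - a" using \<eta> by (simp add: field_simps)
          then show "y \<in> {x \<in> M. a < f x}" using lip[of x y] x y by auto
        qed
        then show "\<exists>r>0. mball x r \<subseteq> {x \<in> M. a < f x}" using x \<eta> by (intro exI[of _ "(f x - a) * \<eta>"]) auto
      qed auto
      then show "{w \<in> space (borel_of mtopology). a < f w} \<in> sets (borel_of mtopology)" by (simp add: borel_of_open)
    qed
    show "f x = 1" if "x \<in> B" for x
    proof -
      have "?h x x = 1" using that B by auto
      then show ?thesis using up[OF that, of x] le1[of x] by linarith
    qed
    show "x \<in> nbhd B \<eta>" if xM: "x \<in> M" and fx: "0 < f x" for x
    proof -
      obtain z where z: "z \<in> B" "0 < ?h x z"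
        using fx less_cSUP_iff[OF False bdd, of 0 x] by (auto simp: f_def)
      then have "d x z < \<eta>" using \<eta> by (auto simp: max_def field_simps split: if_splits)
      then show ?thesis using z(1) xM by (auto simp: nbhd_def)
    qed
  qed (use le1 ge0 lip in auto)
qed

end

text \<open>\<open>mixture\<close> is defined by its values on measurable sets; as a
  \<open>bind\<close> it inherits the rules for integrals of arbitrary nonnegative measurable
  functions.\<close>

lemma mixture_eq_bind:
  assumes T: "metrizable_space T" and Q: "sets Q = sets (borel_of (weak_topology T))" "space Q \<noteq> {}"
  shows "mixture I (borel_of T) Q = Q \<bind> (\<lambda>p. \<Pi>\<^sub>M i\<in>I. p)"
    "(\<lambda>p. \<Pi>\<^sub>M i\<in>I. p) \<in> Q \<rightarrow>\<^sub>M subprob_algebra (\<Pi>\<^sub>M i\<in>I. borel_of T)"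
proof -
  have "(\<lambda>p. \<Pi>\<^sub>M i\<in>I. p) \<in> Q \<rightarrow>\<^sub>M prob_algebra (\<Pi>\<^sub>M i\<in>I. borel_of T)"
    using measurable_compose[OF measurable_weak_topology[OF T] measurable_PiM_prob_algebra] Q
    by (simp cong: measurable_cong_sets)
  then show k: "(\<lambda>p. \<Pi>\<^sub>M i\<in>I. p) \<in> Q \<rightarrow>\<^sub>M subprob_algebra (\<Pi>\<^sub>M i\<in>I. borel_of T)"
    by (rule measurable_prob_algebraD)
  show "mixture I (borel_of T) Q = Q \<bind> (\<lambda>p. \<Pi>\<^sub>M i\<in>I. p)"
  proof (rule measure_eqI)
    have s: "sets (mixture I (borel_of T) Q) = sets (\<Pi>\<^sub>M i\<in>I. borel_of T)"
      by (simp add: mixture_def)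
    then show "sets (mixture I (borel_of T) Q) = sets (Q \<bind> (\<lambda>p. \<Pi>\<^sub>M i\<in>I. p))"
      using sets_bind_measurable[OF k Q(2)] by simp
    fix C assume "C \<in> sets (mixture I (borel_of T) Q)"
    then have C: "C \<in> sets (\<Pi>\<^sub>M i\<in>I. borel_of T)" using s by simp
    show "emeasure (mixture I (borel_of T) Q) C = emeasure (Q \<bind> (\<lambda>p. \<Pi>\<^sub>M i\<in>I. p)) C"
      by (simp add: emeasure_mixture[OF T Q(1) C] emeasure_bind[OF Q(2) k C])
  qed
qed

lemma sets_mixture: "sets (mixture I N Q) = sets (\<Pi>\<^sub>M i\<in>I. N)"
  by (simp add: mixture_def)

lemma space_mixture: "space (mixture I N Q) = space (\<Pi>\<^sub>M i\<in>I. N)"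
  by (rule sets_eq_imp_space_eq[OF sets_mixture])

lemma prob_space_mixture:
  assumes T: "metrizable_space T" and Q: "Q \<in> prob_measures (weak_topology T)"
  shows "prob_space (mixture I (borel_of T) Q)"
proof (rule prob_spaceI)
  interpret Q: prob_space Q using Q by (simp add: prob_measures_def)
  have sQ: "sets Q = sets (borel_of (weak_topology T))" using Q by (simp add: prob_measures_def)
  have spQ: "space Q = prob_measures T" using sets_eq_imp_space_eq[OF sQ] by simp
  have "emeasure (mixture I (borel_of T) Q) (space (mixture I (borel_of T) Q)) =
      (\<integral>\<^sup>+p. emeasure (\<Pi>\<^sub>M i\<in>I. p) (space (\<Pi>\<^sub>M i\<in>I. borel_of T)) \<partial>Q)"
    unfolding space_mixture by (rule emeasure_mixture[OF T sQ]) simp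
  also have "\<dots> = (\<integral>\<^sup>+p. 1 \<partial>Q)"
  proof (rule nn_integral_cong)
    fix p assume "p \<in> space Q"
    then have p: "prob_space p" "sets p = sets (borel_of T)" by (auto simp: spQ prob_measures_def)
    have "space (\<Pi>\<^sub>M i\<in>I. borel_of T) = space (\<Pi>\<^sub>M i\<in>I. p)" using sets_eq_imp_space_eq[OF p(2)] by (simp add: space_PiM)
    then show "emeasure (\<Pi>\<^sub>M i\<in>I. p) (space (\<Pi>\<^sub>M i\<in>I. borel_of T)) = 1"
      using prob_space.emeasure_space_1[OF prob_space_PiM[of I "\<lambda>_. p"]] p by simp
  qed
  finally show "emeasure (mixture I (borel_of T) Q) (space (mixture I (borel_of T) Q)) = 1"
    by (simp add: Q.emeasure_space_1)
qed

lemma nn_integral_mixture: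
  assumes T: "metrizable_space T" and Q: "sets Q = sets (borel_of (weak_topology T))" "space Q \<noteq> {}"
    and f: "f \<in> borel_measurable (\<Pi>\<^sub>M i\<in>I. borel_of T)"
  shows "(\<integral>\<^sup>+x. f x \<partial>mixture I (borel_of T) Q) = (\<integral>\<^sup>+p. (\<integral>\<^sup>+x. f x \<partial>(\<Pi>\<^sub>M i\<in>I. p)) \<partial>Q)"
  unfolding mixture_eq_bind(1)[OF T Q] by (rule nn_integral_bind[OF f mixture_eq_bind(2)[OF T Q]])

text \<open>The probabilities of a measurable null set of the mixture under the products integrate
  to 0 over \<open>Q\<close>, hence vanish for almost every \<open>p\<close>.\<close>

lemma AE_mixture:
  assumes T: "metrizable_space T" and Q: "sets Q = sets (borel_of (weak_topology T))" "space Q \<noteq> {}"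
    and P: "AE x in mixture I (borel_of T) Q. P x"
  shows "AE p in Q. AE x in (\<Pi>\<^sub>M i\<in>I. p). P x"
proof -
  obtain C where C: "{x \<in> space (mixture I (borel_of T) Q). \<not> P x} \<subseteq> C"
      "emeasure (mixture I (borel_of T) Q) C = 0" "C \<in> sets (\<Pi>\<^sub>M i\<in>I. borel_of T)"
    using P by (auto elim!: AE_E simp: sets_mixture)
  have meas: "(\<lambda>p. emeasure (\<Pi>\<^sub>M i\<in>I. p) C) \<in> borel_measurable Q"
    using measurable_emeasure_kernel[OF mixture_eq_bind(2)[OF T Q] C(3)] .
  have "(\<integral>\<^sup>+p. emeasure (\<Pi>\<^sub>M i\<in>I. p) C \<partial>Q) = 0" using C(2) emeasure_mixture[OF T Q(1) C(3)] by simp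
  then have "AE p in Q. emeasure (\<Pi>\<^sub>M i\<in>I. p) C = 0" by (simp add: nn_integral_0_iff_AE[OF meas])
  then show ?thesis
  proof (rule AE_mp[OF _ AE_I2[OF impI]])
    fix p assume p: "p \<in> space Q" "emeasure (\<Pi>\<^sub>M i\<in>I. p) C = 0"
    have s: "sets (\<Pi>\<^sub>M i\<in>I. p) = sets (\<Pi>\<^sub>M i\<in>I. borel_of T)"
      using sets_kernel[OF mixture_eq_bind(2)[OF T Q] p(1)] .
    show "AE x in (\<Pi>\<^sub>M i\<in>I. p). P x"
      using C(1,3) p(2) s sets_eq_imp_space_eq[OF s] by (intro AE_I[of _ _ C]) (auto simp: space_mixture)
  qed
qed

section \<open>Prokhorov distances for tuples up to permutation\<close>

context Metric_space
begin

text \<open>Turns a Lipschitz bound on the quotient into one in each coordinate.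
  \<open>dense_ge\<close> is there because \<open>prokhorov_empirical_le\<close> wants strict bounds
  on the distances of the atoms.\<close>

lemma sym_dist_update_le:
  assumes x: "x \<in> {..<m} \<rightarrow>\<^sub>E M" and i: "i < m" and u: "u \<in> M" and v: "v \<in> M"
  shows "sym_dist mtopology d m (sym_proj M m (x(i := u))) (sym_proj M m (x(i := v))) \<le> d u v"
proof -
  have xu: "x(i := w) \<in> {..<m} \<rightarrow>\<^sub>E M" if "w \<in> M" for w
    using x i that by (auto simp: PiE_iff extensional_def)
  have "dP (empirical (borel_of mtopology) m (x(i := u))) (empirical (borel_of mtopology) m (x(i := v))) \<le> d u v"
  proof (rule dense_ge)
    fix \<epsilon> assume e: "d u v < \<epsilon>"
    then have "\<epsilon> > 0" using nonneg[of u v] by linarith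
    moreover have "d ((x(i := u)) j) ((x(i := v)) j) < \<epsilon>" if "j < m" for j
      using e \<open>\<epsilon> > 0\<close> x that by (auto simp: PiE_iff)
    ultimately show "dP (empirical (borel_of mtopology) m (x(i := u))) (empirical (borel_of mtopology) m (x(i := v))) \<le> \<epsilon>"
      using i by (intro prokhorov_empirical_le xu[OF v]) auto
  qed
  then show ?thesis by (simp add: sym_dist_proj[OF xu[OF u] xu[OF v]])
qed

text \<open>A cut-off at scale \<open>\<eta>\<close>, lifted to tuples, has Lipschitz constant
  \<open>1 / \<eta>\<close> in each coordinate, so exchanging \<open>p\<close> and \<open>e\<close>
  costs \<open>m * (1 / \<eta> + 1) * dP p e\<close>. For \<open>\<eta> \<le> 1\<close> this is at
  most \<open>2 * m * dP p e / \<eta>\<close>, and its integral over \<open>Q\<close> is at most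
  \<open>\<eta>\<close> once \<open>\<eta>\<^sup>2\<close> reaches \<open>2 * m\<close> times the
  mean distance. This explains the factor 2.\<close>

lemma prokhorov_sym_mixture_le_sqrt:
  assumes sc: "second_countable mtopology" and m: "m \<ge> 1"
    and Q: "Q \<in> prob_measures (weak_topology mtopology)" and e: "e \<in> prob_measures mtopology"
  shows "prokhorov (sym_topology mtopology d m) (sym_dist mtopology d m)
      (sym_distr mtopology d m (mixture {..<m} (borel_of mtopology) Q)) (sym_distr mtopology d m (\<Pi>\<^sub>M i\<in>{..<m}. e))
    \<le> sqrt (2 * real m * (\<integral>p. dP p e \<partial>Q))" (is "prokhorov _ _ ?\<mu> ?\<nu> \<le> sqrt (2 * real m * ?E)")
proof (rule dense_ge)
  let ?mix = "mixture {..<m} (borel_of mtopology) Q" and ?em = "\<Pi>\<^sub>M i\<in>{..<m}. e" and ?pm = "\<lambda>p. \<Pi>\<^sub>M i\<in>{..<m}. p"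
  interpret S: Metric_space "sym_space M m" "sym_dist mtopology d m" by (rule Metric_space_sym[OF m])
  have ST: "sym_topology mtopology d m = S.mtopology" by (simp add: sym_topology_def)
  let ?B = "\<Pi>\<^sub>M i\<in>{..<m}. borel_of mtopology"
  let ?pr = "sym_proj M m"
  interpret Q: prob_space Q using Q by (simp add: prob_measures_def)
  have sQ: "sets Q = sets (borel_of (weak_topology mtopology))" using Q by (simp add: prob_measures_def)
  have spQ: "space Q = prob_measures mtopology" using sets_eq_imp_space_eq[OF sQ] by simp
  have pr: "?pr \<in> ?B \<rightarrow>\<^sub>M borel_of S.mtopology" using measurable_sym_proj[OF m sc] by (simp add: ST)
  have spB: "space ?B = {..<m} \<rightarrow>\<^sub>E M" by (simp add: space_PiM)
  interpret P: prob_space "?mix"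
    by (rule prob_space_mixture[OF metrizable_space_mtopology Q])
  have ee: "prob_space e" "sets e = sets (borel_of mtopology)" using e by (auto simp: prob_measures_def)
  have se: "sets ?em = sets ?B" using ee by (intro sets_PiM_cong) auto
  interpret e: prob_space "?em" by (intro prob_space_PiM ee)
  fix \<eta> assume \<eta>: "sqrt (2 * real m * ?E) < \<eta>"
  have E0: "0 \<le> ?E" by (intro Bochner_Integration.integral_nonneg) (auto simp: spQ intro: prokhorov_nonneg)
  then have \<eta>0: "\<eta> > 0" using \<eta> real_sqrt_ge_zero[of "2 * real m * ?E"] by (smt (verit) mult_nonneg_nonneg of_nat_0_le_iff)
  have E\<eta>: "2 * real m * ?E \<le> \<eta> * \<eta>"
    using \<eta> E0 \<eta>0 by (metis less_imp_le power2_eq_square real_sqrt_less_iff real_sqrt_unique)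
  have bound: "measure ?\<mu> A \<le> measure ?\<nu> (S.nbhd A \<eta>) + \<eta>" if A: "A \<in> sets (borel_of S.mtopology)" for A
  \<comment> \<open>A radius of at least 1 is always admissible between probability measures; below
    1 the summand 1 is absorbed into \<open>1 / \<eta>\<close>.\<close>
  proof (cases "\<eta> \<ge> 1")
    case True
    have "prob_space ?\<mu>" unfolding sym_distr_def ST
      using pr by (intro P.prob_space_distr) (simp cong: measurable_cong_sets add: sets_mixture)
    then have "measure ?\<mu> A \<le> 1" by (rule prob_space.prob_le_1)
    then show ?thesis using True by (simp add: add_increasing)
  next
    case False
    then have \<eta>1: "\<eta> \<le> 1" by simp
    define A' where "A' = ?pr -` A \<inter> space ?B"
    define N' where "N' = ?pr -` S.nbhd A \<eta> \<inter> space ?B"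
    have Ns: "S.nbhd A \<eta> \<in> sets (borel_of S.mtopology)" by (rule S.sets_nbhd[OF A])
    have A's: "A' \<in> sets ?B" "N' \<in> sets ?B" unfolding A'_def N'_def using measurable_sets[OF pr] A Ns by auto
    obtain f where f: "f \<in> borel_measurable (borel_of S.mtopology)" "\<And>x. 0 \<le> f x \<and> f x \<le> 1"
      "\<And>x. x \<in> A \<Longrightarrow> f x = 1" "\<And>x. x \<in> sym_space M m \<Longrightarrow> 0 < f x \<Longrightarrow> x \<in> S.nbhd A \<eta>"
      "\<And>x y. x \<in> sym_space M m \<Longrightarrow> y \<in> sym_space M m \<Longrightarrow> f x \<le> f y + sym_dist mtopology d m x y / \<eta>"
      using S.lipschitz_cutoff[OF S.borel_subset[OF A] \<eta>0] by metis
    define F where "F x = f (?pr x)" for x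
    have Fm: "F \<in> borel_measurable ?B" unfolding F_def by (rule measurable_compose[OF pr f(1)])
    have kernel: "emeasure (?pm p) A' \<le> emeasure ?em N' +
        ennreal (real m * (1 / \<eta> + 1) * dP p e)" if p: "p \<in> prob_measures mtopology" for p
    proof -
      have sp: "sets (?pm p) = sets ?B" using p by (intro sets_PiM_cong) (auto simp: prob_measures_def)
      have "emeasure (?pm p) A' = (\<integral>\<^sup>+x. indicator A' x \<partial>(?pm p))"
        using A's sp by simp
      also have "\<dots> \<le> (\<integral>\<^sup>+x. ennreal (F x) \<partial>(?pm p))"
        by (intro nn_integral_mono) (auto simp: A'_def F_def f(3) split: split_indicator)
      also have "\<dots> \<le> (\<integral>\<^sup>+x. ennreal (F x) \<partial>?em) + ennreal (real m * (1 / \<eta> + 1) * dP p e)"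
      proof (rule nn_integral_PiM_lipschitz[OF p e Fm])
        fix x i u v assume x: "x \<in> {..<m} \<rightarrow>\<^sub>E M" and i: "i < m" and u: "u \<in> M" and v: "v \<in> M"
        have "x(i := w) \<in> {..<m} \<rightarrow>\<^sub>E M" if "w \<in> M" for w
          using x i that by (auto simp: PiE_iff extensional_def)
        then have "F (x(i := u)) \<le> F (x(i := v)) + sym_dist mtopology d m (?pr (x(i := u))) (?pr (x(i := v))) / \<eta>"
          unfolding F_def using u v by (intro f(5) sym_proj_in)
        also have "\<dots> \<le> F (x(i := v)) + d u v / \<eta>"
          using sym_dist_update_le[OF x i u v] \<eta>0 by (intro add_left_mono divide_right_mono) auto
        finally show "F (x(i := u)) \<le> F (x(i := v)) + 1 / \<eta> * d u v" by simp
      qed (use f(2) \<eta>0 in \<open>auto simp: F_def\<close>)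
      also have "(\<integral>\<^sup>+x. ennreal (F x) \<partial>?em) \<le> (\<integral>\<^sup>+x. indicator N' x \<partial>?em)"
      proof (rule nn_integral_mono)
        fix x assume "x \<in> space ?em"
        then have x: "x \<in> space ?B" using sets_eq_imp_space_eq[OF se] by simp
        then have prx: "?pr x \<in> sym_space M m" by (intro sym_proj_in) (simp add: spB)
        show "ennreal (F x) \<le> indicator N' x"
        proof (cases "0 < F x")
          case True
          then have "x \<in> N'" using f(4)[OF prx] x by (simp add: F_def N'_def)
          then show ?thesis using f(2) by (simp add: F_def ennreal_le_1)
        qed (simp add: ennreal_neg)
      qed
      also have "\<dots> = emeasure ?em N'" using A's se by simp
      finally show ?thesis by (simp add: add_right_mono)
    qed
    have "emeasure ?mix A' = (\<integral>\<^sup>+p. emeasure (?pm p) A' \<partial>Q)"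
      by (rule emeasure_mixture[OF metrizable_space_mtopology sQ A's(1)])
    also have "\<dots> \<le> (\<integral>\<^sup>+p. emeasure ?em N' + ennreal (real m * (1 / \<eta> + 1) * dP p e) \<partial>Q)"
      using kernel by (intro nn_integral_mono) (simp add: spQ)
    also have "\<dots> = emeasure ?em N' + (\<integral>\<^sup>+p. ennreal (real m * (1 / \<eta> + 1) * dP p e) \<partial>Q)"
      using integrable_prokhorov[OF sc Q e] by (subst nn_integral_add) (auto simp: Q.emeasure_space_1)
    also have "(\<integral>\<^sup>+p. ennreal (real m * (1 / \<eta> + 1) * dP p e) \<partial>Q) = ennreal (real m * (1 / \<eta> + 1) * ?E)"
      using integrable_prokhorov[OF sc Q e] \<eta>0
      by (subst nn_integral_eq_integral) (auto simp: spQ intro!: AE_I2 mult_nonneg_nonneg prokhorov_nonneg)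
    also have "\<dots> \<le> ennreal \<eta>"
    proof (rule ennreal_leI)
      have "real m * (1 / \<eta> + 1) * ?E \<le> real m * (2 / \<eta>) * ?E"
        using \<eta>0 \<eta>1 E0 by (intro mult_right_mono mult_left_mono) (auto simp: field_simps)
      also have "\<dots> = 2 * real m * ?E / \<eta>" by simp
      also have "\<dots> \<le> \<eta> * \<eta> / \<eta>" using E\<eta> \<eta>0 by (intro divide_right_mono) auto
      finally show "real m * (1 / \<eta> + 1) * ?E \<le> \<eta>" using \<eta>0 by simp
    qed
    finally have "emeasure ?mix A' \<le> emeasure ?em N' + ennreal \<eta>"
      by (simp add: add_left_mono)
    then have "measure ?mix A' \<le> measure ?em N' + \<eta>"
      using \<eta>0 by (simp add: P.emeasure_eq_measure e.emeasure_eq_measure flip: ennreal_plus)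
    moreover have "measure ?\<mu> A = measure ?mix A'"
      unfolding sym_distr_def ST A'_def space_mixture[symmetric, of _ _ Q] topspace_mtopology using pr A
      by (intro measure_distr) (simp_all cong: measurable_cong_sets add: sets_mixture)
    moreover have "measure ?\<nu> (S.nbhd A \<eta>) = measure ?em N'"
      unfolding sym_distr_def ST N'_def sets_eq_imp_space_eq[OF se, symmetric] topspace_mtopology using pr Ns se
      by (intro measure_distr) (simp_all cong: measurable_cong_sets)
    ultimately show ?thesis by simp
  qed
  show "prokhorov (sym_topology mtopology d m) (sym_dist mtopology d m) ?\<mu> ?\<nu> \<le> \<eta>"
    unfolding ST by (rule S.prokhorov_le[OF \<eta>0 bound])
qed

end

section \<open>Posterior and predictive distributions\<close>

lemma empirical_cong: "(\<And>i. i < n \<Longrightarrow> x i = y i) \<Longrightarrow> empirical N n x = empirical N n y"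
  unfolding empirical_def
  by (intro arg_cong[where f="measure_of _ _"] ext arg_cong2[where f="(/)"] sum.cong) auto

lemma sets_borel_of_subtopology:
  assumes "A \<in> sets (borel_of T)"
  shows "A \<inter> X \<in> sets (borel_of (subtopology T X))"
proof -
  have "(\<lambda>x. x) \<in> borel_of (subtopology T X) \<rightarrow>\<^sub>M borel_of T"
    unfolding borel_of_def[of T]
  proof (rule measurable_measure_of)
    fix U assume U: "U \<in> {U. openin T U}"
    have "(\<lambda>x. x) -` U \<inter> space (borel_of (subtopology T X)) = U \<inter> X"
      using U openin_subset[of T U] by auto
    then show "(\<lambda>x. x) -` U \<inter> space (borel_of (subtopology T X)) \<in> sets (borel_of (subtopology T X))"
      using U by (simp add: borel_of_open openin_subtopology_Int)
  qed (auto dest: openin_subset)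
  from measurable_sets[OF this assms]
  show ?thesis using sets.sets_into_space[OF assms] by (simp add: Int_absorb1 Int_assoc[symmetric] Int_absorb2)
qed

lemma filterlim_rate: "filterlim rate at_top sequentially"
proof -
  have "filterlim (\<lambda>n. inverse (ln (real n) / real n)) at_top sequentially"
  proof (rule filterlim_inverse_at_top[OF lim_ln_over_n])
    show "eventually (\<lambda>n. 0 < ln (real n) / real n) sequentially"
      using eventually_gt_at_top[of 1] by eventually_elim simp
  qed
  then have "filterlim (\<lambda>n. real n / ln (real n)) at_top sequentially" by simp
  then show ?thesis unfolding rate_def[abs_def] by (rule filterlim_compose[OF sqrt_at_top])
qed

lemma limsup_ennreal_sqrt_le:
  fixes x a :: "nat \<Rightarrow> real"
  assumes l: "0 \<le> l" and x: "limsup (\<lambda>n. ennreal (x n)) \<le> ennreal l"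
    and a: "eventually (\<lambda>n. a n \<le> sqrt (x n)) sequentially"
  shows "limsup (\<lambda>n. ennreal (a n)) \<le> ennreal (sqrt l)"
proof (rule ennreal_le_epsilon)
  fix \<epsilon> :: real assume \<epsilon>: "0 < \<epsilon>"
  \<comment> \<open>The margin is \<open>\<epsilon>\<^sup>2\<close> because the root turns it into
    \<open>\<epsilon>\<close> by subadditivity.\<close>
  have "limsup (\<lambda>n. ennreal (x n)) < ennreal (l + \<epsilon>\<^sup>2)"
    using x l \<epsilon> by (intro le_less_trans[OF x]) (simp add: ennreal_less_iff)
  then have "eventually (\<lambda>n. ennreal (x n) < ennreal (l + \<epsilon>\<^sup>2)) sequentially" by (rule Limsup_lessD)
  with a have "eventually (\<lambda>n. ennreal (a n) \<le> ennreal (sqrt l + \<epsilon>)) sequentially"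
  proof eventually_elim
    case (elim n)
    \<comment> \<open>\<open>ennreal\<close> sends negative \<open>x n\<close> to 0, so that case is
      treated separately.\<close>
    have "x n \<le> l + \<epsilon>\<^sup>2"
    proof (cases "0 \<le> x n")
      case True
      then show ?thesis using elim(2) by (simp add: ennreal_less_iff)
    qed (use l in \<open>auto intro: order_trans[of _ 0]\<close>)
    then have "sqrt (x n) \<le> sqrt (l + \<epsilon>\<^sup>2)" by simp
    also have "\<dots> \<le> sqrt l + \<epsilon>" using sqrt_add_le_add_sqrt[of l "\<epsilon>\<^sup>2"] l \<epsilon> by simp
    finally show ?case using elim(1) by (intro ennreal_leI) simp
  qed
  then have "limsup (\<lambda>n. ennreal (a n)) \<le> ennreal (sqrt l + \<epsilon>)" by (rule Limsup_bounded)
  then show "limsup (\<lambda>n. ennreal (a n)) \<le> ennreal (sqrt l) + ennreal \<epsilon>"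
    using l \<epsilon> by (simp flip: ennreal_plus)
qed

text \<open>An event about the single coordinate \<open>i\<close> belongs to the past of length
  \<open>Suc i\<close>, and such events generate the infinite product.\<close>

lemma sets_PiM_eq_past:
  assumes "sets M = sets (\<Pi>\<^sub>M i\<in>(UNIV::nat set). N)"
  shows "sets M = sigma_sets (space M) (\<Union>n. past M N (\<lambda>i \<omega>. \<omega> i) n)"
proof
  have sp: "space M = (\<Pi>\<^sub>E i\<in>UNIV. space N)" using sets_eq_imp_space_eq[OF assms] by (simp add: space_PiM)
  have X: "(\<lambda>\<omega>. \<omega> i) \<in> M \<rightarrow>\<^sub>M N" for i using assms by (simp cong: measurable_cong_sets)
  show "sigma_sets (space M) (\<Union>n. past M N (\<lambda>i \<omega>. \<omega> i) n) \<subseteq> sets M"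
    using past_subset[where X="\<lambda>i \<omega>. \<omega> i", OF X] by (intro sets.sigma_sets_subset) blast
  show "sets M \<subseteq> sigma_sets (space M) (\<Union>n. past M N (\<lambda>i \<omega>. \<omega> i) n)"
    unfolding assms sets_PiM_single sp
  proof (rule sigma_sets_mono, rule subsetI)
    fix E assume "E \<in> {{f \<in> \<Pi>\<^sub>E i\<in>UNIV. space N. f i \<in> A} | i A. i \<in> (UNIV :: nat set) \<and> A \<in> sets N}"
    then obtain i A where E: "E = {f \<in> \<Pi>\<^sub>E i\<in>UNIV. space N. f i \<in> A}" and A: "A \<in> sets N" by blast
    have "{z \<in> space (\<Pi>\<^sub>M i\<in>{..<Suc i}. N). z i \<in> A} \<in> sets (\<Pi>\<^sub>M i\<in>{..<Suc i}. N)" using A by measurable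
    from pastI[OF this, where X="\<lambda>i \<omega>. \<omega> i" and M=M] have "E \<in> past M N (\<lambda>i \<omega>. \<omega> i) (Suc i)"
      by (rule back_subst[of "\<lambda>A. A \<in> past M N (\<lambda>i \<omega>. \<omega> i) (Suc i)"]) (auto simp: E sp space_PiM PiE_iff)
    then show "E \<in> sigma_sets (\<Pi>\<^sub>E i\<in>UNIV. space N) (\<Union>n. past M N (\<lambda>i \<omega>. \<omega> i) n)" by blast
  qed
qed

section \<open>Convergence of empirical measures in the Prokhorov distance\<close>

context Metric_space
begin

lemma borel_measurable_measure_empirical:
  assumes f: "\<And>i. i < n \<Longrightarrow> (\<lambda>\<omega>. f \<omega> i) \<in> \<Omega> \<rightarrow>\<^sub>M borel_of mtopology" and n: "n \<ge> 1"
    and U: "U \<in> sets (borel_of mtopology)"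
  shows "(\<lambda>\<omega>. measure (empirical (borel_of mtopology) n (f \<omega>)) U) \<in> borel_measurable \<Omega>"
proof -
  have "real (card {i \<in> {..<n}. f \<omega> i \<in> U}) = (\<Sum>i<n. indicator U (f \<omega> i))" for \<omega>
    by (simp add: indicator_def sum.If_cases Int_def)
  moreover have "(\<lambda>\<omega>. (\<Sum>i<n. indicat_real U (f \<omega> i)) / real n) \<in> borel_measurable \<Omega>"
    using measurable_compose[OF f borel_measurable_indicator[OF U]]
    by (intro borel_measurable_divide borel_measurable_sum) auto
  ultimately show ?thesis by (simp add: measure_empirical[OF U n])
qed

lemma prokhorov_tendsto_if_weak_limit:
  assumes sc: "second_countable mtopology" and lim: "limitin (weak_topology mtopology) e \<mu> sequentially"
  shows "(\<lambda>n. dP \<mu> (e n)) \<longlonglongrightarrow> 0"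
proof (rule order_tendstoI)
  have \<mu>: "\<mu> \<in> prob_measures mtopology" using limitin_topspace[OF lim] by simp
  fix c :: real
  {
    assume "c < 0"
    then show "eventually (\<lambda>n. c < dP \<mu> (e n)) sequentially"
      using prokhorov_nonneg[OF \<mu>] by (auto intro!: always_eventually elim: less_le_trans)
  }
  assume "0 < c"
  then have "\<mu> \<in> {\<nu> \<in> prob_measures mtopology. dP \<mu> \<nu> < c}"
    using \<mu> by (simp add: prokhorov_self)
  then have "eventually (\<lambda>n. e n \<in> {\<nu> \<in> prob_measures mtopology. dP \<mu> \<nu> < c}) sequentially"
    using lim openin_weak_prokhorov_ball[OF sc \<mu>] unfolding limitin_def by blast
  then show "eventually (\<lambda>n. dP \<mu> (e n) < c) sequentially"
    by (rule eventually_mono) simp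
qed

text \<open>As \<open>rate\<close> tends to infinity, a bound on the weighted distances forces the
  distances to 0. This is how the limit of the empirical measures under a fixed \<open>p\<close> is
  recognised.\<close>

lemma tendsto_prokhorov_if_rate_bounded:
  assumes \<mu>: "\<mu> \<in> prob_measures mtopology"
    and fin: "(SUP n\<in>{2..}. ennreal (rate n * dP \<mu> (e n))) < \<infinity>"
  shows "(\<lambda>n. dP \<mu> (e n)) \<longlonglongrightarrow> 0"
proof -
  let ?s = "SUP n\<in>{2..}. ennreal (rate n * dP \<mu> (e n))"
  have le: "rate n * dP \<mu> (e n) \<le> enn2real ?s" if "n \<ge> 2" for n
  proof -
    have "ennreal (rate n * dP \<mu> (e n)) \<le> ?s" using that by (intro SUP_upper) auto
    also have "?s = ennreal (enn2real ?s)" using fin by simp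
    finally show ?thesis by (simp add: ennreal_le_iff)
  qed
  have "(\<lambda>n. enn2real ?s / rate n) \<longlonglongrightarrow> 0"
    using filterlim_rate by (intro real_tendsto_divide_at_top[OF tendsto_const])
  moreover have "eventually (\<lambda>n. norm (dP \<mu> (e n)) \<le> enn2real ?s / rate n) sequentially"
    using eventually_ge_at_top[of 2] filterlim_at_top_dense[THEN iffD1, OF filterlim_rate, rule_format, of 0]
  proof eventually_elim
    case (elim n)
    then show ?case using le[of n] prokhorov_nonneg[OF \<mu>, of "e n"] by (simp add: field_simps)
  qed
  ultimately show ?thesis by (rule Lim_null_comparison[rotated])
qed

end

theorem theorem5:
  fixes T S :: "'a topology" and d :: "'a \<Rightarrow> 'a \<Rightarrow> real" and X :: "'a set"
    and q :: "'a measure measure" and \<rho> :: "(nat \<Rightarrow> 'a) measure"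
    and pt :: "(nat \<Rightarrow> 'a) \<Rightarrow> 'a measure"
    and post :: "nat \<Rightarrow> (nat \<Rightarrow> 'a) \<Rightarrow> 'a measure measure"
    and e :: "nat \<Rightarrow> (nat \<Rightarrow> 'a) \<Rightarrow> 'a measure"
    and K :: "nat \<Rightarrow> 'a set" and k :: "nat \<Rightarrow> nat" and A :: "nat \<Rightarrow> nat \<Rightarrow> 'a set" and r :: real
    and Y :: "(nat \<Rightarrow> 'a) \<Rightarrow> ennreal"
  assumes polish: "completely_metrizable_space T" "separable_space T"
    and loc_compact: "locally_compact_space T"
    and dist: "Metric_space (topspace T) d" "Metric_space.mtopology (topspace T) d = T"
    and X: "X \<in> sets (borel_of T)"
    and S_eq: "S = subtopology T X"
    and q: "q \<in> prob_measures (weak_topology S)"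
    and rho: "\<rho> = mixture UNIV (borel_of S) q"
    and e_eq: "\<And>n \<omega>. e n \<omega> = empirical (borel_of S) n \<omega>"
    and pt_rv: "pt \<in> \<rho> \<rightarrow>\<^sub>M borel_of (weak_topology S)"
    and pt_distr: "distr \<rho> (borel_of (weak_topology S)) pt = q"
    and pt_lim: "AE \<omega> in \<rho>. limitin (weak_topology S) (\<lambda>n. e n \<omega>) (pt \<omega>) sequentially"
    and post: "\<And>n. n \<ge> 1 \<Longrightarrow>
      regular_cond_distr \<rho> (\<Pi>\<^sub>M i\<in>{..<n}. borel_of S) (\<lambda>\<omega>. restrict \<omega> {..<n})
        (borel_of (weak_topology S)) pt (post n)"
    and discr: "discretization T d K k A"
    and r: "r > 2"
    and Pi_L1: "(\<lambda>\<omega>. Pi_fun X k A r (pt \<omega>)) \<in> borel_measurable \<rho>"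
      "(\<integral>\<^sup>+\<omega>. Pi_fun X k A r (pt \<omega>) \<partial>\<rho>) < \<infinity>"
    and Y_eq: "\<And>\<omega>. Y \<omega> = ennreal_sqrt (ennreal (3 / 2) *
      limsup (\<lambda>n. ennreal (sqrt (real n / ln (real n)) * prokhorov S d (pt \<omega>) (e n \<omega>))))"
  shows "(AE \<omega> in \<rho>. Y \<omega> < \<infinity>) \<and>
    (AE \<omega> in \<rho>.
      limsup (\<lambda>n. ennreal ((real n / ln (real n)) powr (1 / 4) *
        prokhorov (weak_topology S) (prokhorov S d)
          (post n (restrict \<omega> {..<n})) (return (borel_of (weak_topology S)) (e n \<omega>)))) \<le> Y \<omega>) \<and>
    (\<forall>m\<ge>1. AE \<omega> in \<rho>.
      limsup (\<lambda>n. ennreal ((real n / ln (real n)) powr (1 / 8) *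
        prokhorov (sym_topology S d m) (sym_dist S d m)
          (sym_distr S d m (mixture {..<m} (borel_of S) (post n (restrict \<omega> {..<n}))))
          (sym_distr S d m (\<Pi>\<^sub>M i\<in>{..<m}. e n \<omega>))))
      \<le> ennreal_sqrt (ennreal (3 / 2) * Y \<omega>))"
proof -
  interpret T: Metric_space "topspace T" d by (rule dist)
  have XT: "X \<subseteq> topspace T" using sets.sets_into_space[OF X] by simp
  interpret M: Metric_space X d by (rule T.subspace[OF XT])
  have S: "M.mtopology = S"
  proof -
    interpret Submetric "topspace T" d X by unfold_locales (rule XT)
    show ?thesis using mtopology_submetric by (simp add: dist(2) S_eq)
  qed
  have sc: "second_countable M.mtopology"
    unfolding S S_eq using T.second_countable_if_separable polish(2) dist(2)
    by (intro second_countable_subtopology) simp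
  have met: "metrizable_space S" using M.metrizable_space_mtopology by (simp add: S)
  have topS: "topspace S = X" using M.topspace_mtopology by (simp add: S)
  note measurable_d = M.borel_measurable_prokhorov[OF sc, unfolded S]
  let ?W = "borel_of (weak_topology S)" and ?B = "borel_of S" and ?d = "prokhorov S d"
    and ?iid = "\<lambda>p. \<Pi>\<^sub>M i\<in>(UNIV::nat set). p"
  interpret q: prob_space q using q by (simp add: prob_measures_def)
  have sq: "sets q = sets ?W" using q by (simp add: prob_measures_def)
  have spq: "space q = prob_measures S" using sets_eq_imp_space_eq[OF sq] by simp
  interpret \<rho>: prob_space \<rho> unfolding rho by (rule prob_space_mixture[OF met q])
  have s\<rho>: "sets \<rho> = sets (\<Pi>\<^sub>M i\<in>(UNIV::nat set). ?B)" unfolding rho by (rule sets_mixture)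
  have sp\<rho>: "space \<rho> = (\<Pi>\<^sub>E i\<in>UNIV. X)" using sets_eq_imp_space_eq[OF s\<rho>] by (simp add: space_PiM topS)
  have coord: "(\<lambda>\<omega>. \<omega> i) \<in> \<rho> \<rightarrow>\<^sub>M ?B" for i :: nat using s\<rho> by (simp cong: measurable_cong_sets)
  have e_prob: "e n \<omega> \<in> prob_measures S" if "n \<ge> 1" "\<omega> \<in> {..<n} \<rightarrow> X" for n \<omega>
    unfolding e_eq using that by (intro empirical_prob_measures) (auto simp: topS)
  have e_prob\<rho>: "e n \<omega> \<in> prob_measures S" if "n \<ge> 1" "\<omega> \<in> space \<rho>" for n \<omega>
    using that by (intro e_prob) (auto simp: sp\<rho>)
  have pt_prob: "pt \<omega> \<in> prob_measures S" if "\<omega> \<in> space \<rho>" for \<omega>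
    using measurable_space[OF pt_rv that] by simp
  have weak_meas: "(\<lambda>p. measure p U) \<in> borel_measurable ?W" if "U \<in> sets ?B" for U
    using M.measurable_measure_weak[of "borel_of (weak_topology M.mtopology)" U] that by (simp add: S)
  have emp_meas: "(\<lambda>\<omega>. measure (empirical ?B n (f \<omega>)) U) \<in> borel_measurable \<Omega>"
    if "\<And>i. i < n \<Longrightarrow> (\<lambda>\<omega>. f \<omega> i) \<in> \<Omega> \<rightarrow>\<^sub>M ?B" "n \<ge> 1" "openin S U"
    for n U and f :: "'w \<Rightarrow> nat \<Rightarrow> 'a" and \<Omega> :: "'w measure"
    using M.borel_measurable_measure_empirical[of n f \<Omega> U] that borel_of_open[of S U] by (simp add: S)

  define D where "D n \<omega> = ennreal (rate n * ?d (pt \<omega>) (e n \<omega>))" for n \<omega>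
  have D_meas: "D n \<in> borel_measurable \<rho>" if n: "n \<ge> 2" for n
  proof -
    have "(\<lambda>\<omega>. ?d (pt \<omega>) (e n \<omega>)) \<in> borel_measurable \<rho>"
    proof (rule measurable_d)
      show "(\<lambda>\<omega>. measure (pt \<omega>) U) \<in> borel_measurable \<rho>" if "openin S U" for U
        using measurable_compose[OF pt_rv weak_meas[OF borel_of_open[OF that]]] .
      show "(\<lambda>\<omega>. measure (e n \<omega>) U) \<in> borel_measurable \<rho>" if "openin S U" for U
        unfolding e_eq using n that by (intro emp_meas coord) auto
    qed (use pt_prob e_prob\<rho> n in auto)
    then show ?thesis unfolding D_def by measurable
  qed
  have D_SUP_meas: "(\<lambda>\<omega>. SUP n\<in>{2..}. D n \<omega>) \<in> borel_measurable \<rho>"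
    using D_meas by (intro borel_measurable_SUP) auto

  define C where "C m j = A m j \<inter> X" for m j
  have A_sets: "A m j \<in> sets (borel_of T)" if m: "m \<ge> 1" and j: "j \<in> {1..k m + 1}" for m j
  proof (cases "j = k m + 1")
    case True
    \<comment> \<open>Compact sets in a Hausdorff space are closed, so the outer cell is
      open.\<close>
    have "closedin T (K m)"
      using discr m T.Hausdorff_space_mtopology
      by (intro compactin_imp_closedin) (auto simp: discretization_def dist(2))
    then have "openin T (topspace T - K m)" by (rule openin_diff[OF openin_topspace])
    moreover have "A m j = topspace T - K m" using discr m True by (simp add: discretization_def)
    ultimately show ?thesis by (simp add: borel_of_open)
  next
    case False
    then have "j \<in> {1..k m}" using j by auto
    then show ?thesis using discr m by (simp add: discretization_def)
  qed
  have C_sets: "C m j \<in> sets ?B" if "m \<ge> 1" "j \<in> {1..k m + 1}" for m j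
    unfolding C_def S_eq by (rule sets_borel_of_subtopology[OF A_sets[OF that]])
  have C_last: "C m (k m + 1) = X - K m" if "m \<ge> 1" for m
    using discr that XT by (auto simp: discretization_def C_def)
  \<comment> \<open>Here \<open>p\<close> is fixed and the sample has law \<open>?iid p\<close>; the
    random measure \<open>pt\<close> comes in only after it has been identified with
    \<open>p\<close>.\<close>
  have sup_bound: "(\<integral>\<^sup>+\<omega>. (SUP n\<in>{2..}. ennreal (rate n * ?d p (e n \<omega>))) \<partial>(?iid p))
      \<le> ennreal (sup_const (min r 4)) * Pi_fun X k A r p" if p: "p \<in> prob_measures S" for p
    unfolding e_eq Pi_fun_def C_def[symmetric]
  proof (rule M.nn_integral_sup_prokhorov_empirical[unfolded S, OF p r])
    fix m :: nat assume m: "m \<ge> 1"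
    show "C m j \<in> sets ?B" if "j \<in> {1..k m + 1}" for j by (rule C_sets[OF m that])
    have "disjoint_family_on (A m) {1..k m}" using discr m by (simp add: discretization_def)
    then show "disjoint_family_on (C m) {1..k m}" unfolding disjoint_family_on_def C_def by blast
    have "(\<Union>j\<in>{1..k m}. A m j) = K m" using discr m by (simp add: discretization_def)
    then have "(\<Union>j\<in>{1..k m}. C m j) = K m \<inter> X" by (auto simp: C_def)
    moreover have "(\<Union>j\<in>{1..k m + 1}. C m j) = (\<Union>j\<in>{1..k m}. C m j) \<union> C m (k m + 1)"
      by (simp add: atLeastAtMostSuc_conv Un_commute)
    ultimately show "(\<Union>j\<in>{1..k m + 1}. C m j) = X" unfolding C_last[OF m] by auto
    show "d x y \<le> 1 / real m" if "j \<in> {1..k m}" "x \<in> C m j" "y \<in> C m j" for j x y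
      using discr m that unfolding discretization_def C_def by blast
    have "K m \<subseteq> K (Suc m)" using discr m by (simp add: discretization_def)
    then show "C (Suc m) (k (Suc m) + 1) \<subseteq> C m (k m + 1)"
      using C_last[OF m] C_last[of "Suc m"] m by auto
  next
    have "(\<Union>m\<in>{1..}. K m) = topspace T" using discr by (simp add: discretization_def)
    then show "(\<Inter>m\<in>{1..}. C m (k m + 1)) = {}"
      using XT C_last by auto
  qed

  have Pi_meas: "Pi_fun X k A r \<in> borel_measurable q"
  proof -
    \<comment> \<open>The shift by one avoids the sets of index 0, on which
      \<open>discretization\<close> imposes nothing, so that they may fail to be measurable.\<close>
    have "Pi_fun X k A r p = liminf (\<lambda>m. ennreal (\<Sum>j=1..k (m + 1) + 1.
        (measure p (C (m + 1) j) * (1 - measure p (C (m + 1) j))) powr (1 / r)))" for p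
      unfolding Pi_fun_def C_def
      by (rule liminf_shift[of "\<lambda>m. ennreal (\<Sum>j=1..k m + 1. (measure p (A m j \<inter> X) * (1 - measure p (A m j \<inter> X))) powr (1 / r))", symmetric])
    moreover have "(\<lambda>p. liminf (\<lambda>m. ennreal (\<Sum>j=1..k (m + 1) + 1.
        (measure p (C (m + 1) j) * (1 - measure p (C (m + 1) j))) powr (1 / r)))) \<in> borel_measurable q"
    proof (intro borel_measurable_liminf measurable_compose[OF _ measurable_ennreal] borel_measurable_sum)
      fix m j :: nat assume "j \<in> {1..k (m + 1) + 1}"
      then have "C (m + 1) j \<in> sets ?B" by (intro C_sets) auto
      from weak_meas[OF this] sq have [measurable]: "(\<lambda>p. measure p (C (m + 1) j)) \<in> borel_measurable q"
        by (simp cong: measurable_cong_sets)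
      show "(\<lambda>p. (measure p (C (m + 1) j) * (1 - measure p (C (m + 1) j))) powr (1 / r)) \<in> borel_measurable q"
        by measurable
    qed
    ultimately show ?thesis by (simp only: fun_eq_iff[symmetric] cong: measurable_cong)
  qed
  have Pi_int: "(\<integral>\<^sup>+p. Pi_fun X k A r p \<partial>q) < \<infinity>"
  proof -
    have Pi': "Pi_fun X k A r \<in> borel_measurable ?W" using Pi_meas sq by (simp cong: measurable_cong_sets)
    have "(\<integral>\<^sup>+p. Pi_fun X k A r p \<partial>q) = (\<integral>\<^sup>+\<omega>. Pi_fun X k A r (pt \<omega>) \<partial>\<rho>)"
      unfolding pt_distr[symmetric] using Pi' by (intro nn_integral_distr pt_rv) simp
    then show ?thesis using Pi_L1(2) by simp
  qed

  \<comment> \<open>Under \<open>p\<^sup>\<infinity>\<close> the empirical measures converge to \<open>p\<close>, so the joint law of \<open>pt\<close> and the sample is explicit.\<close>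
  have ident: "AE p in q. AE \<omega> in (?iid p). pt \<omega> = p"
  proof -
    have "AE \<omega> in \<rho>. pt \<omega> \<in> prob_measures S \<and> limitin (weak_topology S) (\<lambda>n. e n \<omega>) (pt \<omega>) sequentially"
      using pt_lim pt_prob by (auto intro: AE_conjI)
    then have lim: "AE p in q. AE \<omega> in (?iid p).
        pt \<omega> \<in> prob_measures S \<and> limitin (weak_topology S) (\<lambda>n. e n \<omega>) (pt \<omega>) sequentially"
      unfolding rho by (rule AE_mixture[OF met sq q.not_empty])
    \<comment> \<open>Through \<open>sup_bound\<close>, finiteness at \<open>p\<close> keeps the
      weighted distances to \<open>p\<close> bounded almost surely under \<open>?iid p\<close>,
      which yields convergence to \<open>p\<close>.\<close>
    have "AE p in q. Pi_fun X k A r p \<noteq> \<infinity>"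
      using Pi_int by (intro nn_integral_PInf_AE[OF Pi_meas]) simp
    with lim AE_space show ?thesis
    proof eventually_elim
      case (elim p)
      then have p: "p \<in> prob_measures S" by (simp add: spq)
      let ?P = "?iid p"
      have sp: "sets p = sets ?B" "space p = X" using p sets_eq_imp_space_eq[of p ?B] by (auto simp: prob_measures_def topS)
      have spP: "space ?P = (\<Pi>\<^sub>E i\<in>UNIV. X)" by (simp add: space_PiM sp)
      let ?s = "\<lambda>\<omega>. SUP n\<in>{2..}. ennreal (rate n * ?d p (e n \<omega>))"
      have "(\<lambda>\<omega>. ?d p (e n \<omega>)) \<in> borel_measurable ?P" if n: "n \<ge> 2" for n
      proof (rule measurable_d)
        show "(\<lambda>\<omega>. measure (e n \<omega>) U) \<in> borel_measurable ?P" if "openin S U" for U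
        proof -
          have "(\<lambda>\<omega>. \<omega> i) \<in> ?P \<rightarrow>\<^sub>M ?B" for i
            using measurable_component_singleton[of i UNIV "\<lambda>_. p"] sp by (simp cong: measurable_cong_sets)
          then show ?thesis unfolding e_eq using n that by (intro emp_meas) auto
        qed
        show "e n \<omega> \<in> prob_measures S" if "\<omega> \<in> space ?P" for \<omega>
          using that n by (intro e_prob) (auto simp: spP)
      qed (use p in auto)
      then have s_meas: "?s \<in> borel_measurable ?P" by (intro borel_measurable_SUP) auto
      have "(\<integral>\<^sup>+\<omega>. ?s \<omega> \<partial>?P) < \<infinity>"
        using sup_bound[OF p] elim by (auto simp: less_top[symmetric] ennreal_mult_eq_top_iff top_unique)
      then have "AE \<omega> in ?P. ?s \<omega> \<noteq> \<infinity>" by (intro nn_integral_PInf_AE[OF s_meas]) simp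
      with elim(1) AE_space show ?case
      proof eventually_elim
        case (elim \<omega>)
        have pt\<omega>: "pt \<omega> \<in> prob_measures S" using elim by simp
        have e\<omega>: "e n \<omega> \<in> prob_measures S" if "n \<ge> 1" for n
          using that elim(2) by (intro e_prob) (auto simp: spP)
        have "(\<lambda>n. ?d (pt \<omega>) (e n \<omega>)) \<longlonglongrightarrow> 0"
          using M.prokhorov_tendsto_if_weak_limit[OF sc] elim(1) by (simp add: S)
        moreover have "(\<lambda>n. ?d p (e n \<omega>)) \<longlonglongrightarrow> 0"
          using elim(3) by (intro M.tendsto_prokhorov_if_rate_bounded[unfolded S, OF p]) (simp only: less_top infinity_ennreal_def)
        \<comment> \<open>\<open>pt \<omega>\<close> and \<open>p\<close> are limits of the same
          empirical measures, so the triangle inequality identifies them.\<close>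
        ultimately have "(\<lambda>n. ?d (pt \<omega>) (e n \<omega>) + ?d p (e n \<omega>)) \<longlonglongrightarrow> 0 + 0" by (rule tendsto_add)
        moreover have "?d (pt \<omega>) p \<le> ?d (pt \<omega>) (e n \<omega>) + ?d p (e n \<omega>)" if "n \<ge> 1" for n
          using M.prokhorov_triangle[unfolded S, OF pt\<omega> e\<omega>[OF that] p]
            M.prokhorov_commute[unfolded S, OF p e\<omega>[OF that]] by simp
        ultimately have "?d (pt \<omega>) p \<le> 0"
          by (intro LIMSEQ_le_const[where X="\<lambda>n. ?d (pt \<omega>) (e n \<omega>) + ?d p (e n \<omega>)"]) (auto intro!: exI[of _ 1])
        then have "?d (pt \<omega>) p = 0" using M.prokhorov_nonneg[unfolded S, OF pt\<omega>, of p] by simp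
        then show ?case using M.prokhorov_eq_0_iff[unfolded S, OF pt\<omega> p] by simp
      qed
    qed
  qed

  have D_int: "(\<integral>\<^sup>+\<omega>. (SUP n\<in>{2..}. D n \<omega>) \<partial>\<rho>) < \<infinity>"
  proof -
    have "(\<lambda>\<omega>. SUP n\<in>{2..}. D n \<omega>) \<in> borel_measurable (\<Pi>\<^sub>M i\<in>(UNIV::nat set). ?B)"
      using D_SUP_meas s\<rho> by (simp cong: measurable_cong_sets)
    then have "(\<integral>\<^sup>+\<omega>. (SUP n\<in>{2..}. D n \<omega>) \<partial>\<rho>) = (\<integral>\<^sup>+p. (\<integral>\<^sup>+\<omega>. (SUP n\<in>{2..}. D n \<omega>) \<partial>(?iid p)) \<partial>q)"
      unfolding rho by (intro nn_integral_mixture[OF met sq q.not_empty])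
    also have "\<dots> \<le> (\<integral>\<^sup>+p. ennreal (sup_const (min r 4)) * Pi_fun X k A r p \<partial>q)"
    proof (rule nn_integral_mono_AE)
      \<comment> \<open>By \<open>ident\<close>, \<open>pt\<close> may be replaced by
        \<open>p\<close> in the inner integral, which makes \<open>sup_bound\<close>
        applicable.\<close>
      show "AE p in q. (\<integral>\<^sup>+\<omega>. (SUP n\<in>{2..}. D n \<omega>) \<partial>(?iid p))
          \<le> ennreal (sup_const (min r 4)) * Pi_fun X k A r p"
        using ident AE_space
      proof eventually_elim
        case (elim p)
        have "(\<integral>\<^sup>+\<omega>. (SUP n\<in>{2..}. D n \<omega>) \<partial>(?iid p)) =
            (\<integral>\<^sup>+\<omega>. (SUP n\<in>{2..}. ennreal (rate n * ?d p (e n \<omega>))) \<partial>(?iid p))"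
          using elim(1) by (intro nn_integral_cong_AE) (auto simp: D_def elim!: eventually_mono)
        also have "\<dots> \<le> ennreal (sup_const (min r 4)) * Pi_fun X k A r p"
          using elim(2) by (intro sup_bound) (simp add: spq)
        finally show ?case .
      qed
    qed
    also have "\<dots> = ennreal (sup_const (min r 4)) * (\<integral>\<^sup>+p. Pi_fun X k A r p \<partial>q)"
      by (rule nn_integral_cmult[OF Pi_meas])
    also have "\<dots> < \<infinity>" using Pi_int by (simp add: ennreal_mult_less_top)
    finally show ?thesis .
  qed

  let ?Z = "\<lambda>n \<omega>. restrict \<omega> {..<n}"
  have Z: "?Z n \<in> \<rho> \<rightarrow>\<^sub>M (\<Pi>\<^sub>M i\<in>{..<n}. ?B)" for n
    using measurable_past_restrict[where X="\<lambda>i \<omega>. \<omega> i", OF coord] by simp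
  have post_prob: "post n z \<in> prob_measures (weak_topology S)" if "n \<ge> 1" "z \<in> space (\<Pi>\<^sub>M i\<in>{..<n}. ?B)" for n z
    using measurable_space[of "post n" _ "prob_algebra ?W"] post[OF that(1)] that(2)
    by (auto simp: regular_cond_distr_def space_prob_algebra prob_measures_def)
  have e_Z: "empirical ?B n (?Z n \<omega>) = e n \<omega>" for n \<omega>
    unfolding e_eq by (rule empirical_cong) simp
  \<comment> \<open>The posterior integral as a function of the sample alone, which makes it
    measurable with respect to the first \<open>n\<close> observations.\<close>
  define h where "h n z = (\<integral>\<^sup>+p. ennreal (rate n * ?d p (empirical ?B n z)) \<partial>post n z)" for n z
  have joint: "(\<lambda>(z, p). ennreal (rate n * ?d p (empirical ?B n z))) \<in> borel_measurable ((\<Pi>\<^sub>M i\<in>{..<n}. ?B) \<Otimes>\<^sub>M ?W)"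
    if n: "n \<ge> 2" for n
  proof -
    have "(\<lambda>x. ?d (snd x) (empirical ?B n (fst x))) \<in> borel_measurable ((\<Pi>\<^sub>M i\<in>{..<n}. ?B) \<Otimes>\<^sub>M ?W)"
    proof (rule measurable_d)
      fix x assume x: "x \<in> space ((\<Pi>\<^sub>M i\<in>{..<n}. ?B) \<Otimes>\<^sub>M ?W)"
      then show "snd x \<in> prob_measures S" by (simp add: space_pair_measure mem_Times_iff)
      have "fst x \<in> (\<Pi>\<^sub>E i\<in>{..<n}. topspace S)" using x by (simp add: space_pair_measure space_PiM mem_Times_iff)
      then show "empirical ?B n (fst x) \<in> prob_measures S"
        using n by (intro empirical_prob_measures) (auto simp: PiE_iff)
    next
      show "(\<lambda>x. measure (snd x) U) \<in> borel_measurable ((\<Pi>\<^sub>M i\<in>{..<n}. ?B) \<Otimes>\<^sub>M ?W)" if "openin S U" for U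
        by (rule measurable_compose[OF measurable_snd weak_meas[OF borel_of_open[OF that]]])
      show "(\<lambda>x. measure (empirical ?B n (fst x)) U) \<in> borel_measurable ((\<Pi>\<^sub>M i\<in>{..<n}. ?B) \<Otimes>\<^sub>M ?W)" if "openin S U" for U
      proof (rule emp_meas)
        fix i assume "i < n"
        then show "(\<lambda>x. fst x i) \<in> (\<Pi>\<^sub>M i\<in>{..<n}. ?B) \<Otimes>\<^sub>M ?W \<rightarrow>\<^sub>M ?B"
          by (intro measurable_compose[OF measurable_fst measurable_component_singleton]) simp
      qed (use n that in simp_all)
    qed
    then show ?thesis by (simp add: case_prod_beta')
  qed
  have cond_le: "AE \<omega> in \<rho>. limsup (\<lambda>n. h n (?Z n \<omega>)) \<le> limsup (\<lambda>n. D n \<omega>)"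
  proof (rule \<rho>.limsup_cond_le_limsup[where X="\<lambda>i \<omega>. \<omega> i" and N="?B" and ?n0.0=2, OF coord sets_PiM_eq_past[OF s\<rho>]])
    show "(\<integral>\<^sup>+\<omega>. (SUP n\<in>{2..}. D n \<omega>) \<partial>\<rho>) < \<infinity>" by (rule D_int)
    fix n :: nat assume n: "2 \<le> n"
    then have n1: "1 \<le> n" by simp
    show "D n \<in> borel_measurable \<rho>" by (rule D_meas[OF n])
    have kernel: "post n \<in> (\<Pi>\<^sub>M i\<in>{..<n}. ?B) \<rightarrow>\<^sub>M subprob_algebra ?W"
      using post[OF n1] by (auto simp: regular_cond_distr_def intro: measurable_prob_algebraD)
    show "h n \<in> borel_measurable (\<Pi>\<^sub>M i\<in>{..<n}. ?B)"
      unfolding h_def[abs_def] by (rule nn_integral_measurable_subprob_algebra2[OF joint[OF n] kernel])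
    fix B assume B: "B \<in> sets (\<Pi>\<^sub>M i\<in>{..<n}. ?B)"
    \<comment> \<open>With the indicator of the conditioning event inside the integrand, one use of
      \<open>nn_integral_regular_cond_distr\<close> gives the conditional expectation
      identity.\<close>
    let ?f = "\<lambda>x. (case x of (z, p) \<Rightarrow> ennreal (rate n * ?d p (empirical ?B n z))) * indicator B (fst x)"
    have f: "?f \<in> borel_measurable ((\<Pi>\<^sub>M i\<in>{..<n}. ?B) \<Otimes>\<^sub>M ?W)"
      using joint[OF n] measurable_compose[OF measurable_fst borel_measurable_indicator[OF B]]
      by (rule borel_measurable_times_ennreal)
    have "(\<integral>\<^sup>+\<omega>\<in>?Z n -` B \<inter> space \<rho>. D n \<omega> \<partial>\<rho>) = (\<integral>\<^sup>+\<omega>. ?f (?Z n \<omega>, pt \<omega>) \<partial>\<rho>)"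
      by (intro nn_integral_cong) (auto simp: D_def e_Z split: split_indicator)
    also have "\<dots> = (\<integral>\<^sup>+\<omega>. (\<integral>\<^sup>+p. ?f (?Z n \<omega>, p) \<partial>post n (?Z n \<omega>)) \<partial>\<rho>)"
      by (rule nn_integral_regular_cond_distr[OF \<rho>.prob_space_axioms Z pt_rv post[OF n1] f])
    also have "\<dots> = (\<integral>\<^sup>+\<omega>\<in>?Z n -` B \<inter> space \<rho>. h n (?Z n \<omega>) \<partial>\<rho>)"
      by (intro nn_integral_cong) (auto simp: h_def split: split_indicator)
    finally show "(\<integral>\<^sup>+\<omega>\<in>?Z n -` B \<inter> space \<rho>. h n (?Z n \<omega>) \<partial>\<rho>) = (\<integral>\<^sup>+\<omega>\<in>?Z n -` B \<inter> space \<rho>. D n \<omega> \<partial>\<rho>)" by simp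
  qed

  define E where "E n \<omega> = (\<integral>p. ?d p (e n \<omega>) \<partial>post n (?Z n \<omega>))" for n \<omega>
  have Zsp: "?Z n \<omega> \<in> space (\<Pi>\<^sub>M i\<in>{..<n}. ?B)" if "\<omega> \<in> space \<rho>" for n \<omega>
    using measurable_space[OF Z that] .
  have E_nonneg: "0 \<le> E n \<omega>" if "\<omega> \<in> space \<rho>" "n \<ge> 1" for n \<omega>
  proof -
    have "space (post n (?Z n \<omega>)) = prob_measures S"
      using post_prob[OF that(2) Zsp[OF that(1)]] sets_eq_imp_space_eq[of _ ?W] by (auto simp: prob_measures_def)
    then show ?thesis unfolding E_def
      by (intro Bochner_Integration.integral_nonneg) (auto intro: M.prokhorov_nonneg[unfolded S])
  qed
  \<comment> \<open>Back to real integrals, in which the square root bounds are stated.\<close>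
  have h_E: "h n (?Z n \<omega>) = ennreal (rate n * E n \<omega>)" if \<omega>: "\<omega> \<in> space \<rho>" and n: "n \<ge> 1" for n \<omega>
  proof -
    note Q = post_prob[OF n Zsp[OF \<omega>]]
    have "space (post n (?Z n \<omega>)) = prob_measures S"
      using Q sets_eq_imp_space_eq[of _ ?W] by (auto simp: prob_measures_def)
    then show ?thesis
      unfolding h_def e_Z E_def
      using M.integrable_prokhorov[unfolded S, OF sc[unfolded S] Q e_prob\<rho>[OF n \<omega>]]
      by (subst nn_integral_eq_integral) (auto intro!: AE_I2 mult_nonneg_nonneg M.prokhorov_nonneg[unfolded S])
  qed
  have D_fin: "AE \<omega> in \<rho>. (SUP n\<in>{2..}. D n \<omega>) \<noteq> \<infinity>"
    using D_int by (intro nn_integral_PInf_AE[OF D_SUP_meas]) simp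
  \<comment> \<open>One exceptional set for all that follows; outside it the limsup of
    \<open>D n\<close> is a real number \<open>l\<close>.\<close>
  have main: "AE \<omega> in \<rho>. \<omega> \<in> space \<rho> \<and> (\<exists>l\<ge>0. limsup (\<lambda>n. D n \<omega>) = ennreal l \<and> limsup (\<lambda>n. ennreal (rate n * E n \<omega>)) \<le> ennreal l)"
    using D_fin cond_le AE_space
  proof eventually_elim
    case (elim \<omega>)
    have "limsup (\<lambda>n. D n \<omega>) \<le> (SUP n\<in>{2..}. D n \<omega>)"
      by (rule Limsup_bounded) (auto simp: eventually_sequentially intro!: exI[of _ 2] SUP_upper)
    then obtain l where l: "0 \<le> l" "limsup (\<lambda>n. D n \<omega>) = ennreal l"
      using elim(1) by (cases "limsup (\<lambda>n. D n \<omega>)") (auto simp: top_unique)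
    have "limsup (\<lambda>n. ennreal (rate n * E n \<omega>)) = limsup (\<lambda>n. h n (?Z n \<omega>))"
      by (rule Limsup_eq) (auto simp: eventually_sequentially h_E[OF elim(3)] intro!: exI[of _ 1])
    then show ?case using elim l by auto
  qed
  have Y: "Y \<omega> = ennreal (sqrt (3 / 2 * l))" if "limsup (\<lambda>n. D n \<omega>) = ennreal l" "0 \<le> l" for \<omega> l
  proof -
    have "Y \<omega> = ennreal_sqrt (ennreal (3 / 2) * limsup (\<lambda>n. D n \<omega>))" unfolding Y_eq D_def rate_def ..
    also have "ennreal (3 / 2) * limsup (\<lambda>n. D n \<omega>) = ennreal (3 / 2 * l)" using that by (simp only: ennreal_mult')
    finally show ?thesis using that(2) by (simp add: ennreal_sqrt_def)
  qed
  have powr4: "(real n / ln (real n)) powr (1 / 4) = sqrt (rate n)" if "n \<ge> 2" for n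
    using that by (simp add: rate_def powr_half_sqrt[symmetric] powr_powr)
  have powr8: "(real n / ln (real n)) powr (1 / 8) = sqrt (sqrt (rate n))" if "n \<ge> 2" for n
    using that by (simp add: rate_def powr_half_sqrt[symmetric] powr_powr)

  let ?D1 = "\<lambda>n \<omega>. prokhorov (weak_topology S) ?d (post n (?Z n \<omega>)) (return ?W (e n \<omega>))"
  let ?D2 = "\<lambda>m n \<omega>. prokhorov (sym_topology S d m) (sym_dist S d m)
    (sym_distr S d m (mixture {..<m} ?B (post n (?Z n \<omega>)))) (sym_distr S d m (\<Pi>\<^sub>M i\<in>{..<m}. e n \<omega>))"
  show ?thesis
  proof (intro conjI allI impI)
    show "AE \<omega> in \<rho>. Y \<omega> < \<infinity>" using main by (rule eventually_mono) (auto simp: Y)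
  next
    show "AE \<omega> in \<rho>. limsup (\<lambda>n. ennreal ((real n / ln (real n)) powr (1 / 4) * ?D1 n \<omega>)) \<le> Y \<omega>"
      using main
    proof eventually_elim
      case (elim \<omega>)
      then obtain l where \<omega>: "\<omega> \<in> space \<rho>" and l: "0 \<le> l" "limsup (\<lambda>n. D n \<omega>) = ennreal l"
        "limsup (\<lambda>n. ennreal (rate n * E n \<omega>)) \<le> ennreal l" by blast
      have "limsup (\<lambda>n. ennreal ((real n / ln (real n)) powr (1 / 4) * ?D1 n \<omega>)) \<le> ennreal (sqrt l)"
      proof (rule limsup_ennreal_sqrt_le[OF l(1,3)])
        show "eventually (\<lambda>n. (real n / ln (real n)) powr (1 / 4) * ?D1 n \<omega> \<le> sqrt (rate n * E n \<omega>)) sequentially"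
          using eventually_ge_at_top[of 2]
        proof eventually_elim
          case (elim n)
          then have n: "n \<ge> 1" by simp
          have "?D1 n \<omega> \<le> sqrt (E n \<omega>)"
            unfolding E_def
            by (rule M.prokhorov_return_le_sqrt[unfolded S, OF sc[unfolded S] post_prob[OF n Zsp[OF \<omega>]] e_prob\<rho>[OF n \<omega>]])
          then show ?case unfolding powr4[OF elim] real_sqrt_mult by (rule mult_left_mono) simp
        qed
      qed
      \<comment> \<open>The argument gives \<open>sqrt l\<close>; the factor \<open>3 / 2\<close> in
        \<open>Y\<close> is slack.\<close>
      also have "\<dots> \<le> Y \<omega>" unfolding Y[OF l(2,1)] using l(1) by (intro ennreal_leI) simp
      finally show ?case .
    qed
  next
    fix m :: nat assume m: "m \<ge> 1"
    show "AE \<omega> in \<rho>. limsup (\<lambda>n. ennreal ((real n / ln (real n)) powr (1 / 8) * ?D2 m n \<omega>))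
      \<le> ennreal_sqrt (ennreal (3 / 2) * Y \<omega>)"
      using main
    proof eventually_elim
      case (elim \<omega>)
      then obtain l where \<omega>: "\<omega> \<in> space \<rho>" and l: "0 \<le> l" "limsup (\<lambda>n. D n \<omega>) = ennreal l"
        "limsup (\<lambda>n. ennreal (rate n * E n \<omega>)) \<le> ennreal l" by blast
      let ?x = "\<lambda>n. sqrt (rate n) * (2 * real m * E n \<omega>)"
      \<comment> \<open>The exponent \<open>1/8\<close> is not sharp for this bound: the left-hand side even vanishes.\<close>
      have "?x \<longlonglongrightarrow> 0"
      proof (rule Lim_null_comparison)
        \<comment> \<open>\<open>?x n\<close> is
          \<open>2 * m * (rate n * E n \<omega>) / sqrt (rate n)\<close> for large \<open>n\<close>,
          and \<open>rate n * E n \<omega>\<close> is eventually below \<open>l + 1\<close>.\<close>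
        show "(\<lambda>n. 2 * real m * (l + 1) / sqrt (rate n)) \<longlonglongrightarrow> 0"
          by (intro real_tendsto_divide_at_top[OF tendsto_const] filterlim_compose[OF sqrt_at_top filterlim_rate])
        have "limsup (\<lambda>n. ennreal (rate n * E n \<omega>)) < ennreal (l + 1)"
          using l(1) by (intro le_less_trans[OF l(3)]) (simp add: ennreal_less_iff)
        then have "eventually (\<lambda>n. ennreal (rate n * E n \<omega>) < ennreal (l + 1)) sequentially" by (rule Limsup_lessD)
        with eventually_ge_at_top[of 2] filterlim_at_top_dense[THEN iffD1, OF filterlim_rate, rule_format, of 0]
        show "eventually (\<lambda>n. norm (?x n) \<le> 2 * real m * (l + 1) / sqrt (rate n)) sequentially"
        proof eventually_elim
          case (elim n)
          have E0: "0 \<le> E n \<omega>" using E_nonneg[OF \<omega>, of n] elim(1) by simp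
          then have "rate n * E n \<omega> < l + 1"
            using elim(3) ennreal_less_iff[of "rate n * E n \<omega>" "l + 1"] by (simp del: ennreal_plus)
          then have "2 * real m * (rate n * E n \<omega>) \<le> 2 * real m * (l + 1)" by (intro mult_left_mono) auto
          moreover have "norm (?x n) * sqrt (rate n) = 2 * real m * (rate n * E n \<omega>)"
          proof -
            have "norm (?x n) * sqrt (rate n) = 2 * real m * (sqrt (rate n) * sqrt (rate n) * E n \<omega>)"
              using E0 by (simp add: abs_mult)
            then show ?thesis by simp
          qed
          ultimately show ?case using elim(2) by (simp add: pos_le_divide_eq)
        qed
      qed
      then have "(\<lambda>n. ennreal (?x n)) \<longlonglongrightarrow> ennreal 0" by (rule tendsto_ennrealI)
      then have x: "limsup (\<lambda>n. ennreal (?x n)) \<le> ennreal 0"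
        using lim_imp_Limsup[OF sequentially_bot] by simp
      have "limsup (\<lambda>n. ennreal ((real n / ln (real n)) powr (1 / 8) * ?D2 m n \<omega>)) \<le> ennreal (sqrt 0)"
      proof (rule limsup_ennreal_sqrt_le[OF order_refl x])
        show "eventually (\<lambda>n. (real n / ln (real n)) powr (1 / 8) * ?D2 m n \<omega>
          \<le> sqrt (?x n)) sequentially"
          using eventually_ge_at_top[of 2]
        proof eventually_elim
          case (elim n)
          then have n: "n \<ge> 1" by simp
          have "?D2 m n \<omega>
            \<le> sqrt (2 * real m * E n \<omega>)"
            unfolding E_def
            by (rule M.prokhorov_sym_mixture_le_sqrt[unfolded S, OF sc[unfolded S] m post_prob[OF n Zsp[OF \<omega>]] e_prob\<rho>[OF n \<omega>]])
          then show ?case unfolding powr8[OF elim] real_sqrt_mult[of "sqrt (rate n)"] by (rule mult_left_mono) simp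
        qed
      qed
      then show ?case by simp
    qed
  qed
qed

end
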